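(* For $a>0$ let $\mathsf R_a=(-\tfrac a2,\tfrac a2)\times(-\tfrac1{2a},\tfrac1{2a})\subset\mathbb R^2$, and let $\varphi^{\mathsf R_a}_{\rm m}$ be the maximum of the torsion function of $\mathsf R_a$. Then for all $a>0$, \[ \varphi_{\rm m}^{\mathsf R_1}-\varphi_{\rm m}^{\mathsf R_a}\ \ge\ \frac{(a^2-1)^2}{24(1+a^4)}. \]
   Context: For a bounded domain $\Omega\subset\mathbb R^2$, the torsion function $\varphi^\Omega$ is the unique solution in $H^1_0(\Omega)$ of $-\Delta\varphi^\Omega=1$ in $\Omega$, $\varphi^\Omega=0$ on $\partial\Omega$. It is positive in $\Omega$, and $\varphi^\Omega_{\rm m}$ denotes its maximum over $\Omega$. *)

theory Defs
  imports "HOL-Analysis.Analysis"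
begin

definition grad :: "('a::euclidean_space \<Rightarrow> real) \<Rightarrow> 'a \<Rightarrow> 'a" where
  "grad f x = (\<Sum>b\<in>Basis. frechet_derivative f (at x) b *\<^sub>R b)"

text \<open>\<open>C_diff k f\<close> says that \<open>f\<close> is of class \<open>C\<close>-\<open>k\<close> on the whole space; since
  \<open>frechet_derivative\<close> is unspecified where \<open>f\<close> is not differentiable, differentiability is
  demanded separately at each step.\<close>

primrec C_diff :: "nat \<Rightarrow> ('a::euclidean_space \<Rightarrow> real) \<Rightarrow> bool" where
  "C_diff 0 f \<longleftrightarrow> continuous_on UNIV f"
| "C_diff (Suc k) f \<longleftrightarrow>
     (\<forall>x. f differentiable (at x)) \<and> (\<forall>b\<in>Basis. C_diff k (\<lambda>x. frechet_derivative f (at x) b))"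

definition test_function :: "('a::euclidean_space) set \<Rightarrow> ('a \<Rightarrow> real) \<Rightarrow> bool" where
  "test_function \<Omega> \<psi> \<longleftrightarrow>
     (\<forall>k. C_diff k \<psi>) \<and> compact (closure {x. \<psi> x \<noteq> 0}) \<and> closure {x. \<psi> x \<noteq> 0} \<subseteq> \<Omega>"

definition L2 :: "('a::euclidean_space) set \<Rightarrow> ('a \<Rightarrow> 'b::euclidean_space) set" where
  "L2 \<Omega> = {f \<in> borel_measurable (lebesgue_on \<Omega>). integrable (lebesgue_on \<Omega>) (\<lambda>x. (norm (f x))\<^sup>2)}"

definition weak_gradient ::
    "('a::euclidean_space) set \<Rightarrow> ('a \<Rightarrow> real) \<Rightarrow> ('a \<Rightarrow> 'a) \<Rightarrow> bool" where
  "weak_gradient \<Omega> u g \<longleftrightarrow> u \<in> L2 \<Omega> \<and> g \<in> L2 \<Omega> \<and>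
     (\<forall>\<psi>. test_function \<Omega> \<psi> \<longrightarrow>
        (LINT x|lebesgue_on \<Omega>. u x *\<^sub>R grad \<psi> x) = - (LINT x|lebesgue_on \<Omega>. \<psi> x *\<^sub>R g x))"

text \<open>The closure of the test functions in the Sobolev space of square-integrable functions
  with square-integrable weak gradient. Elements are representatives, not classes modulo
  almost-everywhere equality.\<close>

definition H1_0 :: "('a::euclidean_space) set \<Rightarrow> ('a \<Rightarrow> real) set" where
  "H1_0 \<Omega> = {u. \<exists>g \<psi>. weak_gradient \<Omega> u g \<and> (\<forall>n::nat. test_function \<Omega> (\<psi> n)) \<and>
     (\<lambda>n. LINT x|lebesgue_on \<Omega>. (u x - \<psi> n x)\<^sup>2) \<longlonglongrightarrow> 0 \<and>
     (\<lambda>n. LINT x|lebesgue_on \<Omega>. (norm (g x - grad (\<psi> n) x))\<^sup>2) \<longlonglongrightarrow> 0}"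

text \<open>The equation is understood weakly. Among the representatives of the solution we take the
  one that is continuous on \<open>\<Omega>\<close> and extended by zero, so that uniqueness holds pointwise and
  the maximum over \<open>\<Omega>\<close> makes sense.\<close>

definition is_torsion_function :: "('a::euclidean_space) set \<Rightarrow> ('a \<Rightarrow> real) \<Rightarrow> bool" where
  "is_torsion_function \<Omega> \<phi> \<longleftrightarrow>
     continuous_on \<Omega> \<phi> \<and> (\<forall>x. x \<notin> \<Omega> \<longrightarrow> \<phi> x = 0) \<and> \<phi> \<in> H1_0 \<Omega> \<and>
     (\<exists>g. weak_gradient \<Omega> \<phi> g \<and>
       (\<forall>\<psi>. test_function \<Omega> \<psi> \<longrightarrow>
          (LINT x|lebesgue_on \<Omega>. g x \<bullet> grad \<psi> x) = (LINT x|lebesgue_on \<Omega>. \<psi> x)))"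

definition torsion_function :: "('a::euclidean_space) set \<Rightarrow> 'a \<Rightarrow> real" where
  "torsion_function \<Omega> = (THE \<phi>. is_torsion_function \<Omega> \<phi>)"

definition torsion_max :: "('a::euclidean_space) set \<Rightarrow> real" where
  "torsion_max \<Omega> = (SUP x\<in>\<Omega>. torsion_function \<Omega> x)"

definition Rect :: "real \<Rightarrow> (real \<times> real) set" where
  "Rect a = {- (a / 2)<..<a / 2} \<times> {- (1 / (2 * a))<..<1 / (2 * a)}"

end

theory Submission
  imports Defs "HOL-Computational_Algebra.Polynomial" "HOL-Real_Asymp.Real_Asymp"
begin

text \<open>With \<open>X = \<pi>x/a + \<pi>/2\<close>, \<open>Y = \<pi>ay + \<pi>/2\<close>, the torsion function of the rectangle is the double sine
  series \<open>16/\<pi>^4 \<Sum> sin(mX) sin(nY) / (mn(m^2/a^2 + n^2 a^2))\<close> over odd \<open>m\<close>, \<open>n\<close>. Its partial sums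
  with Fejer weights are smooth, vanish on the boundary, and have a Laplacian proportional to the
  product of the Fejer means of the odd sine series of a constant. These means are nonnegative and
  increasing on \<open>[0, \<pi>/2]\<close>, so the minimum principle, applied to a partial sum and to its partial
  derivatives, puts the maximum at the centre.

  At the centre, put \<open>c = a^2 + 1/a^2\<close>. Subtracting the series for \<open>a\<close> from the one for \<open>1\<close> and
  symmetrising in \<open>m\<close>, \<open>n\<close>, a diagonal term contributes \<open>(1 - 2/c)/m^4\<close> and, by AM-GM, an off-diagonal
  one at least \<open>-(1 - 2/c)/(m^2 n^2)\<close>. The claim follows from \<open>\<Sum> 1/m^4 = \<pi>^4/96\<close> and
  \<open>\<Sum> 1/m^2 = \<pi>^2/8\<close> over odd \<open>m\<close>.\<close>

section \<open>Smooth functions and test functions\<close>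

text \<open>Fejer weights make monotonicity visible at finite stages. The derivative of the plain
  partial sum of the odd sine series is sin(2Nt)/(2 sin t), which changes sign on [0, pi/2]; the
  weighted one is sin(Nt)^2 cos t/(2N sin(t)^2), which does not. So all comparisons are made between
  trigonometric sums, where every derivative exists, and only inequalities between values pass to
  the limit. The torsion function is given by a definite description of a weak solution, hence
  uniqueness in H^1_0 must come before any series can be identified with it. For existence the
  obstacle is \<open>H1_0\<close> itself: it asks for compactly supported approximants, whereas the
  partial sums vanish on the boundary but not near it. They are cut off, and a gradient bound
  uniform in N, from absolute summability of the once differentiated series, keeps this under
  control. The off-diagonal bound is completed to the square of a single sum by adding and
  subtracting diagonal terms. This leaves 2 pi^4/96 - (pi^2/8)^2 = pi^4/192, and 8/pi^4 times this
  is the constant 1/24.\<close>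

lemma frechet_derivative_eqI:
  "(f has_derivative f') (at x) \<Longrightarrow> frechet_derivative f (at x) v = f' v"
  by (simp add: frechet_derivative_at[symmetric])

lemmas frechet_derivative_worksI = frechet_derivative_works[THEN iffD1]

lemma frechet_derivative_add_at:
  fixes f g :: "'a::euclidean_space \<Rightarrow> real"
  assumes "f differentiable (at x)" "g differentiable (at x)"
  shows "frechet_derivative (\<lambda>x. f x + g x) (at x) v
     = frechet_derivative f (at x) v + frechet_derivative g (at x) v"
  using assms by (intro frechet_derivative_eqI has_derivative_add frechet_derivative_worksI)

lemma frechet_derivative_mult_at:
  fixes f g :: "'a::euclidean_space \<Rightarrow> real"
  assumes "f differentiable (at x)" "g differentiable (at x)"
  shows "frechet_derivative (\<lambda>x. f x * g x) (at x) v
     = f x * frechet_derivative g (at x) v + frechet_derivative f (at x) v * g x"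
  using assms by (intro frechet_derivative_eqI has_derivative_mult frechet_derivative_worksI)

lemma frechet_derivative_compose_real:
  fixes p :: "'a::euclidean_space \<Rightarrow> real"
  assumes "p differentiable (at x)" "(h has_real_derivative h') (at (p x))"
  shows "frechet_derivative (\<lambda>x. h (p x)) (at x) v = h' * frechet_derivative p (at x) v"
proof (rule frechet_derivative_eqI)
  show "((\<lambda>x. h (p x)) has_derivative (\<lambda>v. h' * frechet_derivative p (at x) v)) (at x)"
    using has_derivative_compose[OF assms(1)[THEN frechet_derivative_worksI]
        assms(2)[unfolded has_field_derivative_def]]
    by simp
qed

section \<open>Closure properties of the classes C-k\<close>

lemma C_diff_differentiable: "C_diff (Suc k) f \<Longrightarrow> f differentiable (at x)"
  by simp

lemma C_diff_Suc_D: "C_diff (Suc k) f \<Longrightarrow> C_diff k f"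
proof (induction k arbitrary: f)
  case 0
  then show ?case
    by (auto intro!: continuous_at_imp_continuous_on differentiable_imp_continuous_within)
qed auto

lemma C_diff_const: "C_diff k (\<lambda>_. c)"
  by (induction k arbitrary: c) (auto simp: frechet_derivative_const)

lemma C_diff_add: "C_diff k f \<Longrightarrow> C_diff k g \<Longrightarrow> C_diff k (\<lambda>x. f x + g x)"
proof (induction k arbitrary: f g)
  case 0
  then show ?case by (auto intro: continuous_intros)
next
  case (Suc k)
  have "frechet_derivative (\<lambda>x. f x + g x) (at x) b
     = frechet_derivative f (at x) b + frechet_derivative g (at x) b" for x b
    using Suc.prems by (intro frechet_derivative_add_at) auto
  then show ?case using Suc by auto
qed

lemma C_diff_mult: "C_diff k f \<Longrightarrow> C_diff k g \<Longrightarrow> C_diff k (\<lambda>x. f x * g x)"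
proof (induction k arbitrary: f g)
  case 0
  then show ?case by (auto intro: continuous_intros)
next
  case (Suc k)
  have "frechet_derivative (\<lambda>x. f x * g x) (at x) b
     = f x * frechet_derivative g (at x) b + frechet_derivative f (at x) b * g x" for x b
    using Suc.prems by (intro frechet_derivative_mult_at) auto
  moreover have "C_diff k f" "C_diff k g"
    using Suc.prems C_diff_Suc_D by blast+
  ultimately show ?case
    using Suc.prems by (auto intro!: C_diff_add Suc.IH)
qed

lemma C_diff_linear:
  assumes "bounded_linear (f :: 'a::euclidean_space \<Rightarrow> real)"
  shows "C_diff k f"
proof -
  have "frechet_derivative f (at x) b = f b" for x b
    by (intro frechet_derivative_eqI bounded_linear_imp_has_derivative assms)
  moreover have "continuous_on UNIV f"
    using assms by (rule linear_continuous_on)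
  ultimately show ?thesis
    by (cases k) (auto simp: C_diff_const bounded_linear_imp_differentiable[OF assms])
qed

text \<open>Differentiating \<open>D n (p x)\<close> gives \<open>D (Suc n) (p x)\<close> times a
  derivative of \<open>p\<close>, so the induction needs the whole sequence of derivatives of the
  outer function at once. Bump functions and phase-shifted sines are supplied in this form.\<close>

lemma C_diff_compose:
  assumes D: "\<And>n t. (D n has_real_derivative D (Suc n) t) (at t)" and "\<And>k. C_diff k p"
  shows "C_diff k (\<lambda>x. D n (p x))"
proof (induction k arbitrary: n)
  have p: "p differentiable (at x)" for x
    using assms(2)[of "Suc 0"] by simp
  have d: "((\<lambda>x. D n (p x)) has_derivative
      (\<lambda>v. D (Suc n) (p x) * frechet_derivative p (at x) v)) (at x)" for n x
    using has_derivative_compose[OF p[THEN frechet_derivative_worksI]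
        D[unfolded has_field_derivative_def]]
    by simp
  {
    case 0
    have "continuous_on UNIV (\<lambda>x. D n (p x))"
      using d by (intro continuous_at_imp_continuous_on) (auto intro: has_derivative_continuous)
    then show ?case by simp
  next
    case (Suc k)
    have "frechet_derivative (\<lambda>x. D n (p x)) (at x) b
        = D (Suc n) (p x) * frechet_derivative p (at x) b" for x b
      by (rule frechet_derivative_eqI[OF d])
    moreover have "C_diff k (\<lambda>x. frechet_derivative p (at x) b)" if "b \<in> Basis" for b
      using assms(2)[of "Suc k"] that by simp
    ultimately show ?case
      using Suc differentiableI[OF d] by (auto intro!: C_diff_mult)
  }
qed

section \<open>Smooth functions, gradients and supports\<close>

definition smooth :: "('a::euclidean_space \<Rightarrow> real) \<Rightarrow> bool" where
  "smooth f \<longleftrightarrow> (\<forall>k. C_diff k f)"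

lemma smooth_const: "smooth (\<lambda>_. c)"
  and smooth_add: "smooth f \<Longrightarrow> smooth g \<Longrightarrow> smooth (\<lambda>x. f x + g x)"
  and smooth_mult: "smooth f \<Longrightarrow> smooth g \<Longrightarrow> smooth (\<lambda>x. f x * g x)"
  and smooth_linear: "bounded_linear f \<Longrightarrow> smooth f"
  by (auto simp: smooth_def C_diff_const C_diff_add C_diff_mult C_diff_linear)

lemma smooth_compose:
  "(\<And>n t. (D n has_real_derivative D (Suc n) t) (at t)) \<Longrightarrow> smooth p
    \<Longrightarrow> smooth (\<lambda>x. D n (p x))"
  unfolding smooth_def using C_diff_compose by blast

lemma smooth_sum: "(\<And>i. i \<in> I \<Longrightarrow> smooth (f i)) \<Longrightarrow> smooth (\<lambda>x. \<Sum>i\<in>I. f i x)"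
  by (induction I rule: infinite_finite_induct) (auto intro: smooth_add smooth_const)

lemma smooth_diff: "smooth f \<Longrightarrow> smooth g \<Longrightarrow> smooth (\<lambda>x. f x - g x)"
  using smooth_add[of f "\<lambda>x. -1 * g x"] smooth_mult[of "\<lambda>_. -1" g] by (auto simp: smooth_const)

lemma smooth_differentiable: "smooth f \<Longrightarrow> f differentiable (at x)"
  unfolding smooth_def using C_diff_differentiable by blast

lemma smooth_continuous_on: "smooth f \<Longrightarrow> continuous_on S f"
  unfolding smooth_def using continuous_on_subset by (metis C_diff.simps(1) subset_UNIV)

lemma smooth_frechet_derivative:
  "smooth f \<Longrightarrow> b \<in> Basis \<Longrightarrow> smooth (\<lambda>x. frechet_derivative f (at x) b)"
  unfolding smooth_def by (metis C_diff.simps(2))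

lemma inner_grad: "b \<in> Basis \<Longrightarrow> grad f x \<bullet> b = frechet_derivative f (at x) b"
  by (simp add: grad_def inner_sum_left inner_Basis if_distrib cong: if_cong)

lemma continuous_on_grad: "smooth f \<Longrightarrow> continuous_on S (grad f)"
  unfolding grad_def[abs_def]
  by (intro continuous_intros smooth_continuous_on smooth_frechet_derivative)

lemma frechet_derivative_outside_support:
  fixes f :: "'a::euclidean_space \<Rightarrow> real"
  assumes "x \<notin> closure {x. f x \<noteq> 0}"
  shows "frechet_derivative f (at x) v = 0"
proof -
  have "((\<lambda>_. 0) has_derivative (\<lambda>_. 0)) (at x)" by simp
  then have "(f has_derivative (\<lambda>_. 0)) (at x)"
  proof (rule has_derivative_transform_within_open)
    show "open (- closure {x. f x \<noteq> 0})" by auto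
  next
    fix y assume "y \<in> - closure {x. f x \<noteq> 0}"
    then have "y \<notin> {x. f x \<noteq> 0}" using closure_subset[of "{x. f x \<noteq> 0}"] by blast
    then show "0 = f y" by simp
  qed (use assms in simp)
  then show ?thesis by (rule frechet_derivative_eqI)
qed

lemma grad_outside_support: "x \<notin> closure {x. f x \<noteq> 0} \<Longrightarrow> grad f x = 0"
  by (simp add: grad_def frechet_derivative_outside_support)

section \<open>Test functions\<close>

lemma test_functionD:
  assumes "test_function \<Omega> \<psi>"
  shows "smooth \<psi>" "compact (closure {x. \<psi> x \<noteq> 0})" "closure {x. \<psi> x \<noteq> 0} \<subseteq> \<Omega>"
  using assms by (auto simp: test_function_def smooth_def)

lemma test_function_outside:
  assumes "test_function \<Omega> \<psi>" "x \<notin> \<Omega>"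
  shows "\<psi> x = 0" "frechet_derivative \<psi> (at x) v = 0" "grad \<psi> x = 0"
proof -
  have *: "x \<notin> closure {x. \<psi> x \<noteq> 0}"
    using assms test_functionD(3) by blast
  then show "\<psi> x = 0" using closure_subset[of "{x. \<psi> x \<noteq> 0}"] by blast
  show "frechet_derivative \<psi> (at x) v = 0" "grad \<psi> x = 0"
    using * by (auto intro: frechet_derivative_outside_support grad_outside_support)
qed

lemma test_function_subsupport:
  assumes "test_function \<Omega> \<psi>" "smooth f" "\<And>x. x \<notin> closure {x. \<psi> x \<noteq> 0} \<Longrightarrow> f x = 0"
  shows "test_function \<Omega> f"
proof -
  have "{x. f x \<noteq> 0} \<subseteq> closure {x. \<psi> x \<noteq> 0}" using assms(3) by auto
  then have s: "closure {x. f x \<noteq> 0} \<subseteq> closure {x. \<psi> x \<noteq> 0}"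
    using closure_minimal by blast
  then have "compact (closure {x. f x \<noteq> 0})"
    using test_functionD(2)[OF assms(1)] bounded_subset[OF _ s]
    by (simp add: compact_eq_bounded_closed)
  then show ?thesis
    using s test_functionD(3)[OF assms(1)] assms(2) by (auto simp: test_function_def smooth_def)
qed

lemma test_function_frechet_derivative:
  assumes "test_function \<Omega> \<psi>" "b \<in> Basis"
  shows "test_function \<Omega> (\<lambda>x. frechet_derivative \<psi> (at x) b)"
  using assms by (auto intro: test_function_subsupport smooth_frechet_derivative
      test_functionD frechet_derivative_outside_support)

lemma test_function_mult:
  assumes "test_function \<Omega> \<psi>" "smooth f"
  shows "test_function \<Omega> (\<lambda>x. f x * \<psi> x)"
  using assms(1)
proof (rule test_function_subsupport)
  fix x assume "x \<notin> closure {x. \<psi> x \<noteq> 0}"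
  then have "\<psi> x = 0" using closure_subset[of "{x. \<psi> x \<noteq> 0}"] by blast
  then show "f x * \<psi> x = 0" by simp
qed (use assms test_functionD(1) in \<open>auto intro: smooth_mult\<close>)

lemma test_function_diff:
  assumes "test_function \<Omega> \<psi>" "test_function \<Omega> \<xi>"
  shows "test_function \<Omega> (\<lambda>x. \<psi> x - \<xi> x)"
proof -
  have "{x. \<psi> x - \<xi> x \<noteq> 0} \<subseteq> {x. \<psi> x \<noteq> 0} \<union> {x. \<xi> x \<noteq> 0}" by auto
  then have s: "closure {x. \<psi> x - \<xi> x \<noteq> 0} \<subseteq> closure {x. \<psi> x \<noteq> 0} \<union> closure {x. \<xi> x \<noteq> 0}"
    using closure_mono by (metis closure_Un)
  have "compact (closure {x. \<psi> x \<noteq> 0} \<union> closure {x. \<xi> x \<noteq> 0})"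
    using assms test_functionD(2) by blast
  then have "compact (closure {x. \<psi> x - \<xi> x \<noteq> 0})"
    using bounded_subset[OF _ s] by (simp add: compact_eq_bounded_closed)
  then show ?thesis
    using s assms smooth_diff[of \<psi> \<xi>] by (auto simp: test_function_def smooth_def)
qed

lemma grad_diff:
  "smooth f \<Longrightarrow> smooth g \<Longrightarrow> grad (\<lambda>x. f x - g x) x = grad f x - grad g x"
proof -
  assume "smooth f" "smooth g"
  then have "frechet_derivative (\<lambda>x. f x - g x) (at x) b
      = frechet_derivative f (at x) b - frechet_derivative g (at x) b" for b
    by (intro frechet_derivative_eqI has_derivative_diff frechet_derivative_worksI
        smooth_differentiable)
  then show ?thesis by (simp add: grad_def scaleR_diff_left sum_subtractf)
qed

text \<open>The integral is invariant under translation, so the difference quotients integrate to zero.\<close>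

lemma integral_frechet_derivative_compact_support:
  fixes f :: "'a::euclidean_space \<Rightarrow> real"
  assumes f: "\<And>x. f differentiable (at x)"
    and cont: "continuous_on UNIV (\<lambda>x. frechet_derivative f (at x) b)"
    and K: "compact (closure {x. f x \<noteq> 0})" and b: "b \<in> Basis"
  shows "integral\<^sup>L lborel (\<lambda>x. frechet_derivative f (at x) b) = 0"
proof -
  let ?K = "closure {x. f x \<noteq> 0}"
  define d where "d x = frechet_derivative f (at x) b" for x
  have contf: "continuous_on UNIV f"
    using f by (auto intro!: continuous_at_imp_continuous_on differentiable_imp_continuous_within)
  obtain R where R: "R > 0" "?K \<subseteq> ball 0 R"
    using K bounded_subset_ballD[of ?K 0] compact_imp_bounded by metis
  have "bounded (d ` ?K)"
    using K cont by (auto intro!: compact_imp_bounded compact_continuous_image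
        intro: continuous_on_subset simp: d_def[abs_def])
  then obtain M where M: "M > 0" "\<And>x. x \<in> ?K \<Longrightarrow> \<bar>d x\<bar> \<le> M"
    unfolding bounded_pos by auto
  have dM: "\<bar>d x\<bar> \<le> M" for x
    using M frechet_derivative_outside_support[of x f b] by (cases "x \<in> ?K") (auto simp: d_def)
  have fz: "f x = 0" if "norm x \<ge> R" for x
    using R that closure_subset[of "{x. f x \<noteq> 0}"] by (force simp: subset_iff)
  \<comment> \<open>Difference quotients in direction \<open>b\<close> with step 1/(n + 1), which is
    at most 1.\<close>
  define h where "h n x = real (Suc n) * (f (x + (1 / real (Suc n)) *\<^sub>R b) - f x)" for n x
  have line: "((\<lambda>t. f (x + t *\<^sub>R b)) has_real_derivative d (x + t *\<^sub>R b)) (at t)" for x t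
  proof -
    have "((\<lambda>t. x + t *\<^sub>R b) has_derivative (\<lambda>s. s *\<^sub>R b)) (at t)"
      by (auto intro!: derivative_eq_intros)
    from has_derivative_compose[OF this f[THEN frechet_derivative_worksI]]
    have "((\<lambda>t. f (x + t *\<^sub>R b)) has_derivative
        (\<lambda>s. frechet_derivative f (at (x + t *\<^sub>R b)) (s *\<^sub>R b))) (at t)" .
    moreover have "frechet_derivative f (at (x + t *\<^sub>R b)) (s *\<^sub>R b) = d (x + t *\<^sub>R b) * s" for s
      using linear_cmul[OF linear_frechet_derivative[OF f]] by (simp add: d_def)
    ultimately show ?thesis by (simp add: has_field_derivative_def)
  qed
  have hd: "(\<lambda>n. h n x) \<longlonglongrightarrow> d x" for x
  proof -
    have "((\<lambda>t. f (x + t *\<^sub>R b)) has_real_derivative d x) (at 0)"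
      using line[of x 0] by simp
    then have "((\<lambda>t. (f (x + t *\<^sub>R b) - f x) / t) \<longlongrightarrow> d x) (at 0)"
      by (simp add: has_field_derivative_iff)
    moreover have "filterlim (\<lambda>n. 1 / real (Suc n)) (at 0) sequentially"
      using LIMSEQ_inverse_real_of_nat by (auto simp: filterlim_at inverse_eq_divide)
    ultimately have "(\<lambda>n. (f (x + (1 / real (Suc n)) *\<^sub>R b) - f x) / (1 / real (Suc n))) \<longlonglongrightarrow> d x"
      by (rule filterlim_compose)
    then show ?thesis by (simp add: h_def[abs_def] mult.commute)
  qed
  \<comment> \<open>Inside the larger ball the mean value theorem gives \<open>M\<close>; outside it
    both points of the quotient lie off the support, since the step has length at most 1.\<close>
  have hb: "\<bar>h n x\<bar> \<le> M * indicator (cball 0 (R + 1)) x" for n x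
  proof (cases "norm x \<le> R + 1")
    case True
    have "\<bar>f (x + (1 / real (Suc n)) *\<^sub>R b) - f x\<bar> \<le> M * (1 / real (Suc n))"
    proof -
      have "norm ((\<lambda>t. f (x + t *\<^sub>R b)) (1 / real (Suc n)) - (\<lambda>t. f (x + t *\<^sub>R b)) 0)
          \<le> M * norm (1 / real (Suc n) - 0)"
        by (rule field_differentiable_bound[of UNIV]) (use line dM in auto)
      then show ?thesis by simp
    qed
    then have "real (Suc n) * \<bar>f (x + (1 / real (Suc n)) *\<^sub>R b) - f x\<bar>
        \<le> real (Suc n) * (M * (1 / real (Suc n)))"
      by (rule mult_left_mono) simp
    then show ?thesis using True by (simp add: h_def abs_mult del: of_nat_Suc)
  next
    case False
    have "norm (x + (1 / real (Suc n)) *\<^sub>R b) \<ge> norm x - norm ((1 / real (Suc n)) *\<^sub>R b)"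
      by (rule norm_diff_ineq)
    moreover have "norm ((1 / real (Suc n)) *\<^sub>R b) \<le> 1" using b by (simp add: divide_simps)
    ultimately have "norm (x + (1 / real (Suc n)) *\<^sub>R b) \<ge> R" using False by linarith
    then show ?thesis using False fz[of x] fz by (simp add: h_def)
  qed
  have [measurable]: "f \<in> borel_measurable lborel" "d \<in> borel_measurable lborel"
    using contf cont by (auto intro: borel_measurable_continuous_onI simp: d_def[abs_def])
  have [measurable]: "h n \<in> borel_measurable lborel" for n
    unfolding h_def[abs_def] by measurable
  have ind: "integrable lborel (\<lambda>x::'a. M * indicator (cball 0 (R + 1)) x)"
    by (intro integrable_mult_right integrable_real_indicator) (auto intro: emeasure_bounded_finite simp flip: infinity_ennreal_def)
  have lim: "(\<lambda>n. integral\<^sup>L lborel (h n)) \<longlonglongrightarrow> integral\<^sup>L lborel d"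
  proof (rule integral_dominated_convergence[OF _ _ ind])
    show "AE x in lborel. (\<lambda>n. h n x) \<longlonglongrightarrow> d x" by (simp add: hd)
    show "AE x in lborel. norm (h n x) \<le> M * indicator (cball 0 (R + 1)) x" for n
      by (simp only: real_norm_def hb AE_I2)
  qed auto
  have intf: "integrable lborel f"
  proof -
    have "bounded (f ` cball 0 R)"
      by (intro compact_imp_bounded compact_continuous_image compact_cball continuous_on_subset[OF contf]) auto
    then obtain B where B: "B > 0" "\<And>x. norm x \<le> R \<Longrightarrow> \<bar>f x\<bar> \<le> B"
      unfolding bounded_pos by auto
    show ?thesis
    proof (rule Bochner_Integration.integrable_bound)
      show "integrable lborel (\<lambda>x::'a. B * indicator (cball 0 R) x)"
        by (intro integrable_mult_right integrable_real_indicator)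
          (auto intro: emeasure_bounded_finite simp flip: infinity_ennreal_def)
      show "AE x in lborel. norm (f x) \<le> norm (B * indicator (cball 0 R) x)"
        using B fz by (auto simp: indicator_def)
    qed simp
  qed
  have "integral\<^sup>L lborel (h n) = 0" for n
  proof -
    let ?v = "(1 / real (Suc n)) *\<^sub>R b"
    have "integrable (distr lborel borel (\<lambda>x. ?v + x)) f"
      using intf by (simp only: lborel_distr_plus)
    then have i: "integrable lborel (\<lambda>x. f (x + ?v))"
      by (simp add: integrable_distr_eq add.commute)
    have "integral\<^sup>L (distr lborel borel (\<lambda>x. ?v + x)) f = integral\<^sup>L lborel (\<lambda>x. f (x + ?v))"
      by (simp add: integral_distr add.commute)
    then have "integral\<^sup>L lborel f = integral\<^sup>L lborel (\<lambda>x. f (x + ?v))"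
      by (simp only: lborel_distr_plus)
    then show ?thesis
      using i intf by (simp add: h_def[abs_def])
  qed
  then show ?thesis using lim by (simp add: LIMSEQ_const_iff d_def[abs_def])
qed

section \<open>Integration by parts and uniqueness of the torsion function\<close>

text \<open>Moves an integral from the completed and restricted measure to \<open>lborel\<close>,
  where translation invariance is available.\<close>

lemma integral_lebesgue_on_eq_lborel:
  fixes f :: "'a::euclidean_space \<Rightarrow> 'b::euclidean_space"
  assumes "open \<Omega>" "f \<in> borel_measurable borel" "\<And>x. x \<notin> \<Omega> \<Longrightarrow> f x = 0"
  shows "integral\<^sup>L (lebesgue_on \<Omega>) f = integral\<^sup>L lborel f"
proof -
  have "integral\<^sup>L (lebesgue_on \<Omega>) f = integral\<^sup>L lebesgue (\<lambda>x. indicator \<Omega> x *\<^sub>R f x)"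
    using assms(1) by (intro integral_restrict_space) auto
  also have "(\<lambda>x. indicator \<Omega> x *\<^sub>R f x) = f"
    using assms(3) by (auto simp: indicator_def fun_eq_iff)
  also have "integral\<^sup>L lebesgue f = integral\<^sup>L lborel f"
    using assms(2) by (intro integral_completion) simp
  finally show ?thesis .
qed

section \<open>Square-integrable functions\<close>

lemma L2_real_iff:
  "(f :: 'a::euclidean_space \<Rightarrow> real) \<in> L2 \<Omega> \<longleftrightarrow>
     f \<in> borel_measurable (lebesgue_on \<Omega>) \<and> integrable (lebesgue_on \<Omega>) (\<lambda>x. (f x)\<^sup>2)"
  by (simp add: L2_def)

lemma L2_measurable: "f \<in> L2 \<Omega> \<Longrightarrow> f \<in> borel_measurable (lebesgue_on \<Omega>)"
  by (simp add: L2_def)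

lemma L2_integrable: "f \<in> L2 \<Omega> \<Longrightarrow> integrable (lebesgue_on \<Omega>) (\<lambda>x. (norm (f x))\<^sup>2)"
  by (simp add: L2_def)

lemma two_mult_le_squares: "2 * (x * y) \<le> x\<^sup>2 + (y::real)\<^sup>2"
  using zero_le_power2[of "x - y"] by (simp add: power2_diff)

lemma integrable_norm_mult_L2:
  assumes "f \<in> L2 \<Omega>" "g \<in> L2 \<Omega>"
  shows "integrable (lebesgue_on \<Omega>) (\<lambda>x. norm (f x) * norm (g x))"
proof (rule Bochner_Integration.integrable_bound)
  show "integrable (lebesgue_on \<Omega>) (\<lambda>x. (norm (f x))\<^sup>2 + (norm (g x))\<^sup>2)"
    by (intro Bochner_Integration.integrable_add L2_integrable assms)
  show "(\<lambda>x. norm (f x) * norm (g x)) \<in> borel_measurable (lebesgue_on \<Omega>)"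
    using assms[THEN L2_measurable] by measurable
  show "AE x in lebesgue_on \<Omega>. norm (norm (f x) * norm (g x)) \<le> norm ((norm (f x))\<^sup>2 + (norm (g x))\<^sup>2)"
  proof (intro AE_I2)
    fix x
    have "norm (f x) * norm (g x) \<ge> 0" by simp
    with two_mult_le_squares[of "norm (f x)" "norm (g x)"]
    show "norm (norm (f x) * norm (g x)) \<le> norm ((norm (f x))\<^sup>2 + (norm (g x))\<^sup>2)"
      unfolding real_norm_def by linarith
  qed
qed

lemma integrable_inner_L2:
  assumes "f \<in> L2 \<Omega>" "g \<in> L2 \<Omega>"
  shows "integrable (lebesgue_on \<Omega>) (\<lambda>x. f x \<bullet> g x)"
  using assms[THEN L2_measurable]
  by (intro Bochner_Integration.integrable_bound[OF integrable_norm_mult_L2[OF assms]])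
     (auto simp: Cauchy_Schwarz_ineq2)

lemma integrable_scaleR_L2:
  fixes f :: "'a::euclidean_space \<Rightarrow> real" and g :: "'a \<Rightarrow> 'b::euclidean_space"
  assumes "f \<in> L2 \<Omega>" "g \<in> L2 \<Omega>"
  shows "integrable (lebesgue_on \<Omega>) (\<lambda>x. f x *\<^sub>R g x)"
  using assms[THEN L2_measurable]
  by (intro Bochner_Integration.integrable_bound[OF integrable_norm_mult_L2[OF assms]]) auto

lemma L2_diff:
  fixes f g :: "'a::euclidean_space \<Rightarrow> 'b::euclidean_space"
  assumes "f \<in> L2 \<Omega>" "g \<in> L2 \<Omega>"
  shows "(\<lambda>x. f x - g x) \<in> L2 \<Omega>"
proof -
  have "integrable (lebesgue_on \<Omega>) (\<lambda>x. (norm (f x))\<^sup>2 + (norm (g x))\<^sup>2 - 2 * (f x \<bullet> g x))"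
    using assms L2_integrable integrable_inner_L2
    by (intro Bochner_Integration.integrable_add Bochner_Integration.integrable_diff
        integrable_mult_right) auto
  moreover have "(norm (f x - g x))\<^sup>2 = (norm (f x))\<^sup>2 + (norm (g x))\<^sup>2 - 2 * (f x \<bullet> g x)" for x
    by (simp add: power2_norm_eq_inner inner_diff inner_commute)
  ultimately show ?thesis
    using assms[THEN L2_measurable] by (simp add: L2_def)
qed

lemma L2_bounded_continuous:
  assumes "open \<Omega>" "bounded \<Omega>" "continuous_on \<Omega> f" "\<And>x. x \<in> \<Omega> \<Longrightarrow> norm (f x) \<le> B"
  shows "f \<in> L2 \<Omega>"
proof -
  have lm: "\<Omega> \<in> lmeasurable" using assms by (simp add: lmeasurable_open)
  have m: "f \<in> borel_measurable (lebesgue_on \<Omega>)"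
    using assms by (intro continuous_imp_measurable_on_sets_lebesgue) auto
  interpret finite_measure "lebesgue_on \<Omega>"
    using lm by (rule finite_measure_lebesgue_on)
  have "integrable (lebesgue_on \<Omega>) (\<lambda>x. (norm (f x))\<^sup>2)"
  proof (rule integrable_const_bound[where B = "B\<^sup>2"])
    show "AE x in lebesgue_on \<Omega>. norm ((norm (f x))\<^sup>2) \<le> B\<^sup>2"
      using assms(4) by (intro AE_I2) (simp add: power_mono)
    show "(\<lambda>x. (norm (f x))\<^sup>2) \<in> borel_measurable (lebesgue_on \<Omega>)"
      using m by measurable
  qed
  then show ?thesis using m by (simp add: L2_def)
qed

lemma continuous_L2:
  fixes f :: "'a::euclidean_space \<Rightarrow> 'b::euclidean_space"
  assumes "open \<Omega>" "bounded \<Omega>" "continuous_on UNIV f"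
  shows "f \<in> L2 \<Omega>"
proof -
  have "bounded (f ` closure \<Omega>)"
    using assms by (intro compact_imp_bounded compact_continuous_image)
      (auto intro: continuous_on_subset simp: compact_closure)
  then obtain B where "\<And>x. x \<in> closure \<Omega> \<Longrightarrow> norm (f x) \<le> B"
    unfolding bounded_pos by auto
  then show ?thesis
    using closure_subset[of \<Omega>] continuous_on_subset[OF assms(3)]
    by (intro L2_bounded_continuous[OF assms(1,2), of f B]) auto
qed

lemma smooth_L2:
  assumes "open \<Omega>" "bounded \<Omega>" "smooth f"
  shows "f \<in> L2 \<Omega>" "grad f \<in> L2 \<Omega>"
  using assms by (auto intro: continuous_L2 smooth_continuous_on continuous_on_grad)

lemma test_function_L2:
  assumes "open \<Omega>" "bounded \<Omega>" "test_function \<Omega> \<psi>"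
  shows "\<psi> \<in> L2 \<Omega>" "grad \<psi> \<in> L2 \<Omega>"
  using smooth_L2[OF assms(1,2) test_functionD(1)[OF assms(3)]] .

text \<open>Only \<open>\<psi>\<close> has compact support, but its product with \<open>f\<close>
  inherits it; the integral of the partial derivative of the product vanishes, and the product rule
  splits it.\<close>

lemma integration_by_parts_test_function:
  assumes "open \<Omega>" "bounded \<Omega>" "smooth f" "test_function \<Omega> \<psi>" "b \<in> Basis"
  shows "(LINT x|lebesgue_on \<Omega>. f x * frechet_derivative \<psi> (at x) b)
     = - (LINT x|lebesgue_on \<Omega>. frechet_derivative f (at x) b * \<psi> x)"
proof -
  have sp: "smooth \<psi>" using assms(4) by (rule test_functionD)
  have t: "test_function \<Omega> (\<lambda>x. f x * \<psi> x)"
    using assms by (intro test_function_mult)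
  have "0 = integral\<^sup>L lborel (\<lambda>x. frechet_derivative (\<lambda>x. f x * \<psi> x) (at x) b)"
    using test_functionD[OF t] assms(5)
    by (intro integral_frechet_derivative_compact_support[symmetric] smooth_differentiable
        smooth_continuous_on smooth_frechet_derivative)
  also have "\<dots> = (LINT x|lebesgue_on \<Omega>. frechet_derivative (\<lambda>x. f x * \<psi> x) (at x) b)"
    using test_function_outside[OF t] assms(1,5) test_functionD(1)[OF t]
    by (intro integral_lebesgue_on_eq_lborel[symmetric] borel_measurable_continuous_onI
        smooth_continuous_on smooth_frechet_derivative) auto
  also have "\<dots> = (LINT x|lebesgue_on \<Omega>. f x * frechet_derivative \<psi> (at x) b
      + frechet_derivative f (at x) b * \<psi> x)"
    using assms(3) sp by (simp add: frechet_derivative_mult_at smooth_differentiable)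
  also have "\<dots> = (LINT x|lebesgue_on \<Omega>. f x * frechet_derivative \<psi> (at x) b)
      + (LINT x|lebesgue_on \<Omega>. frechet_derivative f (at x) b * \<psi> x)"
    using integrable_inner_L2[OF smooth_L2(1)[OF assms(1,2)] smooth_L2(1)[OF assms(1,2)]]
      assms(3,5) sp
    by (intro Bochner_Integration.integral_add)
      (auto simp: smooth_frechet_derivative)
  finally show ?thesis by simp
qed

lemma grad_inner_grad:
  "(v::'a::euclidean_space) \<bullet> grad f x = (\<Sum>b\<in>Basis. (v \<bullet> b) * frechet_derivative f (at x) b)"
  by (simp add: grad_def inner_sum_right mult.commute)

lemma abs_frechet_derivative_le_norm_grad:
  "b \<in> Basis \<Longrightarrow> \<bar>frechet_derivative f (at x) b\<bar> \<le> norm (grad f x)"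
  using Basis_le_norm[of b "grad f x"] by (simp add: inner_grad)

text \<open>The coordinate \<open>x \<bullet> b\<close> has derivative 1 in direction
  \<open>b\<close>, so integration by parts turns the integral of psi^2 into -2 times that of (x .
  b) psi (d_b psi), where the coordinate is at most R in absolute value.\<close>

lemma poincare_inequality:
  fixes \<psi> :: "'a::euclidean_space \<Rightarrow> real"
  assumes "open \<Omega>" "\<Omega> \<subseteq> cball 0 R" "test_function \<Omega> \<psi>"
  shows "(LINT x|lebesgue_on \<Omega>. (\<psi> x)\<^sup>2) \<le> 4 * R\<^sup>2 * (LINT x|lebesgue_on \<Omega>. (norm (grad \<psi> x))\<^sup>2)"
proof -
  let ?M = "lebesgue_on \<Omega>"
  obtain b :: 'a where b: "b \<in> Basis" using nonempty_Basis by blast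
  let ?d = "\<lambda>x. frechet_derivative \<psi> (at x) b"
  have bd: "bounded \<Omega>" using assms(2) bounded_cball bounded_subset by blast
  note L2 = smooth_L2(1)[OF assms(1) bd] and G2 = smooth_L2(2)[OF assms(1) bd]
  have s: "smooth \<psi>" using assms(3) by (rule test_functionD)
  have sx: "smooth (\<lambda>x. x \<bullet> b)" by (intro smooth_linear bounded_linear_intros)
  have sd: "smooth ?d" using s b by (rule smooth_frechet_derivative)
  have int: "integrable ?M (\<lambda>x. f x * g x)" if "smooth f" "smooth g" for f g :: "'a \<Rightarrow> real"
    using integrable_inner_L2[OF L2[OF that(1)] L2[OF that(2)]] by simp
  have dx: "frechet_derivative (\<lambda>x. (x \<bullet> b) * \<psi> x) (at x) b = (x \<bullet> b) * ?d x + \<psi> x" for x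
  proof -
    have "frechet_derivative (\<lambda>x. x \<bullet> b) (at x) b = 1"
      using b by (subst frechet_derivative_eqI[of _ "\<lambda>h. h \<bullet> b"])
        (auto intro!: derivative_eq_intros simp: inner_Basis)
    then show ?thesis
      using sx s by (simp add: frechet_derivative_mult_at smooth_differentiable)
  qed
  let ?I = "LINT x|?M. (x \<bullet> b) * \<psi> x * ?d x"
  have i1: "integrable ?M (\<lambda>x. (x \<bullet> b) * \<psi> x * ?d x)"
    by (intro int smooth_mult sx s sd)
  have i2: "integrable ?M (\<lambda>x. (\<psi> x)\<^sup>2)" using int[OF s s] by (simp add: power2_eq_square)
  have i3: "integrable ?M (\<lambda>x. (norm (grad \<psi> x))\<^sup>2)" by (intro L2_integrable G2 s)
  have "?I = - (LINT x|?M. ((x \<bullet> b) * ?d x + \<psi> x) * \<psi> x)"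
    using integration_by_parts_test_function[OF assms(1) bd smooth_mult[OF sx s] assms(3) b]
    by (simp add: dx)
  also have "(LINT x|?M. ((x \<bullet> b) * ?d x + \<psi> x) * \<psi> x)
      = (LINT x|?M. (x \<bullet> b) * \<psi> x * ?d x + (\<psi> x)\<^sup>2)"
    by (rule Bochner_Integration.integral_cong) (auto simp: algebra_simps power2_eq_square)
  also have "\<dots> = ?I + (LINT x|?M. (\<psi> x)\<^sup>2)"
    by (rule Bochner_Integration.integral_add[OF i1 i2])
  finally have "(LINT x|?M. (\<psi> x)\<^sup>2) = -2 * ?I" by simp
  also have "\<dots> = (LINT x|?M. -2 * ((x \<bullet> b) * \<psi> x * ?d x))" by simp
  also have "\<dots> \<le> (LINT x|?M. (\<psi> x)\<^sup>2 / 2 + 2 * R\<^sup>2 * (norm (grad \<psi> x))\<^sup>2)"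
  proof (rule integral_mono)
    fix x assume "x \<in> space ?M"
    then have "norm x \<le> R" using assms(2) by auto
    then have xb: "\<bar>x \<bullet> b\<bar> \<le> R" using Basis_le_norm[OF b, of x] by linarith
    \<comment> \<open>Young's inequality, weighted so that half of the integral of psi^2 remains to
      be absorbed on the left.\<close>
    have "-2 * ((x \<bullet> b) * \<psi> x * ?d x) \<le> (\<psi> x)\<^sup>2 / 2 + 2 * ((x \<bullet> b)\<^sup>2 * (?d x)\<^sup>2)"
      using zero_le_power2[of "\<psi> x + 2 * ((x \<bullet> b) * ?d x)"]
      by (simp add: power2_sum power_mult_distrib algebra_simps)
    also have "(x \<bullet> b)\<^sup>2 * (?d x)\<^sup>2 \<le> R\<^sup>2 * (norm (grad \<psi> x))\<^sup>2"
    proof (rule mult_mono)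
      show "(x \<bullet> b)\<^sup>2 \<le> R\<^sup>2" using xb power_mono[of "\<bar>x \<bullet> b\<bar>" R 2] by simp
      show "(?d x)\<^sup>2 \<le> (norm (grad \<psi> x))\<^sup>2"
        using power_mono[OF abs_frechet_derivative_le_norm_grad[OF b, of \<psi> x], of 2] by simp
    qed auto
    finally show "-2 * ((x \<bullet> b) * \<psi> x * ?d x) \<le> (\<psi> x)\<^sup>2 / 2 + 2 * R\<^sup>2 * (norm (grad \<psi> x))\<^sup>2"
      by simp
  qed (use i1 i2 i3 in auto)
  also have "\<dots> = (LINT x|?M. (\<psi> x)\<^sup>2) / 2 + 2 * R\<^sup>2 * (LINT x|?M. (norm (grad \<psi> x))\<^sup>2)"
    using i2 i3 by simp
  finally show ?thesis by simp
qed

text \<open>The partial derivatives of \<open>\<psi>\<close> are themselves test functions, so two weak gradients can be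
  compared without knowing that test functions are dense.\<close>

lemma weak_gradient_inner_grad_unique:
  assumes "open \<Omega>" "bounded \<Omega>" "weak_gradient \<Omega> u g" "weak_gradient \<Omega> u h" "test_function \<Omega> \<psi>"
  shows "(LINT x|lebesgue_on \<Omega>. g x \<bullet> grad \<psi> x) = (LINT x|lebesgue_on \<Omega>. h x \<bullet> grad \<psi> x)"
proof -
  \<comment> \<open>The weak gradient identity is applied to the test functions
    \<open>frechet_derivative \<psi> (at x) b\<close>, one for each basis vector; the resulting
    expression involves \<open>u\<close> but no longer \<open>g\<close>.\<close>
  have *: "(LINT x|lebesgue_on \<Omega>. g x \<bullet> grad \<psi> x)
      = (\<Sum>b\<in>Basis. - ((LINT x|lebesgue_on \<Omega>. u x *\<^sub>R grad (\<lambda>y. frechet_derivative \<psi> (at y) b) x) \<bullet> b))"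
    if wg: "weak_gradient \<Omega> u g" for g
  proof -
    have int: "integrable (lebesgue_on \<Omega>) (\<lambda>x. frechet_derivative \<psi> (at x) b *\<^sub>R g x)"
      if "b \<in> Basis" for b
      using wg test_function_frechet_derivative[OF assms(5) that] assms(1,2)
      by (intro integrable_scaleR_L2 test_function_L2) (auto simp: weak_gradient_def)
    have "integrable (lebesgue_on \<Omega>) (\<lambda>x. (g x \<bullet> b) * frechet_derivative \<psi> (at x) b)"
      if "b \<in> Basis" for b
      using integrable_inner_left[OF int[OF that], of b] by (simp add: mult.commute)
    then have "(LINT x|lebesgue_on \<Omega>. g x \<bullet> grad \<psi> x)
        = (\<Sum>b\<in>Basis. LINT x|lebesgue_on \<Omega>. (g x \<bullet> b) * frechet_derivative \<psi> (at x) b)"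
      unfolding grad_inner_grad by (rule Bochner_Integration.integral_sum)
    also have "\<dots> = (\<Sum>b\<in>Basis. (LINT x|lebesgue_on \<Omega>. frechet_derivative \<psi> (at x) b *\<^sub>R g x) \<bullet> b)"
    proof (rule sum.cong)
      fix b :: 'a assume b: "b \<in> Basis"
      have "(LINT x|lebesgue_on \<Omega>. (frechet_derivative \<psi> (at x) b *\<^sub>R g x) \<bullet> b)
          = (LINT x|lebesgue_on \<Omega>. frechet_derivative \<psi> (at x) b *\<^sub>R g x) \<bullet> b"
        using int[OF b] by (intro integral_inner_left) auto
      then show "(LINT x|lebesgue_on \<Omega>. (g x \<bullet> b) * frechet_derivative \<psi> (at x) b)
          = (LINT x|lebesgue_on \<Omega>. frechet_derivative \<psi> (at x) b *\<^sub>R g x) \<bullet> b"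
        by (simp add: mult.commute)
    qed simp
    also have "\<dots> = (\<Sum>b\<in>Basis. - ((LINT x|lebesgue_on \<Omega>.
        u x *\<^sub>R grad (\<lambda>y. frechet_derivative \<psi> (at y) b) x) \<bullet> b))"
    proof (rule sum.cong)
      fix b :: 'a assume b: "b \<in> Basis"
      show "(LINT x|lebesgue_on \<Omega>. frechet_derivative \<psi> (at x) b *\<^sub>R g x) \<bullet> b
        = - ((LINT x|lebesgue_on \<Omega>. u x *\<^sub>R grad (\<lambda>y. frechet_derivative \<psi> (at y) b) x) \<bullet> b)"
        using wg test_function_frechet_derivative[OF assms(5) b]
        unfolding weak_gradient_def by simp
    qed simp
    finally show ?thesis .
  qed
  show ?thesis using *[OF assms(3)] *[OF assms(4)] by simp
qed

lemma norm_diff_squared_le: "(norm (x - y))\<^sup>2 \<le> 2 * (norm x)\<^sup>2 + 2 * (norm (y::'a::real_inner))\<^sup>2"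
  using zero_le_power2[of "norm (x + y)"]
  by (simp add: power2_norm_eq_inner inner_simps inner_commute)

lemma integral_norm_diff_squared_le:
  fixes f g :: "'a::euclidean_space \<Rightarrow> 'b::euclidean_space"
  assumes "f \<in> L2 \<Omega>" "g \<in> L2 \<Omega>"
  shows "(LINT x|lebesgue_on \<Omega>. (norm (f x - g x))\<^sup>2)
    \<le> 2 * (LINT x|lebesgue_on \<Omega>. (norm (f x))\<^sup>2) + 2 * (LINT x|lebesgue_on \<Omega>. (norm (g x))\<^sup>2)"
proof -
  have "(LINT x|lebesgue_on \<Omega>. (norm (f x - g x))\<^sup>2)
      \<le> (LINT x|lebesgue_on \<Omega>. 2 * (norm (f x))\<^sup>2 + 2 * (norm (g x))\<^sup>2)"
    using L2_integrable[OF assms(1)] L2_integrable[OF assms(2)] L2_integrable[OF L2_diff[OF assms]]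
    by (intro integral_mono norm_diff_squared_le Bochner_Integration.integrable_add
        integrable_mult_right)
  also have "\<dots> = 2 * (LINT x|lebesgue_on \<Omega>. (norm (f x))\<^sup>2) + 2 * (LINT x|lebesgue_on \<Omega>. (norm (g x))\<^sup>2)"
    using L2_integrable[OF assms(1)] L2_integrable[OF assms(2)] by simp
  finally show ?thesis .
qed

text \<open>A nonzero value of a continuous function persists on an open set, and a nonempty open
  set is not negligible.\<close>

lemma continuous_integral_square_zero:
  fixes f :: "'a::euclidean_space \<Rightarrow> real"
  assumes "open \<Omega>" "continuous_on \<Omega> f" "f \<in> L2 \<Omega>" "(LINT x|lebesgue_on \<Omega>. (f x)\<^sup>2) = 0" "x \<in> \<Omega>"
  shows "f x = 0"
proof (rule ccontr)
  assume fx: "f x \<noteq> 0"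
  have "AE x in lebesgue_on \<Omega>. (f x)\<^sup>2 = 0"
    using integral_nonneg_eq_0_iff_AE[of "lebesgue_on \<Omega>" "\<lambda>x. (f x)\<^sup>2"] assms(3,4)
    by (auto simp: L2_real_iff)
  then have "AE x in lebesgue. x \<in> \<Omega> \<longrightarrow> (f x)\<^sup>2 = 0"
    using assms(1) by (subst (asm) AE_restrict_space_iff) auto
  then have n: "negligible {x. \<not> (x \<in> \<Omega> \<longrightarrow> f x = 0)}"
    by (auto simp: negligible_iff_null_sets eventually_ae_filter dest: null_sets_completion_subset)
  have "{x. \<not> (x \<in> \<Omega> \<longrightarrow> f x = 0)} = \<Omega> \<inter> f -` (- {0})" by auto
  moreover have "open (\<Omega> \<inter> f -` (- {0}))"
    using assms(1,2) continuous_open_preimage by blast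
  ultimately have "\<Omega> \<inter> f -` (- {0}) = {}"
    using n open_not_negligible by metis
  then show False using fx assms(5) by auto
qed

text \<open>Energy argument on the approximants. The difference \<open>G\<close> of the two
  gradients is orthogonal to the gradients of all test functions, in particular of those
  approximating it, so these gradients tend to 0 in L2. By the Poincare inequality the approximants
  tend to 0 as well; the difference of the solutions then vanishes in L2, and pointwise by
  continuity.\<close>

lemma torsion_function_unique:
  fixes \<Omega> :: "'a::euclidean_space set"
  assumes op: "open \<Omega>" and bd: "bounded \<Omega>"
    and "is_torsion_function \<Omega> \<phi>" "is_torsion_function \<Omega> \<eta>"
  shows "\<phi> = \<eta>"
proof -
  let ?M = "lebesgue_on \<Omega>"
  obtain R where R: "\<Omega> \<subseteq> cball 0 R" using bd unfolding bounded_iff by (auto simp: subset_iff)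
  \<comment> \<open>Membership in \<open>H1_0\<close> and the weak equation each come with a
    gradient of their own. The equation is transferred to the one that the test functions
    approximate.\<close>
  have ex: "\<exists>g \<psi>. weak_gradient \<Omega> \<phi> g \<and> (\<forall>n::nat. test_function \<Omega> (\<psi> n)) \<and>
     (\<lambda>n. LINT x|?M. (norm (\<phi> x - \<psi> n x))\<^sup>2) \<longlonglongrightarrow> 0 \<and>
     (\<lambda>n. LINT x|?M. (norm (g x - grad (\<psi> n) x))\<^sup>2) \<longlonglongrightarrow> 0 \<and>
     (\<forall>\<psi>. test_function \<Omega> \<psi> \<longrightarrow> (LINT x|?M. g x \<bullet> grad \<psi> x) = (LINT x|?M. \<psi> x))"
    if t: "is_torsion_function \<Omega> \<phi>" for \<phi>
  proof -
    from t have "\<phi> \<in> H1_0 \<Omega>" by (simp add: is_torsion_function_def)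
    then obtain g \<psi> where g: "weak_gradient \<Omega> \<phi> g" "\<forall>n::nat. test_function \<Omega> (\<psi> n)"
       "(\<lambda>n. LINT x|?M. (\<phi> x - \<psi> n x)\<^sup>2) \<longlonglongrightarrow> 0"
       "(\<lambda>n. LINT x|?M. (norm (g x - grad (\<psi> n) x))\<^sup>2) \<longlonglongrightarrow> 0"
      unfolding H1_0_def by blast
    from t obtain h where h: "weak_gradient \<Omega> \<phi> h"
      "\<And>\<psi>. test_function \<Omega> \<psi> \<Longrightarrow> (LINT x|?M. h x \<bullet> grad \<psi> x) = (LINT x|?M. \<psi> x)"
      unfolding is_torsion_function_def by blast
    have "(LINT x|?M. g x \<bullet> grad \<psi> x) = (LINT x|?M. \<psi> x)" if "test_function \<Omega> \<psi>" for \<psi>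
      using weak_gradient_inner_grad_unique[OF op bd g(1) h(1) that] h(2)[OF that] by simp
    then show ?thesis using g by (auto intro!: exI[of _ g] exI[of _ \<psi>])
  qed
  obtain g1 p1 where 1: "weak_gradient \<Omega> \<phi> g1" "\<And>n::nat. test_function \<Omega> (p1 n)"
     "(\<lambda>n. LINT x|?M. (norm (\<phi> x - p1 n x))\<^sup>2) \<longlonglongrightarrow> 0"
     "(\<lambda>n. LINT x|?M. (norm (g1 x - grad (p1 n) x))\<^sup>2) \<longlonglongrightarrow> 0"
     "\<And>\<psi>. test_function \<Omega> \<psi> \<Longrightarrow> (LINT x|?M. g1 x \<bullet> grad \<psi> x) = (LINT x|?M. \<psi> x)"
    using ex[OF assms(3)] by blast
  obtain g2 p2 where 2: "weak_gradient \<Omega> \<eta> g2" "\<And>n::nat. test_function \<Omega> (p2 n)"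
     "(\<lambda>n. LINT x|?M. (norm (\<eta> x - p2 n x))\<^sup>2) \<longlonglongrightarrow> 0"
     "(\<lambda>n. LINT x|?M. (norm (g2 x - grad (p2 n) x))\<^sup>2) \<longlonglongrightarrow> 0"
     "\<And>\<psi>. test_function \<Omega> \<psi> \<Longrightarrow> (LINT x|?M. g2 x \<bullet> grad \<psi> x) = (LINT x|?M. \<psi> x)"
    using ex[OF assms(4)] by blast
  define w where "w x = \<phi> x - \<eta> x" for x
  define G where "G x = g1 x - g2 x" for x
  define p where "p n x = p1 n x - p2 n x" for n x
  have tp: "test_function \<Omega> (p n)" for n
    using test_function_diff[OF 1(2) 2(2)] by (simp add: p_def[abs_def])
  have gp: "grad (p n) x = grad (p1 n) x - grad (p2 n) x" for n x
    using grad_diff[OF test_functionD(1)[OF 1(2)] test_functionD(1)[OF 2(2)]]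
    by (simp add: p_def[abs_def])
  note pL = test_function_L2[OF op bd]
  have L: "\<phi> \<in> L2 \<Omega>" "g1 \<in> L2 \<Omega>" "\<eta> \<in> L2 \<Omega>" "g2 \<in> L2 \<Omega>"
    using 1(1) 2(1) by (auto simp: weak_gradient_def)
  have wL: "w \<in> L2 \<Omega>" "G \<in> L2 \<Omega>"
    using L2_diff[OF L(1,3)] L2_diff[OF L(2,4)] by (simp_all add: w_def[abs_def] G_def[abs_def])
  have lim_w: "(\<lambda>n. LINT x|?M. (norm (w x - p n x))\<^sup>2) \<longlonglongrightarrow> 0"
  proof (rule tendsto_sandwich)
    show "\<forall>\<^sub>F n in sequentially. 0 \<le> (LINT x|?M. (norm (w x - p n x))\<^sup>2)" by simp
    have "(LINT x|?M. (norm (w x - p n x))\<^sup>2)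
      \<le> 2 * (LINT x|?M. (norm (\<phi> x - p1 n x))\<^sup>2) + 2 * (LINT x|?M. (norm (\<eta> x - p2 n x))\<^sup>2)" for n
      using integral_norm_diff_squared_le[OF L2_diff[OF L(1) pL(1)[OF 1(2)]] L2_diff[OF L(3) pL(1)[OF 2(2)]], of n n]
      by (simp add: w_def p_def algebra_simps)
    then show "\<forall>\<^sub>F n in sequentially. (LINT x|?M. (norm (w x - p n x))\<^sup>2)
      \<le> 2 * (LINT x|?M. (norm (\<phi> x - p1 n x))\<^sup>2) + 2 * (LINT x|?M. (norm (\<eta> x - p2 n x))\<^sup>2)" by simp
    show "(\<lambda>n. 2 * (LINT x|?M. (norm (\<phi> x - p1 n x))\<^sup>2) + 2 * (LINT x|?M. (norm (\<eta> x - p2 n x))\<^sup>2))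
      \<longlonglongrightarrow> 0"
      using tendsto_add[OF tendsto_mult[OF tendsto_const 1(3)] tendsto_mult[OF tendsto_const 2(3)], of 2 2] by simp
  qed simp
  have lim_G: "(\<lambda>n. LINT x|?M. (norm (G x - grad (p n) x))\<^sup>2) \<longlonglongrightarrow> 0"
  proof (rule tendsto_sandwich)
    show "\<forall>\<^sub>F n in sequentially. 0 \<le> (LINT x|?M. (norm (G x - grad (p n) x))\<^sup>2)" by simp
    have "(LINT x|?M. (norm (G x - grad (p n) x))\<^sup>2)
      \<le> 2 * (LINT x|?M. (norm (g1 x - grad (p1 n) x))\<^sup>2) + 2 * (LINT x|?M. (norm (g2 x - grad (p2 n) x))\<^sup>2)" for n
      using integral_norm_diff_squared_le[OF L2_diff[OF L(2) pL(2)[OF 1(2)]] L2_diff[OF L(4) pL(2)[OF 2(2)]], of n n]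
      by (simp add: G_def gp algebra_simps)
    then show "\<forall>\<^sub>F n in sequentially. (LINT x|?M. (norm (G x - grad (p n) x))\<^sup>2)
      \<le> 2 * (LINT x|?M. (norm (g1 x - grad (p1 n) x))\<^sup>2) + 2 * (LINT x|?M. (norm (g2 x - grad (p2 n) x))\<^sup>2)" by simp
    show "(\<lambda>n. 2 * (LINT x|?M. (norm (g1 x - grad (p1 n) x))\<^sup>2) + 2 * (LINT x|?M. (norm (g2 x - grad (p2 n) x))\<^sup>2))
      \<longlonglongrightarrow> 0"
      using tendsto_add[OF tendsto_mult[OF tendsto_const 1(4)] tendsto_mult[OF tendsto_const 2(4)], of 2 2] by simp
  qed simp
  have gz: "(LINT x|?M. G x \<bullet> grad (p n) x) = 0" for n
    using 1(5)[OF tp, of n] 2(5)[OF tp, of n]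
      integrable_inner_L2[OF L(2) pL(2)[OF tp]] integrable_inner_L2[OF L(4) pL(2)[OF tp]]
    by (simp add: G_def inner_diff_left)
  \<comment> \<open>Pythagoras: by orthogonality the squared norm of the difference is the sum of
    the two squared norms.\<close>
  have grad_le: "(LINT x|?M. (norm (grad (p n) x))\<^sup>2) \<le> (LINT x|?M. (norm (G x - grad (p n) x))\<^sup>2)" for n
  proof -
    have "(LINT x|?M. (norm (G x - grad (p n) x))\<^sup>2)
       = (LINT x|?M. (norm (G x))\<^sup>2 + (norm (grad (p n) x))\<^sup>2 - 2 * (G x \<bullet> grad (p n) x))"
      by (simp add: power2_norm_eq_inner inner_diff inner_commute)
    also have "\<dots> = (LINT x|?M. (norm (G x))\<^sup>2) + (LINT x|?M. (norm (grad (p n) x))\<^sup>2)"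
      using gz L2_integrable[OF wL(2)] L2_integrable[OF pL(2)[OF tp]]
        integrable_inner_L2[OF wL(2) pL(2)[OF tp]] by simp
    finally show ?thesis by simp
  qed
  have w_le: "(LINT x|?M. (norm (w x))\<^sup>2)
     \<le> 2 * (LINT x|?M. (norm (w x - p n x))\<^sup>2) + 8 * R\<^sup>2 * (LINT x|?M. (norm (G x - grad (p n) x))\<^sup>2)" for n
  proof -
    have "(\<lambda>x. - p n x) \<in> L2 \<Omega>"
      using pL(1)[OF tp] by (simp add: L2_real_iff)
    from integral_norm_diff_squared_le[OF L2_diff[OF wL(1) pL(1)[OF tp]] this, of n]
    have "(LINT x|?M. (norm (w x))\<^sup>2)
       \<le> 2 * (LINT x|?M. (norm (w x - p n x))\<^sup>2) + 2 * (LINT x|?M. (p n x)\<^sup>2)"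
      by simp
    also have "(LINT x|?M. (p n x)\<^sup>2) \<le> 4 * R\<^sup>2 * (LINT x|?M. (norm (grad (p n) x))\<^sup>2)"
      by (rule poincare_inequality[OF op R tp])
    also have "\<dots> \<le> 4 * R\<^sup>2 * (LINT x|?M. (norm (G x - grad (p n) x))\<^sup>2)"
      by (intro mult_left_mono grad_le) simp
    finally show ?thesis by simp
  qed
  have "(LINT x|?M. (norm (w x))\<^sup>2) \<le> 0"
  proof (rule LIMSEQ_le_const)
    show "(\<lambda>n. 2 * (LINT x|?M. (norm (w x - p n x))\<^sup>2) + 8 * R\<^sup>2 * (LINT x|?M. (norm (G x - grad (p n) x))\<^sup>2))
      \<longlonglongrightarrow> 0"
      using tendsto_add[OF tendsto_mult[OF tendsto_const lim_w] tendsto_mult[OF tendsto_const lim_G], of 2 "8 * R\<^sup>2"] by simp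
  qed (use w_le in auto)
  moreover have "(LINT x|?M. (w x)\<^sup>2) \<ge> 0" by (intro Bochner_Integration.integral_nonneg) simp
  ultimately have "(LINT x|?M. (w x)\<^sup>2) = 0" by simp
  moreover have "continuous_on \<Omega> w"
    using assms(3,4) unfolding is_torsion_function_def w_def[abs_def]
    by (intro continuous_on_diff) auto
  ultimately have "w x = 0" if "x \<in> \<Omega>" for x
    using continuous_integral_square_zero[OF op _ wL(1) _ that] by blast
  moreover have "w x = 0" if "x \<notin> \<Omega>" for x
    using assms(3,4) that by (simp add: is_torsion_function_def w_def)
  ultimately show ?thesis by (auto simp: w_def fun_eq_iff)
qed

section \<open>A smooth cutoff on rectangles\<close>

text \<open>With w = 1/t, the derivative in t of p(w) exp(-w) is w^2 (p(w) - p'(w)) exp(-w); the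
  recursion iterates this.\<close>

fun bump_poly :: "nat \<Rightarrow> real poly" where
  "bump_poly 0 = 1"
| "bump_poly (Suc n) = [:0, 0, 1:] * (bump_poly n - pderiv (bump_poly n))"

text \<open>The \<open>n\<close>-th derivative of exp(-1/t), extended by 0 to the closed left
  half-line; the whole sequence is what \<open>smooth_compose\<close> asks for.\<close>

definition bump :: "nat \<Rightarrow> real \<Rightarrow> real" where
  "bump n t = (if t > 0 then poly (bump_poly n) (1 / t) * exp (- (1 / t)) else 0)"

lemma poly_times_exp_minus_tendsto_0:
  "((\<lambda>w. poly (p :: real poly) w * exp (- w)) \<longlongrightarrow> 0) at_top"
proof -
  have "((\<lambda>w. \<Sum>i\<le>degree p. coeff p i * (w ^ i / exp w)) \<longlongrightarrow> (\<Sum>i\<le>degree p. coeff p i * 0)) at_top"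
    by (intro tendsto_sum tendsto_mult tendsto_const tendsto_power_div_exp_0)
  moreover have "(\<lambda>w. \<Sum>i\<le>degree p. coeff p i * (w ^ i / exp w)) = (\<lambda>w. poly p w * exp (- w))"
    by (simp add: poly_altdef sum_divide_distrib exp_minus field_simps)
  ultimately show ?thesis by simp
qed

lemma bump_has_derivative: "(bump n has_real_derivative bump (Suc n) t) (at t)"
proof -
  consider "t > 0" | "t < 0" | "t = 0" by linarith
  then show ?thesis
  proof cases
    case 1
    have "((\<lambda>t. poly (bump_poly n) (1 / t) * exp (- (1 / t))) has_real_derivative bump (Suc n) t) (at t)"
      using 1
      by (auto intro!: derivative_eq_intros DERIV_chain'[where g = "poly _"] poly_DERIV
          simp: bump_def field_simps power2_eq_square)
    then show ?thesis
      by (rule has_field_derivative_transform_within_open[where S = "{0<..}"]) (use 1 in \<open>auto simp: bump_def\<close>)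
  next
    case 2
    have "((\<lambda>t. 0) has_real_derivative bump (Suc n) t) (at t)"
      using 2 by (auto simp: bump_def)
    then show ?thesis
      by (rule has_field_derivative_transform_within_open[where S = "{..<0}"]) (use 2 in \<open>auto simp: bump_def\<close>)
  next
    case 3
    \<comment> \<open>From the right, w = 1/h turns the quotient into w p(w) exp(-w) for large w, a
      polynomial against an exponential.\<close>
    have "((\<lambda>h. bump n h / h) \<longlongrightarrow> 0) (at 0)"
    proof (rule filterlim_split_at)
      show "((\<lambda>h. bump n h / h) \<longlongrightarrow> 0) (at_left 0)"
        by (rule tendsto_eventually) (auto simp: eventually_at_filter bump_def)
      have "((\<lambda>w. poly (bump_poly n * [:0, 1:]) w * exp (- w)) \<longlongrightarrow> 0) at_top"
        by (rule poly_times_exp_minus_tendsto_0)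
      moreover have "\<forall>\<^sub>F w in at_top. poly (bump_poly n * [:0, 1:]) w * exp (- w)
          = bump n (inverse w) / inverse w"
        using eventually_gt_at_top[of 0] by eventually_elim (auto simp: bump_def field_simps)
      ultimately have "((\<lambda>w. bump n (inverse w) / inverse w) \<longlongrightarrow> 0) at_top"
        by (rule Lim_transform_eventually)
      then show "((\<lambda>h. bump n h / h) \<longlongrightarrow> 0) (at_right 0)"
        by (simp add: filterlim_at_right_to_top)
    qed
    then show ?thesis using 3 by (simp add: has_field_derivative_iff bump_def)
  qed
qed

lemma bump_0: "bump 0 t = (if t > 0 then exp (- (1 / t)) else 0)"
  by (simp add: bump_def)

lemma bump_1: "bump (Suc 0) t = (if t > 0 then (1 / t)\<^sup>2 * exp (- (1 / t)) else 0)"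
  by (simp add: bump_def power2_eq_square)

lemma bump_0_bounds: "0 \<le> bump 0 t" "bump 0 t \<le> 1"
  by (auto simp: bump_0)

lemma bump_0_at_top: "(bump 0 \<longlongrightarrow> 1) at_top"
proof -
  have "((\<lambda>t::real. exp (- (1 / t))) \<longlongrightarrow> exp (- 0)) at_top"
    by (intro tendsto_intros tendsto_exp tendsto_minus
        tendsto_divide_0[OF tendsto_const] filterlim_at_top_imp_at_infinity filterlim_ident)
  moreover have "\<forall>\<^sub>F t::real in at_top. exp (- (1 / t)) = bump 0 t"
    using eventually_gt_at_top[of 0] by eventually_elim (simp add: bump_0)
  ultimately show ?thesis
    using Lim_transform_eventually by fastforce
qed

lemma bump_1_nonneg: "0 \<le> bump (Suc 0) t"
  by (auto simp: bump_1)

text \<open>Controls the part of the gradient in which the cutoff is differentiated. There t is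
  \<open>real (Suc n) * (A\<^sup>2 - (fst z)\<^sup>2)\<close>: the derivative of the cutoff brings
  the factor n + 1, and the function being cut off is at most a multiple of A^2 - x^2. With w = 1/(t
  - 1) the left-hand side becomes (w + w^2) exp(-w), and w + w^2 is at most 3 (1 + w +
  w^2/2).\<close>

lemma bump_1_weighted_le: "t * bump (Suc 0) (t - 1) \<le> 3"
proof (cases "t > 1")
  case True
  define w where "w = 1 / (t - 1)"
  have w: "w > 0" "t = 1 + 1 / w" using True by (auto simp: w_def)
  have "t * w = 1 + w" using w by (simp add: field_simps)
  then have "t * w * w = (1 + w) * w" by simp
  then have "t * w\<^sup>2 = w + w\<^sup>2" by (simp add: field_simps power2_eq_square)
  then have "t * bump (Suc 0) (t - 1) = (w + w\<^sup>2) * exp (- w)"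
    using True by (simp add: bump_1 w_def[symmetric] flip: mult.assoc)
  also have "\<dots> = (w + w\<^sup>2) / exp w" by (simp add: exp_minus field_simps)
  also have "\<dots> \<le> 3"
  proof -
    have "1 + w + w\<^sup>2 / 2 \<le> exp w" using w(1) by (intro exp_lower_Taylor_quadratic) simp
    then have "w + w\<^sup>2 \<le> 3 * exp w" using w(1) zero_le_power2[of w] by linarith
    then show ?thesis by (simp add: divide_le_eq)
  qed
  finally show ?thesis .
qed (simp add: bump_1)

lemma bump_1_weighted_tendsto_0: "((\<lambda>t. t * bump (Suc 0) (t - 1)) \<longlongrightarrow> 0) at_top"
proof (rule tendsto_sandwich)
  show "\<forall>\<^sub>F t in at_top. 0 \<le> t * bump (Suc 0) (t - 1)"
    using eventually_ge_at_top[of 0] by eventually_elim (simp add: bump_1_nonneg)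
  show "\<forall>\<^sub>F t in at_top. t * bump (Suc 0) (t - 1) \<le> t / (t - 1)\<^sup>2"
    using eventually_gt_at_top[of 1]
  proof eventually_elim
    case (elim t)
    have "(1 / (t - 1))\<^sup>2 * exp (- (1 / (t - 1))) \<le> (1 / (t - 1))\<^sup>2 * 1"
      using elim by (intro mult_left_mono) auto
    then have "t * bump (Suc 0) (t - 1) \<le> t * (1 / (t - 1))\<^sup>2"
      using elim by (intro mult_left_mono) (auto simp: bump_1)
    then show ?case by (simp add: power_divide)
  qed
  show "((\<lambda>t::real. t / (t - 1)\<^sup>2) \<longlongrightarrow> 0) at_top" by real_asymp
qed simp

text \<open>The shift by 1 makes a factor vanish wherever A^2 - x^2 is at most 1/(n + 1), hence near
  the sides; at a fixed interior point the argument tends to infinity and the factor to 1. Unlike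
  the distance to the sides, A^2 - x^2 is smooth.\<close>

definition cutoff :: "real \<Rightarrow> real \<Rightarrow> nat \<Rightarrow> real \<times> real \<Rightarrow> real" where
  "cutoff A B n z = bump 0 (real (Suc n) * (A\<^sup>2 - (fst z)\<^sup>2) - 1)
     * bump 0 (real (Suc n) * (B\<^sup>2 - (snd z)\<^sup>2) - 1)"

lemma grad_mult:
  "smooth f \<Longrightarrow> smooth g \<Longrightarrow> grad (\<lambda>x. f x * g x) x = f x *\<^sub>R grad g x + g x *\<^sub>R grad f x"
  by (simp add: grad_def frechet_derivative_mult_at smooth_differentiable scaleR_add_left
      sum.distrib scaleR_sum_right mult.commute)

lemma smooth_fst: "smooth (fst :: real \<times> real \<Rightarrow> real)"
  and smooth_snd: "smooth (snd :: real \<times> real \<Rightarrow> real)"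
  by (auto intro: smooth_linear bounded_linear_fst bounded_linear_snd)

lemma smooth_cutoff_factor:
  fixes r :: "real \<times> real \<Rightarrow> real"
  assumes "smooth r"
  shows "smooth (\<lambda>z. bump k (c * (A\<^sup>2 - (r z)\<^sup>2) - 1))"
proof (rule smooth_compose[where D = bump, OF bump_has_derivative])
  have "smooth (\<lambda>z. c * (A\<^sup>2 - r z * r z) - 1)"
    using assms by (intro smooth_diff smooth_mult smooth_const)
  then show "smooth (\<lambda>z. c * (A\<^sup>2 - (r z)\<^sup>2) - 1)" by (simp add: power2_eq_square)
qed

lemma grad_cutoff_factor:
  fixes r :: "real \<times> real \<Rightarrow> real"
  assumes "smooth r"
  shows "grad (\<lambda>z. bump 0 (c * (A\<^sup>2 - (r z)\<^sup>2) - 1)) z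
     = (bump (Suc 0) (c * (A\<^sup>2 - (r z)\<^sup>2) - 1) * (- 2 * c * r z)) *\<^sub>R grad r z"
proof -
  have d: "((\<lambda>t. bump 0 (c * (A\<^sup>2 - t\<^sup>2) - 1)) has_real_derivative
      bump (Suc 0) (c * (A\<^sup>2 - (r z)\<^sup>2) - 1) * (- 2 * c * r z)) (at (r z))"
    by (rule DERIV_cong[OF DERIV_chain2[OF bump_has_derivative]])
      (auto intro!: derivative_eq_intros)
  show ?thesis
    unfolding grad_def
    by (subst frechet_derivative_compose_real[OF smooth_differentiable[OF assms] d])
      (simp add: scaleR_sum_right)
qed

lemma norm_grad_fst_snd: "norm (grad (fst :: real \<times> real \<Rightarrow> real) z) = 1"
  "norm (grad (snd :: real \<times> real \<Rightarrow> real) z) = 1"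
proof -
  have "frechet_derivative fst (at z) v = fst v" "frechet_derivative snd (at z) v = snd v"
    for v :: "real \<times> real"
    by (auto intro!: frechet_derivative_eqI bounded_linear_imp_has_derivative
        bounded_linear_fst bounded_linear_snd)
  then show "norm (grad (fst :: real \<times> real \<Rightarrow> real) z) = 1"
    "norm (grad (snd :: real \<times> real \<Rightarrow> real) z) = 1"
    by (auto simp: grad_def Basis_prod_def sum.union_disjoint image_iff norm_Pair
        sum.reindex inj_on_def)
qed

lemma test_function_cutoff:
  assumes "smooth U" "A > 0" "B > 0"
  shows "test_function ({-A<..<A} \<times> {-B<..<B}) (\<lambda>z. cutoff A B n z * U z)"
proof -
  let ?c = "1 / real (Suc n)"
  let ?C = "{z. A\<^sup>2 - (fst z)\<^sup>2 \<ge> ?c} \<inter> {z. B\<^sup>2 - (snd z)\<^sup>2 \<ge> ?c}"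
  have abs: "\<bar>x\<bar> < A" if "A\<^sup>2 - x\<^sup>2 \<ge> ?c" "A > 0" for x A :: real
  proof -
    have "?c > 0" by simp
    then have "x\<^sup>2 < A\<^sup>2" using that(1) by linarith
    then show ?thesis using that(2) power2_less_imp_less[of "\<bar>x\<bar>" A] by simp
  qed
  have sub: "?C \<subseteq> {-A<..<A} \<times> {-B<..<B}"
    using abs[OF _ assms(2)] abs[OF _ assms(3)] by (fastforce simp: abs_less_iff)
  have cl: "closed ?C"
    by (intro closed_Int closed_Collect_le continuous_intros)
  have "bounded ?C"
    using sub bounded_subset bounded_Times[of "{-A<..<A}" "{-B<..<B}"] by auto
  then have cC: "compact ?C" using cl compact_eq_bounded_closed by blast
  have "{z. cutoff A B n z * U z \<noteq> 0} \<subseteq> ?C"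
    by (auto simp: cutoff_def bump_0 field_simps split: if_splits)
  then have s: "closure {z. cutoff A B n z * U z \<noteq> 0} \<subseteq> ?C"
    using cl closure_minimal by blast
  then have "compact (closure {z. cutoff A B n z * U z \<noteq> 0})"
    using bounded_subset[OF _ s] cC by (simp add: compact_eq_bounded_closed)
  moreover have "smooth (\<lambda>z. cutoff A B n z * U z)"
    unfolding cutoff_def by (intro smooth_mult smooth_cutoff_factor smooth_fst smooth_snd assms)
  ultimately show ?thesis using s sub by (auto simp: test_function_def smooth_def)
qed

section \<open>A criterion for torsion functions of rectangles\<close>

lemma has_derivative_grad:
  assumes "f differentiable (at x)"
  shows "(f has_derivative (\<lambda>v. v \<bullet> grad f x)) (at x)"
proof -
  have "frechet_derivative f (at x) v = v \<bullet> grad f x" for v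
  proof -
    have "frechet_derivative f (at x) v = frechet_derivative f (at x) (\<Sum>b\<in>Basis. (v \<bullet> b) *\<^sub>R b)"
      by (simp add: euclidean_representation)
    also have "\<dots> = (\<Sum>b\<in>Basis. (v \<bullet> b) * frechet_derivative f (at x) b)"
      using linear_frechet_derivative[OF assms] by (simp add: linear_sum linear_cmul)
    finally show ?thesis by (simp add: grad_inner_grad)
  qed
  then show ?thesis
    using frechet_derivative_worksI[OF assms] by presburger
qed

lemma smooth_lipschitz:
  assumes "smooth f" "\<And>z. norm (grad f z) \<le> K"
  shows "\<bar>f x - f y\<bar> \<le> K * norm (x - y)"
proof -
  have "norm (f x - f y) \<le> K * norm (x - y)"
  proof (rule differentiable_bound[of UNIV])
    fix z
    show "(f has_derivative (\<lambda>v. v \<bullet> grad f z)) (at z within UNIV)"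
      using assms(1) by (simp add: has_derivative_grad smooth_differentiable)
    show "onorm (\<lambda>v. v \<bullet> grad f z) \<le> K"
    proof (rule onorm_le)
      fix v
      have "norm (v \<bullet> grad f z) \<le> norm v * norm (grad f z)"
        using Cauchy_Schwarz_ineq2 by simp
      also have "\<dots> \<le> norm v * K" using assms(2) by (intro mult_left_mono) auto
      finally show "norm (v \<bullet> grad f z) \<le> K * norm v" by (simp add: mult.commute)
    qed
  qed auto
  then show ?thesis by simp
qed

lemma weak_gradient_identity_smooth:
  assumes "open \<Omega>" "bounded \<Omega>" "smooth f" "test_function \<Omega> \<psi>"
  shows "(LINT x|lebesgue_on \<Omega>. f x *\<^sub>R grad \<psi> x) = - (LINT x|lebesgue_on \<Omega>. \<psi> x *\<^sub>R grad f x)"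
proof (rule euclidean_eqI)
  fix b :: 'a assume b: "b \<in> Basis"
  note L = smooth_L2[OF assms(1,2)] and s = test_functionD(1)[OF assms(4)]
  have "(LINT x|lebesgue_on \<Omega>. f x *\<^sub>R grad \<psi> x) \<bullet> b = (LINT x|lebesgue_on \<Omega>. (f x *\<^sub>R grad \<psi> x) \<bullet> b)"
    using integrable_scaleR_L2[OF L(1)[OF assms(3)] L(2)[OF s]]
    by (intro integral_inner_left[symmetric]) auto
  also have "\<dots> = (LINT x|lebesgue_on \<Omega>. f x * frechet_derivative \<psi> (at x) b)"
    using b by (simp add: inner_grad)
  also have "\<dots> = - (LINT x|lebesgue_on \<Omega>. frechet_derivative f (at x) b * \<psi> x)"
    by (rule integration_by_parts_test_function[OF assms b])
  also have "(LINT x|lebesgue_on \<Omega>. frechet_derivative f (at x) b * \<psi> x)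
      = (LINT x|lebesgue_on \<Omega>. (\<psi> x *\<^sub>R grad f x) \<bullet> b)"
    using b by (simp add: inner_grad mult.commute)
  also have "\<dots> = (LINT x|lebesgue_on \<Omega>. \<psi> x *\<^sub>R grad f x) \<bullet> b"
    using integrable_scaleR_L2[OF L(1)[OF s] L(2)[OF assms(3)]]
    by (intro integral_inner_left) auto
  finally show "(LINT x|lebesgue_on \<Omega>. f x *\<^sub>R grad \<psi> x) \<bullet> b
      = - (LINT x|lebesgue_on \<Omega>. \<psi> x *\<^sub>R grad f x) \<bullet> b" by simp
qed

text \<open>Replaces the distance to the nearest side by the quantity in which the cutoff is
  written.\<close>

lemma dist_to_side_le:
  fixes t A :: real
  assumes "\<bar>t\<bar> < A"
  shows "A - \<bar>t\<bar> \<le> (A\<^sup>2 - t\<^sup>2) / A"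
proof -
  have "A * (A - \<bar>t\<bar>) \<le> (A + \<bar>t\<bar>) * (A - \<bar>t\<bar>)"
    using assms by (intro mult_right_mono) auto
  also have "\<dots> = A\<^sup>2 - t\<^sup>2" by (simp add: power2_eq_square algebra_simps)
  finally show ?thesis using assms by (simp add: field_simps)
qed

text \<open>The uniform gradient bound \<open>K\<close> and the zero boundary values bound
  \<open>U n\<close> by \<open>K\<close> times the distance to the sides. This compensates the
  growth of the gradient of the cutoff, so the cut-off functions \<open>\<psi> n\<close> tend to
  \<open>u\<close>, and their gradients to \<open>g\<close>, pointwise and boundedly, hence in L2.
  The equation is asked for only in the limit because the approximants solve it only
  approximately.\<close>

lemma is_torsion_function_rectangleI:
  fixes U :: "nat \<Rightarrow> real \<times> real \<Rightarrow> real" and A B :: real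
  defines "\<Omega> \<equiv> {-A<..<A} \<times> {-B<..<B}"
  assumes A: "A > 0" and B: "B > 0"
    and sm: "\<And>n. smooth (U n)"
    and K: "\<And>n z. norm (grad (U n) z) \<le> K"
    and bdry: "\<And>n z. \<bar>fst z\<bar> = A \<or> \<bar>snd z\<bar> = B \<Longrightarrow> U n z = 0"
    and lim: "\<And>z. (\<lambda>n. U n z) \<longlonglongrightarrow> u z"
    and glim: "\<And>z. (\<lambda>n. grad (U n) z) \<longlonglongrightarrow> g z"
    and eq: "\<And>\<psi>. test_function \<Omega> \<psi> \<Longrightarrow>
        (\<lambda>n. LINT x|lebesgue_on \<Omega>. grad (U n) x \<bullet> grad \<psi> x) \<longlonglongrightarrow> (LINT x|lebesgue_on \<Omega>. \<psi> x)"
  shows "is_torsion_function \<Omega> (\<lambda>z. if z \<in> \<Omega> then u z else 0)"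
proof -
  let ?M = "lebesgue_on \<Omega>"
  have op: "open \<Omega>" unfolding \<Omega>_def by (intro open_Times) auto
  have bd: "bounded \<Omega>" unfolding \<Omega>_def by (intro bounded_Times) auto
  have "\<Omega> \<in> lmeasurable" using op bd by (simp add: lmeasurable_open)
  then interpret finite_measure ?M by (rule finite_measure_lebesgue_on)
  have K0: "K \<ge> 0" using K[of 0 0] norm_ge_zero order_trans by blast
  have mU [measurable]: "U n \<in> borel_measurable ?M" and mG [measurable]: "grad (U n) \<in> borel_measurable ?M" for n
    using L2_measurable smooth_L2[OF op bd sm] by blast+
  have mu [measurable]: "u \<in> borel_measurable ?M"
    by (rule borel_measurable_LIMSEQ_real[OF _ mU]) (rule lim)
  have mg [measurable]: "g \<in> borel_measurable ?M"
    by (rule borel_measurable_LIMSEQ_metric[OF mG]) (rule glim)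
  have U_fst: "\<bar>U n z\<bar> \<le> K / A * (A\<^sup>2 - (fst z)\<^sup>2)" if "z \<in> \<Omega>" for n z
  proof -
    obtain x y where z: "z = (x, y)" by (cases z)
    have x: "\<bar>x\<bar> < A" using that z by (auto simp: \<Omega>_def)
    \<comment> \<open>The nearest vertical side, on which \<open>U n\<close> vanishes.\<close>
    define s where "s = (if x \<ge> 0 then A else - A)"
    have "\<bar>U n (x, y) - U n (s, y)\<bar> \<le> K * norm ((x, y) - (s, y))"
      by (rule smooth_lipschitz[OF sm K])
    moreover have "U n (s, y) = 0" using A by (intro bdry) (auto simp: s_def)
    moreover have "norm ((x, y) - (s, y)) = A - \<bar>x\<bar>" using x by (auto simp: s_def norm_Pair)
    ultimately have "\<bar>U n z\<bar> \<le> K * (A - \<bar>x\<bar>)" using z by simp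
    also have "\<dots> \<le> K * ((A\<^sup>2 - x\<^sup>2) / A)" using dist_to_side_le[OF x] K0 by (rule mult_left_mono)
    finally show ?thesis using z by simp
  qed
  have U_snd: "\<bar>U n z\<bar> \<le> K / B * (B\<^sup>2 - (snd z)\<^sup>2)" if "z \<in> \<Omega>" for n z
  proof -
    obtain x y where z: "z = (x, y)" by (cases z)
    have y: "\<bar>y\<bar> < B" using that z by (auto simp: \<Omega>_def)
    define s where "s = (if y \<ge> 0 then B else - B)"
    have "\<bar>U n (x, y) - U n (x, s)\<bar> \<le> K * norm ((x, y) - (x, s))"
      by (rule smooth_lipschitz[OF sm K])
    moreover have "U n (x, s) = 0" using B by (intro bdry) (auto simp: s_def)
    moreover have "norm ((x, y) - (x, s)) = B - \<bar>y\<bar>" using y by (auto simp: s_def norm_Pair)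
    ultimately have "\<bar>U n z\<bar> \<le> K * (B - \<bar>y\<bar>)" using z by simp
    also have "\<dots> \<le> K * ((B\<^sup>2 - y\<^sup>2) / B)" using dist_to_side_le[OF y] K0 by (rule mult_left_mono)
    finally show ?thesis using z by simp
  qed
  have Ub: "\<bar>U n z\<bar> \<le> K * A" if "z \<in> \<Omega>" for n z
  proof -
    have "K / A * (A\<^sup>2 - (fst z)\<^sup>2) \<le> K / A * A\<^sup>2" using K0 A by (intro mult_left_mono) auto
    then show ?thesis using U_fst[OF that, of n] A by (simp add: power2_eq_square)
  qed
  have ub: "\<bar>u z\<bar> \<le> K * A" if "z \<in> \<Omega>" for z
    using tendsto_rabs[OF lim[of z]] Ub[OF that] by (intro LIMSEQ_le_const2) auto
  have gb: "norm (g z) \<le> K" for z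
    using LIMSEQ_le_const2[OF tendsto_norm[OF glim[of z]], of K] K by blast
  have ulip: "\<bar>u x - u y\<bar> \<le> K * norm (x - y)" for x y
    using LIMSEQ_le_const2[OF tendsto_rabs[OF tendsto_diff[OF lim[of x] lim[of y]]]]
      smooth_lipschitz[OF sm K] by blast
  have contu: "continuous_on S u" for S
  proof -
    have "K-lipschitz_on S u" using K0 ulip by (auto simp: lipschitz_on_def dist_norm)
    then show ?thesis by (rule lipschitz_on_continuous_on)
  qed
  have uL2: "u \<in> L2 \<Omega>"
    using ub by (intro L2_bounded_continuous[OF op bd contu, of "K * A"]) auto
  have gL2: "g \<in> L2 \<Omega>"
  proof -
    have "integrable ?M (\<lambda>x. (norm (g x))\<^sup>2)"
      using gb power_mono[OF gb norm_ge_zero, of _ 2] by (intro integrable_const_bound[of _ "K\<^sup>2"]) auto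
    then show ?thesis by (simp add: L2_def)
  qed
  have wg: "weak_gradient \<Omega> u g"
    unfolding weak_gradient_def
  proof (intro conjI uL2 gL2 allI impI)
    fix \<psi> assume t: "test_function \<Omega> \<psi>"
    note tL = test_function_L2[OF op bd t]
    have [measurable]: "\<psi> \<in> borel_measurable ?M" "grad \<psi> \<in> borel_measurable ?M"
      using tL L2_measurable by blast+
    have one: "(\<lambda>_. 1::real) \<in> L2 \<Omega>"
      by (intro L2_bounded_continuous[OF op bd, of _ 1]) auto
    have i1: "integrable ?M (\<lambda>x. K * A * norm (grad \<psi> x))"
      using integrable_norm_mult_L2[OF one tL(2)] by simp
    have i2: "integrable ?M (\<lambda>x. K * norm (\<psi> x))"
      using integrable_norm_mult_L2[OF one tL(1)] by simp
    have l1: "(\<lambda>n. LINT x|?M. U n x *\<^sub>R grad \<psi> x) \<longlonglongrightarrow> (LINT x|?M. u x *\<^sub>R grad \<psi> x)"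
      by (rule integral_dominated_convergence[OF _ _ i1])
        (auto intro!: AE_I2 tendsto_scaleR lim mult_right_mono Ub)
    have l2: "(\<lambda>n. LINT x|?M. \<psi> x *\<^sub>R grad (U n) x) \<longlonglongrightarrow> (LINT x|?M. \<psi> x *\<^sub>R g x)"
      by (rule integral_dominated_convergence[OF _ _ i2])
        (auto intro!: AE_I2 tendsto_scaleR glim simp: mult.commute[of K] intro: mult_left_mono K)
    have "(\<lambda>n. LINT x|?M. U n x *\<^sub>R grad \<psi> x) \<longlonglongrightarrow> - (LINT x|?M. \<psi> x *\<^sub>R g x)"
      using tendsto_minus[OF l2] by (simp add: weak_gradient_identity_smooth[OF op bd sm t])
    then show "(LINT x|?M. u x *\<^sub>R grad \<psi> x) = - (LINT x|?M. \<psi> x *\<^sub>R g x)"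
      using l1 LIMSEQ_unique by blast
  qed
  \<comment> \<open>The two factors of \<open>cutoff\<close> and, primed, the values of
    \<open>bump (Suc 0)\<close> that enter their gradients. One index \<open>n\<close> serves both
    the cutoff and the approximant.\<close>
  define P where "P n z = bump 0 (real (Suc n) * (A\<^sup>2 - (fst z)\<^sup>2) - 1)" for n and z :: "real \<times> real"
  define Q where "Q n z = bump 0 (real (Suc n) * (B\<^sup>2 - (snd z)\<^sup>2) - 1)" for n and z :: "real \<times> real"
  define P' where "P' n z = bump (Suc 0) (real (Suc n) * (A\<^sup>2 - (fst z)\<^sup>2) - 1)" for n and z :: "real \<times> real"
  define Q' where "Q' n z = bump (Suc 0) (real (Suc n) * (B\<^sup>2 - (snd z)\<^sup>2) - 1)" for n and z :: "real \<times> real"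
  define \<psi> where "\<psi> n z = P n z * Q n z * U n z" for n z
  have tp: "test_function \<Omega> (\<psi> n)" for n
    using test_function_cutoff[OF sm A B, of n n]
    by (simp add: \<psi>_def[abs_def] P_def Q_def cutoff_def \<Omega>_def)
  have sP: "smooth (P n)" and sQ: "smooth (Q n)" for n
    unfolding P_def[abs_def] Q_def[abs_def] by (intro smooth_cutoff_factor smooth_fst smooth_snd)+
  have bP: "0 \<le> P n z" "P n z \<le> 1" and bQ: "0 \<le> Q n z" "Q n z \<le> 1" for n z
    unfolding P_def Q_def using bump_0_bounds by auto
  have bP': "0 \<le> P' n z" and bQ': "0 \<le> Q' n z" for n z
    unfolding P'_def Q'_def using bump_1_nonneg by auto
  have gP: "grad (P n) z = (P' n z * (- 2 * real (Suc n) * fst z)) *\<^sub>R grad fst z" for n z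
    unfolding P_def[abs_def] P'_def by (rule grad_cutoff_factor[OF smooth_fst])
  have gQ: "grad (Q n) z = (Q' n z * (- 2 * real (Suc n) * snd z)) *\<^sub>R grad snd z" for n z
    unfolding Q_def[abs_def] Q'_def by (rule grad_cutoff_factor[OF smooth_snd])
  \<comment> \<open>The parts of the gradient of \<open>\<psi> n\<close> in which a cutoff factor is
    differentiated; only they carry a factor of order \<open>n\<close>.\<close>
  define RP where "RP n z = (Q n z * U n z) *\<^sub>R grad (P n) z" for n z
  define RQ where "RQ n z = (P n z * U n z) *\<^sub>R grad (Q n) z" for n z
  have g\<psi>: "grad (\<psi> n) z = (P n z * Q n z) *\<^sub>R grad (U n) z + (RP n z + RQ n z)" for n z
    unfolding \<psi>_def[abs_def] RP_def RQ_def grad_mult[OF smooth_mult[OF sP sQ] sm] grad_mult[OF sP sQ]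
    by (simp add: algebra_simps)
  have nRP: "norm (RP n z) \<le> 2 * K * (real (Suc n) * (A\<^sup>2 - (fst z)\<^sup>2) * P' n z)" if z: "z \<in> \<Omega>" for n z
  proof -
    have "\<bar>fst z\<bar> \<le> A" using z by (auto simp: \<Omega>_def)
    have "norm (RP n z) = Q n z * (\<bar>U n z\<bar> * (P' n z * (2 * real (Suc n)) * \<bar>fst z\<bar>))"
      using bQ[of n z] bP'[of n z] by (simp add: RP_def gP abs_mult norm_grad_fst_snd)
    also have "\<dots> \<le> 1 * (\<bar>U n z\<bar> * (P' n z * (2 * real (Suc n)) * \<bar>fst z\<bar>))"
      using bQ[of n z] bP'[of n z] by (intro mult_right_mono) auto
    also have "\<dots> \<le> 1 * ((K / A * (A\<^sup>2 - (fst z)\<^sup>2)) * (P' n z * (2 * real (Suc n)) * A))"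
      using bP'[of n z] U_fst[OF z, of n] \<open>\<bar>fst z\<bar> \<le> A\<close>
      by (intro mult_mono mult_nonneg_nonneg order_refl order_trans[OF abs_ge_zero U_fst[OF z, of n]]) auto
    also have "\<dots> = 2 * K * (real (Suc n) * (A\<^sup>2 - (fst z)\<^sup>2) * P' n z)" using A by simp
    finally show ?thesis .
  qed
  have nRQ: "norm (RQ n z) \<le> 2 * K * (real (Suc n) * (B\<^sup>2 - (snd z)\<^sup>2) * Q' n z)" if z: "z \<in> \<Omega>" for n z
  proof -
    have "\<bar>snd z\<bar> \<le> B" using z by (auto simp: \<Omega>_def)
    have "norm (RQ n z) = P n z * (\<bar>U n z\<bar> * (Q' n z * (2 * real (Suc n)) * \<bar>snd z\<bar>))"
      using bP[of n z] bQ'[of n z] by (simp add: RQ_def gQ abs_mult norm_grad_fst_snd)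
    also have "\<dots> \<le> 1 * (\<bar>U n z\<bar> * (Q' n z * (2 * real (Suc n)) * \<bar>snd z\<bar>))"
      using bP[of n z] bQ'[of n z] by (intro mult_right_mono) auto
    also have "\<dots> \<le> 1 * ((K / B * (B\<^sup>2 - (snd z)\<^sup>2)) * (Q' n z * (2 * real (Suc n)) * B))"
      using bQ'[of n z] U_snd[OF z, of n] \<open>\<bar>snd z\<bar> \<le> B\<close>
      by (intro mult_mono mult_nonneg_nonneg order_refl order_trans[OF abs_ge_zero U_snd[OF z, of n]]) auto
    also have "\<dots> = 2 * K * (real (Suc n) * (B\<^sup>2 - (snd z)\<^sup>2) * Q' n z)" using B by simp
    finally show ?thesis .
  qed
  have big: "filterlim (\<lambda>n. real (Suc n) * c) at_top sequentially" if "c > 0" for c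
    using that by real_asymp
  have pq: "A\<^sup>2 - (fst z)\<^sup>2 > 0" "B\<^sup>2 - (snd z)\<^sup>2 > 0" if "z \<in> \<Omega>" for z
  proof -
    have "\<bar>fst z\<bar> < A" "\<bar>snd z\<bar> < B" using that by (auto simp: \<Omega>_def)
    then have "\<bar>fst z\<bar>\<^sup>2 < A\<^sup>2" "\<bar>snd z\<bar>\<^sup>2 < B\<^sup>2" by (intro power_strict_mono; simp)+
    then show "A\<^sup>2 - (fst z)\<^sup>2 > 0" "B\<^sup>2 - (snd z)\<^sup>2 > 0" by auto
  qed
  have lP: "(\<lambda>n. P n z) \<longlonglongrightarrow> 1" and lQ: "(\<lambda>n. Q n z) \<longlonglongrightarrow> 1" if "z \<in> \<Omega>" for z
  proof -
    have *: "filterlim (\<lambda>n. real (Suc n) * c - 1) at_top sequentially" if "c > 0" for c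
      using that by real_asymp
    show "(\<lambda>n. P n z) \<longlonglongrightarrow> 1" "(\<lambda>n. Q n z) \<longlonglongrightarrow> 1"
      unfolding P_def Q_def
      by (rule filterlim_compose[OF bump_0_at_top *[OF pq(1)[OF that]]])
        (rule filterlim_compose[OF bump_0_at_top *[OF pq(2)[OF that]]])
  qed
  have lRP: "(\<lambda>n. RP n z) \<longlonglongrightarrow> 0" if z: "z \<in> \<Omega>" for z
  proof (rule Lim_null_comparison)
    show "\<forall>\<^sub>F n in sequentially. norm (RP n z) \<le> 2 * K * (real (Suc n) * (A\<^sup>2 - (fst z)\<^sup>2) * P' n z)"
      using nRP[OF z] by simp
    show "(\<lambda>n. 2 * K * (real (Suc n) * (A\<^sup>2 - (fst z)\<^sup>2) * P' n z)) \<longlonglongrightarrow> 0"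
      unfolding P'_def
      using tendsto_mult[OF tendsto_const filterlim_compose[OF bump_1_weighted_tendsto_0 big[OF pq(1)[OF z]]], of "2 * K"]
      by simp
  qed
  have lRQ: "(\<lambda>n. RQ n z) \<longlonglongrightarrow> 0" if z: "z \<in> \<Omega>" for z
  proof (rule Lim_null_comparison)
    show "\<forall>\<^sub>F n in sequentially. norm (RQ n z) \<le> 2 * K * (real (Suc n) * (B\<^sup>2 - (snd z)\<^sup>2) * Q' n z)"
      using nRQ[OF z] by simp
    show "(\<lambda>n. 2 * K * (real (Suc n) * (B\<^sup>2 - (snd z)\<^sup>2) * Q' n z)) \<longlonglongrightarrow> 0"
      unfolding Q'_def
      using tendsto_mult[OF tendsto_const filterlim_compose[OF bump_1_weighted_tendsto_0 big[OF pq(2)[OF z]]], of "2 * K"]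
      by simp
  qed
  \<comment> \<open>The factor 2 K comes from \<open>nRP\<close> and \<open>nRQ\<close>, the factor
    3 from \<open>bump_1_weighted_le\<close>.\<close>
  have bRP: "norm (RP n z) \<le> 6 * K" and bRQ: "norm (RQ n z) \<le> 6 * K" if z: "z \<in> \<Omega>" for n z
  proof -
    have "real (Suc n) * (A\<^sup>2 - (fst z)\<^sup>2) * P' n z \<le> 3" "real (Suc n) * (B\<^sup>2 - (snd z)\<^sup>2) * Q' n z \<le> 3"
      unfolding P'_def Q'_def by (rule bump_1_weighted_le)+
    from mult_left_mono[OF this(1), of "2 * K"] mult_left_mono[OF this(2), of "2 * K"]
      K0 nRP[OF z, of n] nRQ[OF z, of n]
    show "norm (RP n z) \<le> 6 * K" "norm (RQ n z) \<le> 6 * K" by linarith+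
  qed
  have PQ1: "P n z * Q n z \<le> 1" and PQ0: "P n z * Q n z \<ge> 0" for n z
    using mult_mono[OF bP(2) bQ(2) _ bQ(1), of n z n z] bP(1) bQ(1) by auto
  have lim\<psi>: "(\<lambda>n. \<psi> n z) \<longlonglongrightarrow> u z" if "z \<in> \<Omega>" for z
    using tendsto_mult[OF tendsto_mult[OF lP[OF that] lQ[OF that]] lim[of z]] by (simp add: \<psi>_def)
  have limg\<psi>: "(\<lambda>n. grad (\<psi> n) z) \<longlonglongrightarrow> g z" if "z \<in> \<Omega>" for z
    using tendsto_add[OF tendsto_scaleR[OF tendsto_mult[OF lP[OF that] lQ[OF that]] glim[of z]]
        tendsto_add[OF lRP[OF that] lRQ[OF that]]]
    by (simp add: g\<psi>)
  have b\<psi>: "\<bar>u z - \<psi> n z\<bar> \<le> 2 * (K * A)" if z: "z \<in> \<Omega>" for n z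
  proof -
    have "\<bar>\<psi> n z\<bar> = P n z * Q n z * \<bar>U n z\<bar>" using bP[of n z] bQ[of n z] by (simp add: \<psi>_def abs_mult)
    also have "\<dots> \<le> 1 * (K * A)" using PQ1 PQ0 Ub[OF z] by (intro mult_mono) auto
    finally show ?thesis using ub[OF z] by linarith
  qed
  \<comment> \<open>14 K is made of K for \<open>g\<close>, K for the term with the cutoff
    undifferentiated, and 6 K for each of \<open>RP\<close> and \<open>RQ\<close>.\<close>
  have bg\<psi>: "norm (g z - grad (\<psi> n) z) \<le> 14 * K" if z: "z \<in> \<Omega>" for n z
  proof -
    have "norm ((P n z * Q n z) *\<^sub>R grad (U n) z) = P n z * Q n z * norm (grad (U n) z)"
      using PQ0 by simp
    also have "\<dots> \<le> 1 * K" using PQ1 PQ0 K by (intro mult_mono) auto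
    finally have "norm (grad (\<psi> n) z) \<le> K + (6 * K + 6 * K)"
      unfolding g\<psi> using bRP[OF z, of n] bRQ[OF z, of n] by (intro norm_add_rule_thm add_mono order_trans[OF norm_triangle_ineq]) auto
    then show ?thesis using gb[of z] norm_triangle_ineq4[of "g z" "grad (\<psi> n) z"] by linarith
  qed
  have [measurable]: "\<psi> n \<in> borel_measurable ?M" "grad (\<psi> n) \<in> borel_measurable ?M" for n
    using test_function_L2[OF op bd tp] L2_measurable by blast+
  have H1: "(\<lambda>n. LINT x|?M. (u x - \<psi> n x)\<^sup>2) \<longlonglongrightarrow> (LINT x|?M. (0::real))"
  proof (rule integral_dominated_convergence[where w = "\<lambda>_. (2 * (K * A))\<^sup>2"])
    show "AE x in ?M. (\<lambda>n. (u x - \<psi> n x)\<^sup>2) \<longlonglongrightarrow> 0"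
    proof (intro AE_I2)
      fix x assume "x \<in> space ?M"
      then have "x \<in> \<Omega>" by simp
      from tendsto_power[OF tendsto_diff[OF tendsto_const lim\<psi>[OF this]], of "u x" 2]
      show "(\<lambda>n. (u x - \<psi> n x)\<^sup>2) \<longlonglongrightarrow> 0" by simp
    qed
    show "AE x in ?M. norm ((u x - \<psi> n x)\<^sup>2) \<le> (2 * (K * A))\<^sup>2" for n
      using power_mono[OF b\<psi> abs_ge_zero, of _ n 2] by (intro AE_I2) auto
  qed auto
  have H2: "(\<lambda>n. LINT x|?M. (norm (g x - grad (\<psi> n) x))\<^sup>2) \<longlonglongrightarrow> (LINT x|?M. (0::real))"
  proof (rule integral_dominated_convergence[where w = "\<lambda>_. (14 * K)\<^sup>2"])
    show "AE x in ?M. (\<lambda>n. (norm (g x - grad (\<psi> n) x))\<^sup>2) \<longlonglongrightarrow> 0"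
    proof (intro AE_I2)
      fix x assume "x \<in> space ?M"
      then have "x \<in> \<Omega>" by simp
      from tendsto_power[OF tendsto_norm[OF tendsto_diff[OF tendsto_const limg\<psi>[OF this]]], of "g x" 2]
      show "(\<lambda>n. (norm (g x - grad (\<psi> n) x))\<^sup>2) \<longlonglongrightarrow> 0" by simp
    qed
    show "AE x in ?M. norm ((norm (g x - grad (\<psi> n) x))\<^sup>2) \<le> (14 * K)\<^sup>2" for n
      using power_mono[OF bg\<psi> norm_ge_zero, of _ n 2] by (intro AE_I2) auto
  qed auto
  have weq: "(LINT x|?M. g x \<bullet> grad \<theta> x) = (LINT x|?M. \<theta> x)" if t: "test_function \<Omega> \<theta>" for \<theta>
  proof -
    note tL = test_function_L2[OF op bd t]
    have [measurable]: "grad \<theta> \<in> borel_measurable ?M" using tL L2_measurable by blast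
    have one: "(\<lambda>_. 1::real) \<in> L2 \<Omega>"
      by (intro L2_bounded_continuous[OF op bd, of _ 1]) auto
    have i1: "integrable ?M (\<lambda>x. K * norm (grad \<theta> x))"
      using integrable_norm_mult_L2[OF one tL(2)] by simp
    have "(\<lambda>n. LINT x|?M. grad (U n) x \<bullet> grad \<theta> x) \<longlonglongrightarrow> (LINT x|?M. g x \<bullet> grad \<theta> x)"
    proof (rule integral_dominated_convergence[OF _ _ i1])
      show "AE x in ?M. (\<lambda>n. grad (U n) x \<bullet> grad \<theta> x) \<longlonglongrightarrow> g x \<bullet> grad \<theta> x"
        by (intro AE_I2 tendsto_inner glim tendsto_const)
      show "AE x in ?M. norm (grad (U n) x \<bullet> grad \<theta> x) \<le> K * norm (grad \<theta> x)" for n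
      proof (intro AE_I2)
        fix x
        have "norm (grad (U n) x \<bullet> grad \<theta> x) \<le> norm (grad (U n) x) * norm (grad \<theta> x)"
          by (simp add: Cauchy_Schwarz_ineq2)
        also have "\<dots> \<le> K * norm (grad \<theta> x)" using K by (intro mult_right_mono) auto
        finally show "norm (grad (U n) x \<bullet> grad \<theta> x) \<le> K * norm (grad \<theta> x)" .
      qed
    qed auto
    then show ?thesis using eq[OF t] LIMSEQ_unique by blast
  qed
  \<comment> \<open>\<open>?v\<close> agrees with \<open>u\<close> on \<open>\<Omega>\<close>, which
    is all that the integrals see.\<close>
  let ?v = "\<lambda>z. if z \<in> \<Omega> then u z else 0"
  have cong1: "(LINT x|?M. ?v x *\<^sub>R f x) = (LINT x|?M. u x *\<^sub>R f x)" for f :: "real \<times> real \<Rightarrow> real \<times> real"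
    by (rule Bochner_Integration.integral_cong) auto
  have cong2: "(LINT x|?M. (?v x - f x)\<^sup>2) = (LINT x|?M. (u x - f x)\<^sup>2)" for f :: "real \<times> real \<Rightarrow> real"
    by (rule Bochner_Integration.integral_cong) auto
  have "?v \<in> L2 \<Omega>"
    using uL2 by (intro L2_bounded_continuous[OF op bd, of _ "K * A"])
      (auto simp: ub intro: continuous_on_eq[OF contu])
  then have wgv: "weak_gradient \<Omega> ?v g"
    using wg unfolding weak_gradient_def cong1 by blast
  have "(\<lambda>n. LINT x|?M. (?v x - \<psi> n x)\<^sup>2) \<longlonglongrightarrow> 0"
    using H1 unfolding cong2 by simp
  then have "?v \<in> H1_0 \<Omega>"
    using wgv tp H2 unfolding H1_0_def by (auto intro!: exI[of _ g] exI[of _ \<psi>])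
  moreover have "continuous_on \<Omega> ?v"
    by (rule continuous_on_eq[OF contu]) auto
  ultimately show ?thesis
    unfolding is_torsion_function_def using wgv weq by auto
qed

section \<open>Fejer means of the odd sine series\<close>

text \<open>Cesaro weights for the odd frequencies below 2N, linear in the frequency; they turn the
  Dirichlet kernel of the odd cosines into a Fejer kernel.\<close>

definition fejer :: "nat \<Rightarrow> nat \<Rightarrow> real" where
  "fejer N k = 1 - real (2 * k + 1) / real (2 * N)"

definition fejer_sin :: "nat \<Rightarrow> real \<Rightarrow> real" where
  "fejer_sin N t = (\<Sum>k<N. fejer N k * (sin (real (2 * k + 1) * t) / real (2 * k + 1)))"

definition fejer_cos :: "nat \<Rightarrow> real \<Rightarrow> real" where
  "fejer_cos N t = (\<Sum>k<N. fejer N k * cos (real (2 * k + 1) * t))"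

lemma fejer_bounds: "k < N \<Longrightarrow> 0 \<le> fejer N k" "fejer N k \<le> 1"
  by (auto simp: fejer_def field_simps)

lemma fejer_tendsto_1: "(\<lambda>N. fejer N k) \<longlonglongrightarrow> 1"
  unfolding fejer_def by real_asymp

text \<open>2 cos(mt) sin t = sin((m + 1)t) - sin((m - 1)t), which telescopes over odd m.\<close>

lemma sum_cos_odd: "(\<Sum>k<p. 2 * cos (real (2 * k + 1) * t)) * sin t = sin (real (2 * p) * t)"
proof (induction p)
  case (Suc p)
  have a: "real (2 * p + 1) * t + t = real (2 * Suc p) * t" "real (2 * p + 1) * t - t = real (2 * p) * t"
    by (auto simp: algebra_simps)
  have "2 * cos (real (2 * p + 1) * t) * sin t
      = sin (real (2 * p + 1) * t + t) - sin (real (2 * p + 1) * t - t)"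
    unfolding sin_add sin_diff by simp
  then show ?case using Suc unfolding a by (simp add: algebra_simps del: of_nat_Suc)
qed simp

text \<open>The Fejer kernel of the odd cosines, multiplied through by sin(t)^2 so that it also
  holds at the zeros of sin. Passing from \<open>p\<close> to \<open>Suc p\<close> adds a Dirichlet
  sum and one new cosine; the identity sin(x + y) sin(x - y) = sin(x)^2 - sin(y)^2 recombines the
  increment.\<close>

lemma sum_fejer_cos_closed_form:
  "(\<Sum>k<p. (2 * real p - real (2 * k + 1)) * cos (real (2 * k + 1) * t)) * (sin t)\<^sup>2
    = (sin (real p * t))\<^sup>2 * cos t"
proof (induction p)
  case (Suc p)
  let ?c = "\<lambda>k. cos (real (2 * k + 1) * t)"
  define m where "m = real (2 * p + 1) * t"
  have m: "real (2 * p) * t = m - t" by (simp add: m_def algebra_simps)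
  have "(\<Sum>k<Suc p. (2 * real (Suc p) - real (2 * k + 1)) * ?c k)
      = (\<Sum>k<p. (2 * real p - real (2 * k + 1)) * ?c k + 2 * ?c k) + ?c p"
    by (simp add: algebra_simps)
  also have "\<dots> = (\<Sum>k<p. (2 * real p - real (2 * k + 1)) * ?c k) + (\<Sum>k<p. 2 * ?c k) + ?c p"
    by (simp only: sum.distrib)
  finally have "(\<Sum>k<Suc p. (2 * real (Suc p) - real (2 * k + 1)) * ?c k) * (sin t)\<^sup>2
      = (\<Sum>k<p. (2 * real p - real (2 * k + 1)) * ?c k) * (sin t)\<^sup>2
        + ((\<Sum>k<p. 2 * ?c k) * sin t) * sin t + ?c p * (sin t)\<^sup>2"
    by (simp only: distrib_right power2_eq_square mult.assoc)
  also have "\<dots> = (sin (real p * t))\<^sup>2 * cos t + (sin (m - t) * sin t + cos m * (sin t)\<^sup>2)"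
    by (simp only: Suc.IH sum_cos_odd m add.assoc) (simp only: m_def)
  also have "sin (m - t) * sin t + cos m * (sin t)\<^sup>2 = (sin m * sin t) * cos t"
    by (simp add: sin_diff algebra_simps power2_eq_square)
  also have "sin m * sin t = (sin (real (Suc p) * t))\<^sup>2 - (sin (real p * t))\<^sup>2"
  proof -
    have *: "sin (x + y) * sin (x - y) = (sin x)\<^sup>2 - (sin y)\<^sup>2" for x y :: real
    proof -
      have "sin (x + y) * sin (x - y) = (sin x)\<^sup>2 * (cos y)\<^sup>2 - (cos x)\<^sup>2 * (sin y)\<^sup>2"
        by (simp add: sin_add sin_diff power2_eq_square algebra_simps)
      then show ?thesis by (simp add: cos_squared_eq algebra_simps)
    qed
    have "real (Suc p) * t + real p * t = m" "real (Suc p) * t - real p * t = t"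
      by (auto simp: m_def algebra_simps)
    then show ?thesis using *[of "real (Suc p) * t" "real p * t"] by simp
  qed
  finally show ?case by (simp only: left_diff_distrib)
qed simp

lemma fejer_cos_closed_form:
  assumes "N > 0"
  shows "2 * real N * fejer_cos N t * (sin t)\<^sup>2 = (sin (real N * t))\<^sup>2 * cos t"
proof -
  have "2 * real N * fejer_cos N t
      = (\<Sum>k<N. (2 * real N - real (2 * k + 1)) * cos (real (2 * k + 1) * t))"
    unfolding fejer_cos_def sum_distrib_left using assms
    by (intro sum.cong) (auto simp: fejer_def field_simps)
  then show ?thesis using sum_fejer_cos_closed_form[of N t] by simp
qed

text \<open>The closed form decides the sign except at t = 0, where sin vanishes but every single
  term is nonnegative.\<close>

lemma fejer_cos_nonneg:
  assumes "0 \<le> t" "t \<le> pi / 2"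
  shows "fejer_cos N t \<ge> 0"
proof (cases "t = 0 \<or> N = 0")
  case True
  then show ?thesis by (auto simp: fejer_cos_def intro!: sum_nonneg fejer_bounds)
next
  case False
  then have "sin t > 0" using assms by (intro sin_gt_zero) auto
  moreover have "cos t \<ge> 0" using assms by (intro cos_ge_zero) auto
  ultimately have "0 \<le> fejer_cos N t * (2 * real N * (sin t)\<^sup>2)" "2 * real N * (sin t)\<^sup>2 > 0"
    using fejer_cos_closed_form[of N t] False by (auto simp: algebra_simps)
  then show ?thesis
    using mult_neg_pos[of "fejer_cos N t" "2 * real N * (sin t)\<^sup>2"] by linarith
qed

lemma fejer_sin_has_derivative: "(fejer_sin N has_real_derivative fejer_cos N t) (at t)"
  unfolding fejer_sin_def[abs_def] fejer_cos_def
  by (auto intro!: derivative_eq_intros simp: mult.commute simp del: of_nat_add of_nat_mult of_nat_Suc)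

lemma fejer_sin_mono:
  assumes "0 \<le> s" "s \<le> t" "t \<le> pi / 2"
  shows "fejer_sin N s \<le> fejer_sin N t"
proof (rule DERIV_nonneg_imp_nondecreasing[OF assms(2)])
  fix x assume "s \<le> x" "x \<le> t"
  then have "fejer_cos N x \<ge> 0" using assms by (intro fejer_cos_nonneg) auto
  then show "\<exists>y. (fejer_sin N has_real_derivative y) (at x) \<and> 0 \<le> y"
    using fejer_sin_has_derivative by blast
qed

section \<open>Symmetry, bounds and limit of the sine means\<close>

lemma sin_odd_reflect: "sin (real (2 * k + 1) * (pi - t)) = sin (real (2 * k + 1) * t)"
proof -
  have "sin (real (2 * k + 1) * pi - real (2 * k + 1) * t) = sin (real (2 * k + 1) * t)"
    unfolding sin_diff using cos_npi[of "2 * k + 1"] sin_npi[of "2 * k + 1"] by simp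
  then show ?thesis by (simp only: right_diff_distrib)
qed

lemma fejer_sin_reflect: "fejer_sin N (pi - t) = fejer_sin N t"
  unfolding fejer_sin_def sin_odd_reflect ..

lemma fejer_sin_0: "fejer_sin N 0 = 0" by (simp add: fejer_sin_def)

lemma fejer_sin_bounds:
  assumes "0 \<le> t" "t \<le> pi"
  shows "0 \<le> fejer_sin N t" "fejer_sin N t \<le> fejer_sin N (pi / 2)"
proof -
  have *: "0 \<le> fejer_sin N t \<and> fejer_sin N t \<le> fejer_sin N (pi / 2)" if "0 \<le> t" "t \<le> pi / 2" for t
    using fejer_sin_mono[of 0 t N] fejer_sin_mono[of t "pi / 2" N] that by (auto simp: fejer_sin_0)
  show "0 \<le> fejer_sin N t" "fejer_sin N t \<le> fejer_sin N (pi / 2)"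
    using *[of t] *[of "pi - t"] assms fejer_sin_reflect[of N t] by (cases "t \<le> pi / 2"; force)+
qed

lemma sin_odd_half_pi: "sin (real (2 * k + 1) * (pi / 2)) = (-1) ^ k"
  and cos_odd_half_pi: "cos (real (2 * k + 1) * (pi / 2)) = 0"
proof -
  have "real (2 * k + 1) * (pi / 2) = real k * pi + pi / 2" by (simp add: field_simps)
  then show "sin (real (2 * k + 1) * (pi / 2)) = (-1) ^ k" "cos (real (2 * k + 1) * (pi / 2)) = 0"
    by (simp_all only: sin_add cos_add) (simp_all add: cos_npi)
qed

lemma abs_sum_minus_one_power: "\<bar>\<Sum>k<N. (-1::real) ^ k\<bar> \<le> 1"
proof -
  have "(\<Sum>k<N. (-1::real) ^ k) = (if even N then 0 else 1)" by (induction N) auto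
  then show ?thesis by simp
qed

text \<open>At pi/2 the weighted terms are (-1)^k/(2k + 1) - (-1)^k/(2N): a partial sum of the
  Leibniz series for pi/4 minus a bounded sum divided by 2N.\<close>

lemma fejer_sin_half_pi_tendsto: "(\<lambda>N. fejer_sin N (pi / 2)) \<longlonglongrightarrow> pi / 4"
proof -
  have "summable (\<lambda>k. (-1::real) ^ k * (1 / real (k * 2 + 1) * 1 ^ (k * 2 + 1)))"
    by (rule summable_arctan_series) simp
  then have "(\<lambda>N. \<Sum>k<N. (-1) ^ k * 1 / real (k * 2 + 1)) \<longlonglongrightarrow> pi / 4"
    unfolding pi_series using summable_LIMSEQ by fastforce
  moreover have "(\<lambda>N. (\<Sum>k<N. (-1) ^ k) / (2 * real N)) \<longlonglongrightarrow> 0"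
  proof (rule Lim_null_comparison)
    show "\<forall>\<^sub>F N in sequentially. norm ((\<Sum>k<N. (-1) ^ k) / (2 * real N)) \<le> 1 / (2 * real N)"
      using abs_sum_minus_one_power by (intro always_eventually allI) (simp add: divide_right_mono)
    show "(\<lambda>N. 1 / (2 * real N)) \<longlonglongrightarrow> 0" by real_asymp
  qed
  ultimately have "(\<lambda>N. (\<Sum>k<N. (-1) ^ k * 1 / real (k * 2 + 1)) - (\<Sum>k<N. (-1) ^ k) / (2 * real N)) \<longlonglongrightarrow> pi / 4 - 0"
    by (rule tendsto_diff)
  moreover have "(\<Sum>k<N. (-1) ^ k * 1 / real (k * 2 + 1)) - (\<Sum>k<N. (-1) ^ k) / (2 * real N)
      = fejer_sin N (pi / 2)" for N
    unfolding fejer_sin_def sin_odd_half_pi sum_divide_distrib sum_subtractf[symmetric]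
    by (rule sum.cong) (auto simp: fejer_def field_simps)
  ultimately show ?thesis by simp
qed

text \<open>The limit is known at pi/2 and carried to t by the mean value theorem: between t and
  pi/2 the closed form bounds \<open>fejer_cos N\<close> by 1/(2N sin(t)^2). Points beyond pi/2
  follow by reflection.\<close>

lemma fejer_sin_tendsto:
  assumes "0 < t" "t < pi"
  shows "(\<lambda>N. fejer_sin N t) \<longlonglongrightarrow> pi / 4"
proof -
  have *: "(\<lambda>N. fejer_sin N t) \<longlonglongrightarrow> pi / 4" if t: "0 < t" "t \<le> pi / 2" for t
  proof -
    have st: "sin t > 0" using t by (intro sin_gt_zero) auto
    have bound: "\<bar>fejer_sin N (pi / 2) - fejer_sin N t\<bar> \<le> 1 / (2 * real N * (sin t)\<^sup>2) * (pi / 2)" if N: "N > 0" for N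
    proof -
      have "norm (fejer_sin N (pi / 2) - fejer_sin N t) \<le> 1 / (2 * real N * (sin t)\<^sup>2) * norm (pi / 2 - t)"
      proof (rule field_differentiable_bound[of "{t..pi/2}"])
        fix s assume s: "s \<in> {t..pi/2}"
        show "(fejer_sin N has_field_derivative fejer_cos N s) (at s within {t..pi/2})"
          by (rule has_field_derivative_at_within[OF fejer_sin_has_derivative])
        have "sin t \<le> sin s" using s t by (intro sin_mono_le_eq[THEN iffD2]) auto
        then have ss: "(sin t)\<^sup>2 \<le> (sin s)\<^sup>2" using st by (intro power_mono) auto
        have c: "fejer_cos N s \<ge> 0" using s t by (intro fejer_cos_nonneg) auto
        have "fejer_cos N s * (2 * real N * (sin t)\<^sup>2) \<le> fejer_cos N s * (2 * real N * (sin s)\<^sup>2)"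
          using ss c by (intro mult_left_mono) auto
        also have "\<dots> = (sin (real N * s))\<^sup>2 * cos s"
          using fejer_cos_closed_form[OF N, of s] by (simp add: algebra_simps)
        also have "\<dots> \<le> 1 * 1"
          using cos_ge_zero[of s] s t by (intro mult_mono) (auto simp: abs_square_le_1)
        finally show "norm (fejer_cos N s) \<le> 1 / (2 * real N * (sin t)\<^sup>2)"
          using c N st by (simp add: field_simps)
      qed (use t in auto)
      also have "\<dots> \<le> 1 / (2 * real N * (sin t)\<^sup>2) * (pi / 2)"
        using t by (intro mult_left_mono) auto
      finally show ?thesis by simp
    qed
    have "\<forall>\<^sub>F N in sequentially. norm (fejer_sin N (pi / 2) - fejer_sin N t) \<le> 1 / (2 * real N * (sin t)\<^sup>2) * (pi / 2)"
      using eventually_gt_at_top[of 0] by eventually_elim (simp only: bound real_norm_def)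
    moreover have "(\<lambda>N. 1 / (2 * real N * (sin t)\<^sup>2) * (pi / 2)) \<longlonglongrightarrow> 0"
      using st by real_asymp
    ultimately have "(\<lambda>N. fejer_sin N (pi / 2) - fejer_sin N t) \<longlonglongrightarrow> 0"
      by (rule Lim_null_comparison)
    from tendsto_diff[OF fejer_sin_half_pi_tendsto this] show ?thesis by simp
  qed
  show ?thesis
    using *[of t] *[of "pi - t"] assms by (cases "t \<le> pi / 2") (auto simp: fejer_sin_reflect)
qed

text \<open>For every N the maximum over [0, pi] is attained at pi/2, and the values there
  converge.\<close>

lemma fejer_sin_bounded:
  obtains C where "C > 0" "\<And>N t. 0 \<le> t \<Longrightarrow> t \<le> pi \<Longrightarrow> \<bar>fejer_sin N t\<bar> \<le> C"
proof -
  have "Bseq (\<lambda>N. fejer_sin N (pi / 2))"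
    using fejer_sin_half_pi_tendsto convergentI convergent_imp_Bseq by blast
  then obtain C where C: "C > 0" "\<And>N. norm (fejer_sin N (pi / 2)) \<le> C"
    unfolding Bseq_def by blast
  show ?thesis
  proof (rule that[OF C(1)])
    fix N t assume "0 \<le> t" "t \<le> pi"
    from fejer_sin_bounds[OF this, of N] C(2)[of N] show "\<bar>fejer_sin N t\<bar> \<le> C" by auto
  qed
qed

section \<open>Sums over the odd integers: inverse squares and fourth powers\<close>

lemma inverse_odd_squares_sums: "(\<lambda>k. 1 / (real (2 * k + 1))\<^sup>2) sums (pi\<^sup>2 / 8)"
proof -
  let ?f = "\<lambda>n. 1 / (real (n + 1))\<^sup>2"
  have s: "?f sums (pi\<^sup>2 / 6)" using inverse_squares_sums by simp
  \<comment> \<open>Neighbouring terms of the Basel series are paired; those with an even base add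
    up to a quarter of it.\<close>
  have "(\<lambda>n. sum ?f {n * 2..<n * 2 + 2}) sums (pi\<^sup>2 / 6)"
    using sums_group[OF s, of 2] by simp
  moreover have "sum ?f {n * 2..<n * 2 + 2} = 1 / (real (2 * n + 1))\<^sup>2 + ?f n / 4" for n
  proof -
    have "{n * 2..<n * 2 + 2} = {2 * n, 2 * n + 1}" by auto
    moreover have "(real (2 * n + 1 + 1))\<^sup>2 = 4 * (real (n + 1))\<^sup>2"
      by (simp add: power2_eq_square algebra_simps)
    ultimately show ?thesis by simp
  qed
  ultimately have "(\<lambda>n. 1 / (real (2 * n + 1))\<^sup>2 + ?f n / 4) sums (pi\<^sup>2 / 6)" by simp
  from sums_diff[OF this sums_divide[OF s, of 4]] show ?thesis by simp
qed

lemma sum_inverse_odd_squares_le: "(\<Sum>k<N. 1 / (real (2 * k + 1))\<^sup>2) \<le> pi\<^sup>2 / 8"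
  using sum_le_suminf[OF sums_summable[OF inverse_odd_squares_sums], of "{..<N}"]
    sums_unique[OF inverse_odd_squares_sums] by simp

text \<open>Up to normalisation the sine coefficients of the parabola t(pi - t). Against the 1/m of
  \<open>fejer_sin\<close> they produce 1/m^4.\<close>

lemma integral_sin_odd_parabola:
  "((\<lambda>t. sin (real (2 * k + 1) * t) * (t * (pi - t))) has_integral 4 / real (2 * k + 1) ^ 3) {0..pi}"
proof -
  define m where "m = real (2 * k + 1)"
  have m: "m > 0" by (simp add: m_def)
  \<comment> \<open>Antiderivative found by integrating by parts twice; at both ends only its last
    term survives.\<close>
  define G where "G t = - (t * (pi - t)) * cos (m * t) / m + (pi - 2 * t) * sin (m * t) / m\<^sup>2
      - 2 * cos (m * t) / m ^ 3" for t
  have "((\<lambda>t. sin (m * t) * (t * (pi - t))) has_integral (G pi - G 0)) {0..pi}"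
  proof (rule fundamental_theorem_of_calculus)
    fix t
    have "(G has_real_derivative sin (m * t) * (t * (pi - t))) (at t)"
      unfolding G_def[abs_def] using m
      by (auto intro!: derivative_eq_intros simp: field_simps power2_eq_square power3_eq_cube)
    then show "(G has_vector_derivative sin (m * t) * (t * (pi - t))) (at t within {0..pi})"
      using has_field_derivative_at_within has_real_derivative_iff_has_vector_derivative by blast
  qed simp
  moreover have "cos (m * pi) = -1" "sin (m * pi) = 0"
    unfolding m_def using cos_npi[of "2 * k + 1"] sin_npi[of "2 * k + 1"] by simp_all
  then have "G pi - G 0 = 4 / m ^ 3" by (simp add: G_def)
  ultimately show ?thesis by (simp add: m_def)
qed

lemma integral_parabola: "((\<lambda>t. pi / 4 * (t * (pi - t))) has_integral pi ^ 4 / 24) {0..pi}"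
proof -
  define G where "G t = pi / 4 * (pi * t\<^sup>2 / 2 - t ^ 3 / 3)" for t
  have "((\<lambda>t. pi / 4 * (t * (pi - t))) has_integral (G pi - G 0)) {0..pi}"
  proof (rule fundamental_theorem_of_calculus)
    fix t
    have "(G has_real_derivative pi / 4 * (t * (pi - t))) (at t)"
      unfolding G_def[abs_def]
      by (auto intro!: derivative_eq_intros simp: field_simps power2_eq_square)
    then show "(G has_vector_derivative pi / 4 * (t * (pi - t))) (at t within {0..pi})"
      using has_field_derivative_at_within has_real_derivative_iff_has_vector_derivative by blast
  qed simp
  moreover have "G pi - G 0 = pi ^ 4 / 24"
    by (simp add: G_def power2_eq_square power3_eq_cube power4_eq_xxxx field_simps)
  ultimately show ?thesis by simp
qed

text \<open>Four times the sum is the integral of \<open>fejer_sin N\<close> against t(pi - t).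
  Since \<open>fejer_sin N\<close> tends boundedly to pi/4 inside the interval, the integrals tend
  to pi/4 times pi^3/6.\<close>

lemma fejer_inverse_fourth_powers_tendsto:
  "(\<lambda>N. \<Sum>k<N. fejer N k / real (2 * k + 1) ^ 4) \<longlonglongrightarrow> pi ^ 4 / 96"
proof -
  obtain C where C: "C > 0" "\<And>N t. 0 \<le> t \<Longrightarrow> t \<le> pi \<Longrightarrow> \<bar>fejer_sin N t\<bar> \<le> C"
    using fejer_sin_bounded by blast
  define f where "f N t = fejer_sin N t * (t * (pi - t))" for N t
  have I: "(f N has_integral (\<Sum>k<N. 4 * (fejer N k / real (2 * k + 1) ^ 4))) {0..pi}" for N
  proof -
    have "((\<lambda>t. \<Sum>k<N. fejer N k / real (2 * k + 1) * (sin (real (2 * k + 1) * t) * (t * (pi - t))))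
       has_integral (\<Sum>k<N. fejer N k / real (2 * k + 1) * (4 / real (2 * k + 1) ^ 3))) {0..pi}"
      by (intro has_integral_sum has_integral_mult_right integral_sin_odd_parabola) auto
    moreover have "f N = (\<lambda>t. \<Sum>k<N. fejer N k / real (2 * k + 1) * (sin (real (2 * k + 1) * t) * (t * (pi - t))))"
      by (simp add: f_def[abs_def] fejer_sin_def sum_distrib_right mult.assoc)
    ultimately show ?thesis
      by (simp add: power3_eq_cube power4_eq_xxxx mult.assoc mult.commute[of _ 4])
  qed
  have lim: "(\<lambda>N. integral {0..pi} (f N)) \<longlonglongrightarrow> integral {0..pi} (\<lambda>t. pi / 4 * (t * (pi - t)))"
  proof (rule dominated_convergence(2)[where h = "\<lambda>_. C * (pi * pi)"])
    show "f N integrable_on {0..pi}" for N using I by blast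
    show "norm (f N t) \<le> C * (pi * pi)" if "t \<in> {0..pi}" for N t
    proof -
      have "\<bar>t * (pi - t)\<bar> \<le> pi * pi"
        using that by (simp add: abs_mult mult_mono)
      then show ?thesis unfolding f_def real_norm_def abs_mult[of "fejer_sin N t"]
        using that C by (intro mult_mono) auto
    qed
    show "(\<lambda>N. f N t) \<longlonglongrightarrow> pi / 4 * (t * (pi - t))" if "t \<in> {0..pi}" for t
    \<comment> \<open>At the ends \<open>fejer_sin N\<close> is 0 and does not approach pi/4, but
      the parabola vanishes there.\<close>
    proof (cases "t = 0 \<or> t = pi")
      case False
      then show ?thesis unfolding f_def
        using that by (intro tendsto_mult_right fejer_sin_tendsto) auto
    qed (auto simp: f_def)
  qed auto
  have int: "integral {0..pi} (f N) = 4 * (\<Sum>k<N. fejer N k / real (2 * k + 1) ^ 4)" for N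
    using integral_unique[OF I] by (simp add: sum_distrib_left)
  have "(\<lambda>N. 4 * (\<Sum>k<N. fejer N k / real (2 * k + 1) ^ 4)) \<longlonglongrightarrow> pi ^ 4 / 24"
    using lim unfolding int integral_unique[OF integral_parabola] .
  from tendsto_divide[OF this tendsto_const[of 4]] show ?thesis by simp
qed

text \<open>The right-hand side of the bound is what the AM-GM estimate of the off-diagonal terms leaves of
  the double sum at the centre.\<close>

lemma fejer_diagonal_lower_bound:
  obtains L where "L \<longlonglongrightarrow> pi ^ 4 / 192"
    "\<And>N. N > 0 \<Longrightarrow> L N \<le> 2 * (\<Sum>k<N. (fejer N k)\<^sup>2 / real (2 * k + 1) ^ 4)
        - (\<Sum>k<N. fejer N k / (real (2 * k + 1))\<^sup>2)\<^sup>2"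
proof
  let ?S = "\<lambda>N. \<Sum>k<N. fejer N k / real (2 * k + 1) ^ 4"
  \<comment> \<open>The diagonal carries squared weights, whereas the known limit concerns their
    first powers; the correction (pi^2/8)/(2N) bounds what is lost in between.\<close>
  define L where "L N = 2 * (?S N - (pi\<^sup>2 / 8) / (2 * real N)) - (pi\<^sup>2 / 8)\<^sup>2" for N
  have "L \<longlonglongrightarrow> 2 * (pi ^ 4 / 96 - 0) - (pi\<^sup>2 / 8)\<^sup>2"
    unfolding L_def[abs_def]
  proof (intro tendsto_intros fejer_inverse_fourth_powers_tendsto)
    show "(\<lambda>N. (pi\<^sup>2 / 8) / (2 * real N)) \<longlonglongrightarrow> 0" by real_asymp
  qed
  then show "L \<longlonglongrightarrow> pi ^ 4 / 192" by (simp add: power_divide flip: power_mult)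
  fix N :: nat assume N: "N > 0"
  have "?S N - (pi\<^sup>2 / 8) / (2 * real N)
      \<le> ?S N - (\<Sum>k<N. 1 / (real (2 * k + 1))\<^sup>2) / (2 * real N)"
    using sum_inverse_odd_squares_le[of N] by (intro diff_mono divide_right_mono) auto
  also have "\<dots> = (\<Sum>k<N. fejer N k / real (2 * k + 1) ^ 4 - 1 / (real (2 * k + 1))\<^sup>2 / (2 * real N))"
    by (simp add: sum_subtractf sum_divide_distrib)
  also have "\<dots> \<le> (\<Sum>k<N. (fejer N k)\<^sup>2 / real (2 * k + 1) ^ 4)"
  proof (rule sum_mono)
    fix k assume "k \<in> {..<N}"
    define m where "m = real (2 * k + 1)"
    have m: "m \<ge> 1" by (simp add: m_def)
    have f: "fejer N k = 1 - m / (2 * real N)" by (simp add: fejer_def m_def)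
    \<comment> \<open>The deficit \<open>1 - fejer N k\<close> is m/(2N), so the loss per term is at
      most m^(-3)/(2N).\<close>
    have "fejer N k / m ^ 4 - (fejer N k)\<^sup>2 / m ^ 4 = fejer N k * (1 - fejer N k) / m ^ 4"
      by (simp add: power2_eq_square diff_divide_distrib right_diff_distrib)
    also have "\<dots> \<le> (1 - fejer N k) / m ^ 4"
      using fejer_bounds(2)[of N k] mult_right_mono[of "fejer N k" 1 "1 - fejer N k"] m
      by (intro divide_right_mono) auto
    also have "\<dots> = 1 / m ^ 3 / (2 * real N)"
      using m by (simp add: f power3_eq_cube power4_eq_xxxx)
    also have "\<dots> \<le> 1 / m\<^sup>2 / (2 * real N)"
      using m by (intro divide_right_mono divide_left_mono power_increasing) auto
    finally show "fejer N k / real (2 * k + 1) ^ 4 - 1 / (real (2 * k + 1))\<^sup>2 / (2 * real N)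
       \<le> (fejer N k)\<^sup>2 / real (2 * k + 1) ^ 4" by (simp add: m_def)
  qed
  finally have 1: "?S N - (pi\<^sup>2 / 8) / (2 * real N) \<le> (\<Sum>k<N. (fejer N k)\<^sup>2 / real (2 * k + 1) ^ 4)" .
  have "(\<Sum>k<N. fejer N k / (real (2 * k + 1))\<^sup>2) \<le> (\<Sum>k<N. 1 / (real (2 * k + 1))\<^sup>2)"
    by (intro sum_mono divide_right_mono fejer_bounds) auto
  also have "\<dots> \<le> pi\<^sup>2 / 8" by (rule sum_inverse_odd_squares_le)
  finally have 2: "(\<Sum>k<N. fejer N k / (real (2 * k + 1))\<^sup>2)\<^sup>2 \<le> (pi\<^sup>2 / 8)\<^sup>2"
    by (intro power_mono sum_nonneg divide_nonneg_nonneg fejer_bounds) auto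
  show "L N \<le> 2 * (\<Sum>k<N. (fejer N k)\<^sup>2 / real (2 * k + 1) ^ 4)
        - (\<Sum>k<N. fejer N k / (real (2 * k + 1))\<^sup>2)\<^sup>2"
    unfolding L_def by (intro diff_mono mult_left_mono 1 2) simp
qed

section \<open>A minimum principle and double sine sums\<close>

text \<open>At the minimum \<open>f'\<close> vanishes; if \<open>D\<close> were negative,
  \<open>f'\<close> would be negative just to the right of \<open>x\<close> and \<open>f\<close>
  would drop below its minimum.\<close>

lemma second_derivative_nonneg_at_local_min:
  fixes f f' :: "real \<Rightarrow> real"
  assumes f: "\<And>t. (f has_real_derivative f' t) (at t)" and f': "(f' has_real_derivative D) (at x)"
    and e: "e > 0" and min: "\<And>t. \<bar>t - x\<bar> < e \<Longrightarrow> f x \<le> f t"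
  shows "D \<ge> 0"
proof (rule ccontr)
  assume "\<not> D \<ge> 0"
  then have "D < 0" by simp
  have "f' x = 0"
    using DERIV_local_min[OF f e] min by (auto simp: abs_minus_commute)
  obtain d where d: "d > 0" "\<And>h. h > 0 \<Longrightarrow> h < d \<Longrightarrow> f' (x + h) < f' x"
    using DERIV_neg_dec_right[OF f' \<open>D < 0\<close>] by blast
  define h where "h = min d e / 2"
  have h: "0 < h" "h < d" "h < e" using d(1) e by (auto simp: h_def)
  have "f (x + h) < f x"
  proof (rule DERIV_neg_imp_decreasing_open[where f = f and a = x and b = "x + h"])
    fix t assume t: "x < t" "t < x + h"
    then have "f' (x + (t - x)) < f' x" using h by (intro d(2)) auto
    then show "\<exists>y. (f has_real_derivative y) (at t) \<and> y < 0"
      using f \<open>f' x = 0\<close> by auto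
  qed (use h f in \<open>auto intro!: continuous_at_imp_continuous_on DERIV_isCont\<close>)
  moreover have "f x \<le> f (x + h)" using h by (intro min) auto
  ultimately show False by simp
qed

text \<open>Subtracting \<open>\<delta> * s\<^sup>2\<close> makes the inequality strict: at an
  interior minimum of \<open>g\<close>, \<open>fxx\<close> is at least 2 delta and
  \<open>fyy\<close> is nonnegative, against \<open>super\<close>.\<close>

lemma minimum_principle_rectangle:
  fixes f :: "real \<Rightarrow> real \<Rightarrow> real"
  assumes cont: "continuous_on UNIV (\<lambda>z. f (fst z) (snd z))"
    and fx: "\<And>s t. ((\<lambda>s. f s t) has_real_derivative fx s t) (at s)"
    and fxx: "\<And>s t. ((\<lambda>s. fx s t) has_real_derivative fxx s t) (at s)"
    and fy: "\<And>s t. ((\<lambda>t. f s t) has_real_derivative fy s t) (at t)"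
    and fyy: "\<And>s t. ((\<lambda>t. fy s t) has_real_derivative fyy s t) (at t)"
    and pos: "\<alpha> > 0" "\<beta> > 0"
    and super: "\<And>s t. a < s \<Longrightarrow> s < b \<Longrightarrow> c < t \<Longrightarrow> t < d \<Longrightarrow> \<alpha> * fxx s t + \<beta> * fyy s t \<le> 0"
    and side1: "\<And>t. c \<le> t \<Longrightarrow> t \<le> d \<Longrightarrow> f a t \<ge> 0 \<and> f b t \<ge> 0"
    and side2: "\<And>s. a \<le> s \<Longrightarrow> s \<le> b \<Longrightarrow> f s c \<ge> 0 \<and> f s d \<ge> 0"
    and z: "a \<le> s0" "s0 \<le> b" "c \<le> t0" "t0 \<le> d"
  shows "f s0 t0 \<ge> 0"
proof (rule ccontr)
  assume "\<not> f s0 t0 \<ge> 0"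
  then have neg: "f s0 t0 < 0" by simp
  define m where "m = max (a\<^sup>2) (b\<^sup>2)"
  have m: "s\<^sup>2 \<le> m" if "a \<le> s" "s \<le> b" for s
  proof (cases "s \<ge> 0")
    case True
    then show ?thesis using that power_mono[of s b 2] by (auto simp: m_def le_max_iff_disj)
  next
    case False
    then show ?thesis using that power_mono[of "- s" "- a" 2] by (auto simp: m_def le_max_iff_disj)
  qed
  have m0: "m \<ge> 0" by (simp add: m_def le_max_iff_disj)
  \<comment> \<open>Small enough that the perturbation, at most delta m, cannot outweigh the
    negative value \<open>f s0 t0\<close>. Hence \<open>f\<close> is negative at the minimiser of
    \<open>g\<close>, which therefore lies in the interior.\<close>
  define \<delta> where "\<delta> = - f s0 t0 / (2 * (1 + m))"
  have \<delta>: "\<delta> > 0" "\<delta> * m < - f s0 t0"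
  proof -
    show "\<delta> > 0" unfolding \<delta>_def using neg m0 by (intro divide_pos_pos) auto
    then have "\<delta> * m < \<delta> * (2 * (1 + m))" using m0 by (intro mult_strict_left_mono) auto
    also have "\<dots> = - f s0 t0" using m0 by (simp add: \<delta>_def)
    finally show "\<delta> * m < - f s0 t0" .
  qed
  define g where "g s t = f s t - \<delta> * s\<^sup>2" for s t
  let ?R = "{a..b} \<times> {c..d}"
  have "continuous_on ?R (\<lambda>z. g (fst z) (snd z))"
    unfolding g_def by (intro continuous_intros continuous_on_subset[OF cont]) auto
  moreover have "compact ?R" "?R \<noteq> {}" using z by (auto intro: compact_Times)
  ultimately obtain w where w: "w \<in> ?R" "\<And>v. v \<in> ?R \<Longrightarrow> g (fst w) (snd w) \<le> g (fst v) (snd v)"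
    using continuous_attains_inf[of ?R "\<lambda>z. g (fst z) (snd z)"] by blast
  obtain s t where st: "w = (s, t)" by (cases w)
  have r: "a \<le> s" "s \<le> b" "c \<le> t" "t \<le> d" using w(1) st by auto
  have gmin: "g s t \<le> g s' t'" if "a \<le> s'" "s' \<le> b" "c \<le> t'" "t' \<le> d" for s' t'
    using w(2)[of "(s', t')"] that st by simp
  have "g s0 t0 \<le> f s0 t0" using \<delta>(1) by (simp add: g_def)
  then have gneg: "g s t \<le> f s0 t0" using gmin[OF z] by simp
  have interior: "f s t < 0"
  proof -
    have "\<delta> * s\<^sup>2 \<le> \<delta> * m" using \<delta>(1) m[OF r(1,2)] by (intro mult_left_mono) auto
    then show ?thesis using gneg \<delta>(2) by (simp add: g_def)
  qed
  then have i: "a < s" "s < b" "c < t" "t < d"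
    using side1[OF r(3,4)] side2[OF r(1,2)] r by (auto simp: less_le)
  have "fxx s t - 2 * \<delta> \<ge> 0"
  proof (rule second_derivative_nonneg_at_local_min[where f = "\<lambda>s. g s t" and x = s
        and f' = "\<lambda>s. fx s t - 2 * \<delta> * s" and e = "min (s - a) (b - s)"])
    show "((\<lambda>s. g s t) has_real_derivative fx x t - 2 * \<delta> * x) (at x)" for x
      unfolding g_def by (auto intro!: derivative_eq_intros fx)
    show "((\<lambda>s. fx s t - 2 * \<delta> * s) has_real_derivative fxx s t - 2 * \<delta>) (at s)"
      by (auto intro!: derivative_eq_intros fxx)
    show "g s t \<le> g x t" if "\<bar>x - s\<bar> < min (s - a) (b - s)" for x
      using that r by (intro gmin) auto
  qed (use i in auto)
  moreover have "fyy s t \<ge> 0"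
  proof (rule second_derivative_nonneg_at_local_min[where f = "\<lambda>t. g s t" and x = t
        and f' = "\<lambda>t. fy s t" and e = "min (t - c) (d - t)"])
    show "((\<lambda>t. g s t) has_real_derivative fy s x) (at x)" for x
      unfolding g_def by (auto intro!: derivative_eq_intros fy)
    show "((\<lambda>t. fy s t) has_real_derivative fyy s t) (at t)" by (rule fyy)
    show "g s t \<le> g s x" if "\<bar>x - t\<bar> < min (t - c) (d - t)" for x
      using that r by (intro gmin) auto
  qed (use i in auto)
  ultimately have "\<alpha> * (2 * \<delta>) \<le> \<alpha> * fxx s t" "0 \<le> \<beta> * fyy s t"
    using pos by (auto intro: mult_left_mono)
  moreover have "\<alpha> * (2 * \<delta>) > 0" using pos \<delta> by simp
  ultimately show False using super[OF i] by linarith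
qed

section \<open>Double sine sums with Fejer weights\<close>

definition coef :: "real \<Rightarrow> real \<Rightarrow> nat \<Rightarrow> nat \<Rightarrow> real" where
  "coef \<alpha> \<beta> j k = 1 / (real (2 * j + 1) * real (2 * k + 1)
     * ((real (2 * j + 1))\<^sup>2 * \<alpha> + (real (2 * k + 1))\<^sup>2 * \<beta>))"

text \<open>The factors \<open>p\<close> and \<open>q\<close> are left open so that every partial
  derivative is again a \<open>double_sum\<close> with the same coefficients.\<close>

definition double_sum ::
    "real \<Rightarrow> real \<Rightarrow> nat \<Rightarrow> (nat \<Rightarrow> real \<Rightarrow> real) \<Rightarrow> (nat \<Rightarrow> real \<Rightarrow> real) \<Rightarrow> real \<Rightarrow> real \<Rightarrow> real" where
  "double_sum \<alpha> \<beta> N p q s t =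
     (\<Sum>j<N. \<Sum>k<N. fejer N j * fejer N k * coef \<alpha> \<beta> j k * (p j s * q k t))"

lemma double_sum_swap: "double_sum \<alpha> \<beta> N p q s t = double_sum \<beta> \<alpha> N q p t s"
  unfolding double_sum_def
  by (subst sum.swap) (simp add: coef_def algebra_simps)

lemma double_sum_deriv1:
  assumes "\<And>j t. (p j has_real_derivative p' j t) (at t)"
  shows "((\<lambda>s. double_sum \<alpha> \<beta> N p q s t) has_real_derivative double_sum \<alpha> \<beta> N p' q s t) (at s)"
  unfolding double_sum_def
  by (intro DERIV_sum DERIV_cmult DERIV_cmult_right assms)

lemma double_sum_deriv2:
  assumes "\<And>j t. (q j has_real_derivative q' j t) (at t)"
  shows "((\<lambda>t. double_sum \<alpha> \<beta> N p q s t) has_real_derivative double_sum \<alpha> \<beta> N p q' s t) (at t)"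
  unfolding double_sum_def
  by (intro DERIV_sum DERIV_cmult assms)

lemma double_sum_continuous:
  assumes "\<And>j. continuous_on UNIV (p j)" "\<And>j. continuous_on UNIV (q j)"
  shows "continuous_on UNIV (\<lambda>z. double_sum \<alpha> \<beta> N p q (fst z) (snd z))"
proof -
  have "continuous_on UNIV (\<lambda>z. p j (fst z))" "continuous_on UNIV (\<lambda>z. q j (snd z))"
    for j and z :: "real \<times> real"
    by (auto intro!: continuous_on_compose2[OF assms(1)] continuous_on_compose2[OF assms(2)]
        continuous_intros)
  then show ?thesis unfolding double_sum_def by (intro continuous_intros) auto
qed

text \<open>The \<open>i\<close>-th derivative of sin((2j + 1)t); the phase shift avoids a case
  distinction on \<open>i\<close> modulo 4.\<close>

definition sinN :: "nat \<Rightarrow> nat \<Rightarrow> real \<Rightarrow> real" where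
  "sinN i j t = real (2 * j + 1) ^ i * sin (real (2 * j + 1) * t + real i * (pi / 2))"

lemma sinN_deriv: "(sinN i j has_real_derivative sinN (Suc i) j t) (at t)"
proof -
  have "real (2 * j + 1) * t + real (Suc i) * (pi / 2) = real (2 * j + 1) * t + real i * (pi / 2) + pi / 2"
    by (simp add: algebra_simps add_divide_distrib)
  then have "sin (real (2 * j + 1) * t + real (Suc i) * (pi / 2)) = cos (real (2 * j + 1) * t + real i * (pi / 2))"
    by (simp only: sin_add[of _ "pi / 2"]) simp
  then show ?thesis
    unfolding sinN_def[abs_def] 
    by (auto intro!: derivative_eq_intros simp del: of_nat_add of_nat_mult of_nat_Suc)
qed

lemma sinN_0: "sinN 0 j t = sin (real (2 * j + 1) * t)"
  by (simp add: sinN_def)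

lemma sinN_1: "sinN (Suc 0) j t = real (2 * j + 1) * cos (real (2 * j + 1) * t)"
  by (simp add: sinN_def sin_add)

lemma sinN_Suc_Suc: "sinN (Suc (Suc i)) j t = - (real (2 * j + 1))\<^sup>2 * sinN i j t"
proof -
  have "real (2 * j + 1) * t + real (Suc (Suc i)) * (pi / 2) = real (2 * j + 1) * t + real i * (pi / 2) + pi"
    by (simp add: algebra_simps)
  then have "sin (real (2 * j + 1) * t + real (Suc (Suc i)) * (pi / 2)) = - sin (real (2 * j + 1) * t + real i * (pi / 2))"
    by (simp only: sin_periodic_pi)
  then show ?thesis by (simp add: sinN_def power2_eq_square del: of_nat_add of_nat_mult of_nat_Suc)
qed

lemmas double_sum_sinN_deriv1 = double_sum_deriv1[where p = "sinN i" and p' = "sinN (Suc i)" for i, OF sinN_deriv]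
lemmas double_sum_sinN_deriv2 = double_sum_deriv2[where q = "sinN i" and q' = "sinN (Suc i)" for i, OF sinN_deriv]

lemma sinN_continuous: "continuous_on UNIV (sinN i j)"
  by (intro continuous_at_imp_continuous_on ballI DERIV_isCont[OF sinN_deriv])

lemma sinN_reflect: "sinN 0 j (pi - t) = sinN 0 j t"
  by (simp only: sinN_0 sin_odd_reflect)

lemma sinN_bound: "\<bar>sinN i j t\<bar> \<le> real (2 * j + 1) ^ i"
  unfolding sinN_def abs_mult using abs_sin_le_one mult_left_le by (auto simp: mult_left_le)

abbreviation torsion_sum :: "real \<Rightarrow> real \<Rightarrow> nat \<Rightarrow> real \<Rightarrow> real \<Rightarrow> real" where
  "torsion_sum \<alpha> \<beta> N \<equiv> double_sum \<alpha> \<beta> N (sinN 0) (sinN 0)"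

lemma coef_mult:
  assumes "\<alpha> > 0" "\<beta> > 0"
  shows "coef \<alpha> \<beta> j k * (\<alpha> * (real (2 * j + 1))\<^sup>2 + \<beta> * (real (2 * k + 1))\<^sup>2)
     = 1 / real (2 * j + 1) * (1 / real (2 * k + 1))"
proof -
  define m n where "m = real (2 * j + 1)" and "n = real (2 * k + 1)"
  have "m > 0" "n > 0" by (auto simp: m_def n_def)
  then have "m\<^sup>2 * \<alpha> + n\<^sup>2 * \<beta> > 0" using assms by (simp add: add_pos_pos)
  then show ?thesis
    unfolding coef_def m_def[symmetric] n_def[symmetric] by (simp add: mult.commute)
qed

text \<open>Two derivatives multiply a term by minus its squared frequency, so the operator cancels
  the last factor in the denominator of \<open>coef\<close>. What remains is 1/(mn), and the double
  sum splits into a product. General orders \<open>i\<close> and \<open>l\<close> cover the first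
  derivatives of the sum as well.\<close>

lemma torsion_sum_laplacian:
  assumes "\<alpha> > 0" "\<beta> > 0"
  shows "\<alpha> * double_sum \<alpha> \<beta> N (sinN (Suc (Suc i))) (sinN l) s t
      + \<beta> * double_sum \<alpha> \<beta> N (sinN i) (sinN (Suc (Suc l))) s t
    = - (\<Sum>j<N. fejer N j * (sinN i j s / real (2 * j + 1)))
        * (\<Sum>k<N. fejer N k * (sinN l k t / real (2 * k + 1)))"
proof -
  have "\<alpha> * double_sum \<alpha> \<beta> N (sinN (Suc (Suc i))) (sinN l) s t
      + \<beta> * double_sum \<alpha> \<beta> N (sinN i) (sinN (Suc (Suc l))) s t
    = (\<Sum>j<N. \<Sum>k<N. - (fejer N j * fejer N k * (sinN i j s * sinN l k t)
        * (coef \<alpha> \<beta> j k * (\<alpha> * (real (2 * j + 1))\<^sup>2 + \<beta> * (real (2 * k + 1))\<^sup>2))))"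
    unfolding double_sum_def sum_distrib_left sum.distrib[symmetric] sinN_Suc_Suc
    by (intro sum.cong refl) (simp only: algebra_simps minus_mult_left[symmetric] minus_mult_right[symmetric] minus_add_distrib)
  also have "\<dots> = - (\<Sum>j<N. \<Sum>k<N. (fejer N j * (sinN i j s / real (2 * j + 1)))
        * (fejer N k * (sinN l k t / real (2 * k + 1))))"
    unfolding coef_mult[OF assms] by (simp add: sum_negf field_simps del: of_nat_add of_nat_mult of_nat_Suc)
  also have "\<dots> = - (\<Sum>j<N. fejer N j * (sinN i j s / real (2 * j + 1)))
        * (\<Sum>k<N. fejer N k * (sinN l k t / real (2 * k + 1)))"
    by (simp only: sum_product[symmetric] minus_mult_left)
  finally show ?thesis .
qed

lemma fejer_sin_eq: "(\<Sum>j<N. fejer N j * (sinN 0 j s / real (2 * j + 1))) = fejer_sin N s"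
  unfolding fejer_sin_def sinN_0 ..

lemma fejer_cos_eq: "(\<Sum>j<N. fejer N j * (sinN (Suc 0) j s / real (2 * j + 1))) = fejer_cos N s"
proof -
  have "sinN (Suc 0) j s / real (2 * j + 1) = cos (real (2 * j + 1) * s)" for j
    by (simp add: sinN_1 del: of_nat_add of_nat_mult of_nat_Suc)
  then show ?thesis unfolding fejer_cos_def by simp
qed

lemma double_sum_zero1: "(\<And>j. p j s = 0) \<Longrightarrow> double_sum \<alpha> \<beta> N p q s t = 0"
  by (simp add: double_sum_def)

lemma double_sum_zero2: "(\<And>j. q j t = 0) \<Longrightarrow> double_sum \<alpha> \<beta> N p q s t = 0"
  by (simp add: double_sum_def)

lemma sinN_0_at_0: "sinN 0 j 0 = 0" by (simp add: sinN_0)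

lemma sinN_0_at_pi: "sinN 0 j pi = 0"
  using sinN_reflect[of j 0] by (simp add: sinN_0_at_0)

lemma torsion_sum_nonneg:
  assumes pos: "\<alpha> > 0" "\<beta> > 0" and "0 \<le> s" "s \<le> pi" "0 \<le> t" "t \<le> pi"
  shows "torsion_sum \<alpha> \<beta> N s t \<ge> 0"
proof (rule minimum_principle_rectangle[where f = "torsion_sum \<alpha> \<beta> N" and \<alpha> = \<alpha> and \<beta> = \<beta>
      and a = 0 and b = pi and c = 0 and d = pi])
  note d = double_sum_sinN_deriv1 double_sum_sinN_deriv2
  show "((\<lambda>s. torsion_sum \<alpha> \<beta> N s t) has_real_derivative double_sum \<alpha> \<beta> N (sinN (Suc 0)) (sinN 0) s t) (at s)"
    and "((\<lambda>s. double_sum \<alpha> \<beta> N (sinN (Suc 0)) (sinN 0) s t) has_real_derivative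
        double_sum \<alpha> \<beta> N (sinN (Suc (Suc 0))) (sinN 0) s t) (at s)"
    and "((\<lambda>t. torsion_sum \<alpha> \<beta> N s t) has_real_derivative double_sum \<alpha> \<beta> N (sinN 0) (sinN (Suc 0)) s t) (at t)"
    and "((\<lambda>t. double_sum \<alpha> \<beta> N (sinN 0) (sinN (Suc 0)) s t) has_real_derivative
        double_sum \<alpha> \<beta> N (sinN 0) (sinN (Suc (Suc 0))) s t) (at t)" for s t
    by (rule d)+
  show "continuous_on UNIV (\<lambda>z. torsion_sum \<alpha> \<beta> N (fst z) (snd z))"
    by (intro double_sum_continuous sinN_continuous)
  show "\<alpha> * double_sum \<alpha> \<beta> N (sinN (Suc (Suc 0))) (sinN 0) s t
      + \<beta> * double_sum \<alpha> \<beta> N (sinN 0) (sinN (Suc (Suc 0))) s t \<le> 0"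
    if "0 < s" "s < pi" "0 < t" "t < pi" for s t
    unfolding torsion_sum_laplacian[OF pos] fejer_sin_eq
    using fejer_sin_bounds(1)[of s N] fejer_sin_bounds(1)[of t N] that by simp
qed (use assms in \<open>auto simp: double_sum_zero1 double_sum_zero2 sinN_0_at_0 sinN_0_at_pi\<close>)

text \<open>The derivative in the first variable is superharmonic on the left half of the rectangle, where
  its boundary values are nonnegative by symmetry and by positivity of the sum.\<close>

lemma torsion_sum_deriv1_nonneg:
  assumes pos: "\<alpha> > 0" "\<beta> > 0" and "0 \<le> s" "s \<le> pi / 2" "0 \<le> t" "t \<le> pi"
  shows "double_sum \<alpha> \<beta> N (sinN (Suc 0)) (sinN 0) s t \<ge> 0"
proof (rule minimum_principle_rectangle[where f = "double_sum \<alpha> \<beta> N (sinN (Suc 0)) (sinN 0)"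
      and \<alpha> = \<alpha> and \<beta> = \<beta> and a = 0 and b = "pi / 2" and c = 0 and d = pi])
  note d = double_sum_sinN_deriv1 double_sum_sinN_deriv2
  let ?D = "\<lambda>i l. double_sum \<alpha> \<beta> N (sinN i) (sinN l)"
  show "((\<lambda>s. ?D (Suc 0) 0 s t) has_real_derivative ?D (Suc (Suc 0)) 0 s t) (at s)"
    and "((\<lambda>s. ?D (Suc (Suc 0)) 0 s t) has_real_derivative ?D (Suc (Suc (Suc 0))) 0 s t) (at s)"
    and "((\<lambda>t. ?D (Suc 0) 0 s t) has_real_derivative ?D (Suc 0) (Suc 0) s t) (at t)"
    and "((\<lambda>t. ?D (Suc 0) (Suc 0) s t) has_real_derivative ?D (Suc 0) (Suc (Suc 0)) s t) (at t)" for s t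
    by (rule d)+
  show "continuous_on UNIV (\<lambda>z. ?D (Suc 0) 0 (fst z) (snd z))"
    by (intro double_sum_continuous sinN_continuous)
  show "\<alpha> * ?D (Suc (Suc (Suc 0))) 0 s t + \<beta> * ?D (Suc 0) (Suc (Suc 0)) s t \<le> 0"
    if "0 < s" "s < pi / 2" "0 < t" "t < pi" for s t
    unfolding torsion_sum_laplacian[OF pos] fejer_sin_eq fejer_cos_eq
    using fejer_cos_nonneg[of s N] fejer_sin_bounds(1)[of t N] that by simp
  show "?D (Suc 0) 0 0 t \<ge> 0 \<and> ?D (Suc 0) 0 (pi / 2) t \<ge> 0" if t: "0 \<le> t" "t \<le> pi" for t
  proof
    have "?D (Suc 0) 0 (pi / 2) t = 0"
      by (rule double_sum_zero1) (simp only: sinN_1 cos_odd_half_pi mult_zero_right)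
    then show "?D (Suc 0) 0 (pi / 2) t \<ge> 0" by simp
    \<comment> \<open>The sum itself vanishes at s = 0; a negative slope there would make it
      negative just inside.\<close>
    show "?D (Suc 0) 0 0 t \<ge> 0"
    proof (rule ccontr)
      assume "\<not> ?D (Suc 0) 0 0 t \<ge> 0"
      then obtain e where e: "e > 0" "\<And>h. h > 0 \<Longrightarrow> h < e \<Longrightarrow> ?D 0 0 (0 + h) t < ?D 0 0 0 t"
        using DERIV_neg_dec_right[OF d(1)[where i = 0 and s = 0]] by (metis not_le)
      define h where "h = min e pi / 2"
      have "0 < h" "h < e" "h \<le> pi" using e(1) by (auto simp: h_def min_def)
      then show False
        using e(2)[of h] torsion_sum_nonneg[OF pos, of h t N] t
        by (simp add: double_sum_zero1 sinN_0_at_0)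
    qed
  qed
qed (use assms in \<open>auto simp: double_sum_zero1 double_sum_zero2 sinN_0_at_0 sinN_0_at_pi\<close>)

lemma torsion_sum_le_mid1:
  assumes pos: "\<alpha> > 0" "\<beta> > 0" and "0 \<le> s" "s \<le> pi" "0 \<le> t" "t \<le> pi"
  shows "torsion_sum \<alpha> \<beta> N s t \<le> torsion_sum \<alpha> \<beta> N (pi / 2) t"
proof -
  have *: "torsion_sum \<alpha> \<beta> N s t \<le> torsion_sum \<alpha> \<beta> N (pi / 2) t" if s: "0 \<le> s" "s \<le> pi / 2" for s
  proof (rule DERIV_nonneg_imp_nondecreasing[OF s(2)])
    fix x assume "s \<le> x" "x \<le> pi / 2"
    then have "double_sum \<alpha> \<beta> N (sinN (Suc 0)) (sinN 0) x t \<ge> 0"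
      using s assms by (intro torsion_sum_deriv1_nonneg) auto
    then show "\<exists>y. ((\<lambda>s. torsion_sum \<alpha> \<beta> N s t) has_real_derivative y) (at x) \<and> 0 \<le> y"
      using double_sum_sinN_deriv1 by blast
  qed
  have "torsion_sum \<alpha> \<beta> N (pi - s) t = torsion_sum \<alpha> \<beta> N s t"
    by (simp add: double_sum_def sinN_reflect)
  then show ?thesis using *[of s] *[of "pi - s"] assms by (cases "s \<le> pi / 2") auto
qed

lemma torsion_sum_le_center:
  assumes pos: "\<alpha> > 0" "\<beta> > 0" and st: "0 \<le> s" "s \<le> pi" "0 \<le> t" "t \<le> pi"
  shows "torsion_sum \<alpha> \<beta> N s t \<le> torsion_sum \<alpha> \<beta> N (pi / 2) (pi / 2)"
proof -
  have "torsion_sum \<alpha> \<beta> N s t \<le> torsion_sum \<alpha> \<beta> N (pi / 2) t"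
    by (rule torsion_sum_le_mid1[OF pos st])
  also have "\<dots> = torsion_sum \<beta> \<alpha> N t (pi / 2)" by (rule double_sum_swap)
  also have "\<dots> \<le> torsion_sum \<beta> \<alpha> N (pi / 2) (pi / 2)"
    using st by (intro torsion_sum_le_mid1 pos) auto
  also have "\<dots> = torsion_sum \<alpha> \<beta> N (pi / 2) (pi / 2)" by (rule double_sum_swap)
  finally show ?thesis .
qed

section \<open>The value at the centre\<close>

text \<open>As alpha beta = 1, the two denominators have product \<open>Q\<close> and sum
  \<open>c * p\<close>, both depending on \<open>\<alpha>\<close> and \<open>\<beta>\<close> only
  through \<open>c\<close>. The factor c - 2, which vanishes for the square, can then be split
  off.\<close>

lemma reciprocal_pair:
  fixes \<alpha> \<beta> m n :: real
  assumes "\<alpha> > 0" "\<beta> > 0" "\<alpha> * \<beta> = 1" "m > 0" "n > 0"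
    and c_def: "c = \<alpha> + \<beta>" and p_def: "p = m\<^sup>2 + n\<^sup>2"
    and Q_def: "Q = (m\<^sup>2 - n\<^sup>2)\<^sup>2 + (m * n * c)\<^sup>2"
  shows "2 / p - 1 / (m\<^sup>2 * \<alpha> + n\<^sup>2 * \<beta>) - 1 / (n\<^sup>2 * \<alpha> + m\<^sup>2 * \<beta>)
     = (c - 2) * (2 * (m * n)\<^sup>2 * c - (m\<^sup>2 - n\<^sup>2)\<^sup>2) / (p * Q)"
proof -
  let ?q1 = "m\<^sup>2 * \<alpha> + n\<^sup>2 * \<beta>" and ?q2 = "n\<^sup>2 * \<alpha> + m\<^sup>2 * \<beta>"
  have pos: "?q1 > 0" "?q2 > 0" "p > 0" using assms by (auto simp: add_pos_pos)
  have Q: "Q = ?q1 * ?q2"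
  proof -
    have "?q1 * ?q2 = m\<^sup>2 * n\<^sup>2 * (\<alpha>\<^sup>2 + \<beta>\<^sup>2) + (m ^ 4 + n ^ 4) * (\<alpha> * \<beta>)"
      by (simp add: power2_eq_square power4_eq_xxxx algebra_simps)
    also have "\<alpha>\<^sup>2 + \<beta>\<^sup>2 = c\<^sup>2 - 2" using assms(3) by (simp add: c_def power2_sum)
    finally show ?thesis
      using assms(3) by (simp add: Q_def power2_eq_square power4_eq_xxxx algebra_simps)
  qed
  have s: "?q1 + ?q2 = c * p" by (simp add: c_def p_def algebra_simps)
  have "1 / x + 1 / y = (x + y) / (x * y)" if "x > 0" "y > 0" for x y :: real
    using that by (simp add: field_simps)
  from this[OF pos(1,2)] have "2 / p - 1 / ?q1 - 1 / ?q2 = 2 / p - (?q1 + ?q2) / (?q1 * ?q2)"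
    by linarith
  also have "\<dots> = (2 * Q - c * p\<^sup>2) / (p * Q)"
  proof -
    have "Q > 0" unfolding Q using pos by simp
    then show ?thesis
      unfolding s Q[symmetric] using pos(3) by (simp add: diff_divide_distrib power2_eq_square)
  qed
  also have "2 * Q - c * p\<^sup>2 = (c - 2) * (2 * (m * n)\<^sup>2 * c - (m\<^sup>2 - n\<^sup>2)\<^sup>2)"
    by (simp add: Q_def p_def power2_eq_square algebra_simps)
  finally show ?thesis .
qed

text \<open>With r = mn and d = |m^2 - n^2|, the exact formula reduces the claim to c r |2 r^2 c -
  d^2| <= p (d^2 + r^2 c^2).\<close>

lemma reciprocal_pair_bound:
  fixes \<alpha> \<beta> m n :: real
  assumes ab: "\<alpha> > 0" "\<beta> > 0" "\<alpha> * \<beta> = 1" and mn: "m > 0" "n > 0"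
  shows "\<bar>2 / (m\<^sup>2 + n\<^sup>2) - 1 / (m\<^sup>2 * \<alpha> + n\<^sup>2 * \<beta>) - 1 / (n\<^sup>2 * \<alpha> + m\<^sup>2 * \<beta>)\<bar>
     \<le> (1 - 2 / (\<alpha> + \<beta>)) / (m * n)"
proof -
  define c where "c = \<alpha> + \<beta>"
  define p where "p = m\<^sup>2 + n\<^sup>2"
  define d where "d = \<bar>m\<^sup>2 - n\<^sup>2\<bar>"
  define r where "r = m * n"
  have c2: "c \<ge> 2"
    using zero_le_power2[of "\<alpha> - \<beta>"] ab power2_le_imp_le[of 2 c]
    by (simp add: c_def power2_diff power2_sum)
  have r: "r > 0" and p: "p > 0" using mn by (auto simp: r_def p_def add_pos_pos)
  have pr: "2 * r \<le> p" using zero_le_power2[of "m - n"] by (simp add: p_def r_def power2_diff)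
  have d: "0 \<le> d" "d \<le> p" by (auto simp: d_def p_def abs_le_iff)
  have dd: "(m\<^sup>2 - n\<^sup>2)\<^sup>2 = d\<^sup>2" by (simp add: d_def)
  let ?Q = "d\<^sup>2 + (r * c)\<^sup>2"
  have Q: "?Q > 0" using r c2 by (simp add: add_nonneg_pos)
  \<comment> \<open>AM-GM enters as 2 r <= p; the terms in d^2 have the favourable sign.\<close>
  have up: "c * r * (2 * r\<^sup>2 * c - d\<^sup>2) \<le> p * ?Q"
  proof -
    have "(2 * r) * (r * c)\<^sup>2 \<le> p * (r * c)\<^sup>2" using pr by (intro mult_right_mono) auto
    moreover have "0 \<le> c * r * d\<^sup>2 + p * d\<^sup>2" using c2 r p by simp
    ultimately show ?thesis by (simp add: algebra_simps power2_eq_square)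
  qed
  \<comment> \<open>AM-GM is applied to d and r c, followed by d <= p.\<close>
  have low: "c * r * (d\<^sup>2 - 2 * r\<^sup>2 * c) \<le> p * ?Q"
  proof -
    have "2 * (d * (r * c)) \<le> ?Q" using zero_le_power2[of "d - r * c"] by (simp add: power2_diff)
    then have "p * (2 * (d * (r * c))) \<le> p * ?Q" using p by (intro mult_left_mono) auto
    moreover have "d * (2 * (d * (r * c))) \<le> p * (2 * (d * (r * c)))"
      using d c2 r by (intro mult_right_mono) auto
    moreover have "0 \<le> (r * c) * (d * d)" "0 \<le> c * r * (2 * r\<^sup>2 * c)" using c2 r by auto
    ultimately show ?thesis by (simp add: algebra_simps power2_eq_square)
  qed
  have "\<bar>c * r * (2 * r\<^sup>2 * c - d\<^sup>2)\<bar> \<le> p * ?Q"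
    using up low by (simp add: abs_le_iff algebra_simps)
  then have "c * r * \<bar>2 * r\<^sup>2 * c - d\<^sup>2\<bar> \<le> p * ?Q"
    using c2 r by (simp add: abs_mult)
  then have "(c - 2) * (c * r * \<bar>2 * r\<^sup>2 * c - d\<^sup>2\<bar>) \<le> (c - 2) * (p * ?Q)"
    using c2 by (intro mult_left_mono) auto
  then have "(c - 2) * \<bar>2 * r\<^sup>2 * c - d\<^sup>2\<bar> / (p * ?Q) \<le> (c - 2) / (c * r)"
    using p Q c2 r by (simp add: divide_le_eq le_divide_eq mult_ac)
  moreover have "(c - 2) / (c * r) = (1 - 2 / c) / r" using c2 r by (simp add: field_simps)
  ultimately show ?thesis
    unfolding reciprocal_pair[OF ab mn refl refl refl] using c2 p Q
    by (simp add: abs_mult dd c_def[symmetric] p_def[symmetric] r_def[symmetric])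
qed

lemma torsion_sum_center:
  "torsion_sum \<alpha> \<beta> N (pi / 2) (pi / 2)
    = (\<Sum>j<N. \<Sum>k<N. (fejer N j * (-1) ^ j / real (2 * j + 1)) * (fejer N k * (-1) ^ k / real (2 * k + 1))
        * (1 / ((real (2 * j + 1))\<^sup>2 * \<alpha> + (real (2 * k + 1))\<^sup>2 * \<beta>)))"
  unfolding double_sum_def sinN_0 sin_odd_half_pi coef_def
  by (intro sum.cong refl) (simp add: mult_ac del: of_nat_add of_nat_mult of_nat_Suc)

text \<open>Symmetrising in j and k puts both orders of the denominator into \<open>T\<close>, whose
  size \<open>reciprocal_pair_bound\<close> controls. Off the diagonal the sign of
  \<open>g j * g k\<close> is given up for the worst case; on the diagonal it is positive and
  \<open>T\<close> is evaluated exactly.\<close>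

lemma torsion_sum_center_diff:
  assumes ab: "\<alpha> > 0" "\<beta> > 0" "\<alpha> * \<beta> = 1"
  shows "2 * (torsion_sum 1 1 N (pi / 2) (pi / 2) - torsion_sum \<alpha> \<beta> N (pi / 2) (pi / 2))
    \<ge> (1 - 2 / (\<alpha> + \<beta>)) * (2 * (\<Sum>k<N. (fejer N k)\<^sup>2 / real (2 * k + 1) ^ 4)
        - (\<Sum>k<N. fejer N k / (real (2 * k + 1))\<^sup>2)\<^sup>2)"
proof -
  define m where "m k = real (2 * k + 1)" for k
  define g where "g k = fejer N k * (-1) ^ k / m k" for k
  define c where "c = 1 - 2 / (\<alpha> + \<beta>)"
  define q where "q j k = 1 / ((m j)\<^sup>2 * \<alpha> + (m k)\<^sup>2 * \<beta>)" for j k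
  define T where "T j k = 2 / ((m j)\<^sup>2 + (m k)\<^sup>2) - q j k - q k j" for j k
  have m: "m k > 0" for k by (simp add: m_def)
  have ts: "torsion_sum \<alpha> \<beta> N (pi / 2) (pi / 2) = (\<Sum>j<N. \<Sum>k<N. g j * g k * q j k)"
    unfolding torsion_sum_center g_def m_def q_def ..
  then have ts': "torsion_sum \<alpha> \<beta> N (pi / 2) (pi / 2) = (\<Sum>j<N. \<Sum>k<N. g j * g k * q k j)"
    by (subst sum.swap) (simp add: mult.commute)
  have t1: "torsion_sum 1 1 N (pi / 2) (pi / 2) = (\<Sum>j<N. \<Sum>k<N. g j * g k * (1 / ((m j)\<^sup>2 + (m k)\<^sup>2)))"
    unfolding torsion_sum_center g_def m_def by simp
  have "2 * (torsion_sum 1 1 N (pi / 2) (pi / 2) - torsion_sum \<alpha> \<beta> N (pi / 2) (pi / 2))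
      = 2 * torsion_sum 1 1 N (pi / 2) (pi / 2) - torsion_sum \<alpha> \<beta> N (pi / 2) (pi / 2)
        - torsion_sum \<alpha> \<beta> N (pi / 2) (pi / 2)" by simp
  also have "\<dots> = 2 * (\<Sum>j<N. \<Sum>k<N. g j * g k * (1 / ((m j)\<^sup>2 + (m k)\<^sup>2)))
      - (\<Sum>j<N. \<Sum>k<N. g j * g k * q j k) - (\<Sum>j<N. \<Sum>k<N. g j * g k * q k j)"
    using ts ts' t1 by argo
  also have "\<dots> = (\<Sum>j<N. \<Sum>k<N. g j * g k * T j k)"
    unfolding sum_distrib_left sum_subtractf[symmetric] T_def
    by (intro sum.cong refl) (simp add: right_diff_distrib)
  \<comment> \<open>The subtracted products run over all pairs, so that they sum to a square; the
    factor 2 compensates for this on the diagonal and leaves the exact term there.\<close>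
  also have "\<dots> \<ge> (\<Sum>j<N. \<Sum>k<N. c * ((if j = k then 2 * ((fejer N j)\<^sup>2 / m j ^ 4) else 0)
      - (fejer N j / (m j)\<^sup>2) * (fejer N k / (m k)\<^sup>2)))"
  proof (intro sum_mono)
    fix j k assume jk: "j \<in> {..<N}" "k \<in> {..<N}"
    have f: "fejer N j \<ge> 0" "fejer N k \<ge> 0" using jk fejer_bounds(1) by auto
    have cT: "\<bar>T j k\<bar> \<le> c / (m j * m k)"
      unfolding T_def q_def c_def by (rule reciprocal_pair_bound[OF ab m m])
    show "c * ((if j = k then 2 * ((fejer N j)\<^sup>2 / m j ^ 4) else 0)
      - (fejer N j / (m j)\<^sup>2) * (fejer N k / (m k)\<^sup>2)) \<le> g j * g k * T j k"
    proof (cases "j = k")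
      case True
      have "2 / (x + x) - 1 / (x * y) - 1 / (x * y) = (1 - 2 / y) / x" if "x > 0" "y > 0" for x y :: real
        using that by (simp add: field_simps)
      from this[of "(m j)\<^sup>2" "\<alpha> + \<beta>"] have "T j j = c / (m j)\<^sup>2"
        unfolding T_def q_def c_def using m[of j] ab by (simp add: distrib_left)
      moreover have "((-1::real) ^ j) * (-1) ^ j = 1" by (simp flip: power_mult_distrib)
      then have "g j * g j = (fejer N j)\<^sup>2 / (m j)\<^sup>2"
        by (simp add: g_def power2_eq_square field_simps)
      ultimately have e1: "g j * g j * T j j = c * ((fejer N j)\<^sup>2 / m j ^ 4)"
        by (simp add: power2_eq_square power4_eq_xxxx mult_ac)
      have e2: "(fejer N j / (m j)\<^sup>2) * (fejer N j / (m j)\<^sup>2) = (fejer N j)\<^sup>2 / m j ^ 4"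
        by (simp add: power2_eq_square power4_eq_xxxx)
      show ?thesis unfolding True[symmetric] e1 e2 by simp
    next
      case False
      have "\<bar>g j\<bar> * \<bar>g k\<bar> * \<bar>T j k\<bar> \<le> \<bar>g j\<bar> * \<bar>g k\<bar> * (c / (m j * m k))"
        by (intro mult_left_mono cT) auto
      moreover have "\<bar>g j\<bar> = fejer N j / m j" "\<bar>g k\<bar> = fejer N k / m k"
        using f m[of j] m[of k] by (auto simp: g_def abs_mult)
      ultimately have "\<bar>g j * g k * T j k\<bar> \<le> c * ((fejer N j / (m j)\<^sup>2) * (fejer N k / (m k)\<^sup>2))"
        by (simp add: abs_mult power2_eq_square mult_ac)
      then show ?thesis using False by simp
    qed
  qed
  also have "(\<Sum>j<N. \<Sum>k<N. c * ((if j = k then 2 * ((fejer N j)\<^sup>2 / m j ^ 4) else 0)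
      - (fejer N j / (m j)\<^sup>2) * (fejer N k / (m k)\<^sup>2)))
      = c * (2 * (\<Sum>k<N. (fejer N k)\<^sup>2 / m k ^ 4) - (\<Sum>k<N. fejer N k / (m k)\<^sup>2)\<^sup>2)"
    unfolding power2_eq_square[of "sum _ _"] sum_product
    by (simp add: sum_distrib_left[symmetric] sum_subtractf sum.delta' cong: if_cong)
      (simp add: sum_distrib_left)
  finally show ?thesis unfolding c_def m_def .
qed

section \<open>Absolute summability and convergence of the double sums\<close>

lemma fejer_tannery:
  fixes a :: "nat \<Rightarrow> nat \<Rightarrow> real"
  assumes "summable M" "\<And>k N. \<bar>a k N\<bar> \<le> M k" "\<And>k. (\<lambda>N. a k N) \<longlonglongrightarrow> b k"
  shows "(\<lambda>N. \<Sum>k<N. fejer N k * a k N) \<longlonglongrightarrow> suminf b"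
proof -
  \<comment> \<open>Padding with zeros from \<open>N\<close> on turns the finite sum into a series
    to which Tannery's theorem applies. The dependence of \<open>a\<close> on \<open>N\<close> lets
    an inner sum take its place.\<close>
  define h where "h k N = (if k < N then fejer N k * a k N else 0)" for k N
  have "\<bar>h k N\<bar> \<le> M k" for k N
  proof (cases "k < N")
    case True
    then have "\<bar>h k N\<bar> = fejer N k * \<bar>a k N\<bar>" using fejer_bounds(1) by (simp add: h_def abs_mult)
    also have "\<dots> \<le> 1 * \<bar>a k N\<bar>" by (intro mult_right_mono fejer_bounds) auto
    finally show ?thesis using assms(2)[of k N] by simp
  qed (use order_trans[OF abs_ge_zero assms(2)] in \<open>auto simp: h_def\<close>)
  then have "\<forall>\<^sub>F x in at_top \<times>\<^sub>F sequentially. case x of (k, N) \<Rightarrow> norm (h k N) \<le> M k"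
    by (intro always_eventually) auto
  moreover have "(\<lambda>N. h k N) \<longlonglongrightarrow> b k" for k
  proof (rule Lim_transform_eventually)
    show "(\<lambda>N. fejer N k * a k N) \<longlonglongrightarrow> b k"
      using tendsto_mult[OF fejer_tendsto_1 assms(3)] by simp
    show "\<forall>\<^sub>F N in sequentially. fejer N k * a k N = h k N"
      using eventually_gt_at_top[of k] by eventually_elim (simp add: h_def)
  qed
  ultimately have "(\<lambda>N. \<Sum>k. h k N) \<longlonglongrightarrow> suminf b"
    using tannerys_theorem[of h b sequentially M] assms(1) by auto
  moreover have "(\<Sum>k. h k N) = (\<Sum>k<N. fejer N k * a k N)" for N
    using suminf_finite[of "{..<N}" "\<lambda>k. h k N"] by (simp add: h_def)
  ultimately show ?thesis by simp
qed

text \<open>Tannery's theorem twice: for fixed \<open>j\<close> the inner sum converges and is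
  dominated by a multiple of \<open>M j\<close>, so it can serve as the summand of the outer
  sum.\<close>

lemma fejer_double_convergent:
  fixes b :: "nat \<Rightarrow> nat \<Rightarrow> real"
  assumes M: "summable M" "\<And>k. M k \<ge> 0" and b: "\<And>j k. \<bar>b j k\<bar> \<le> C * (M j * M k)"
  shows "convergent (\<lambda>N. \<Sum>j<N. \<Sum>k<N. fejer N j * fejer N k * b j k)"
    and "\<bar>\<Sum>j<N. \<Sum>k<N. fejer N j * fejer N k * b j k\<bar> \<le> \<bar>C\<bar> * (suminf M)\<^sup>2"
proof -
  have sM: "(\<Sum>k<N. M k) \<le> suminf M" for N using M by (intro sum_le_suminf) auto
  have S0: "suminf M \<ge> 0" using M by (intro suminf_nonneg)
  have b': "\<bar>b j k\<bar> \<le> \<bar>C\<bar> * M j * M k" for j k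
  proof -
    have "C * (M j * M k) \<le> \<bar>C\<bar> * (M j * M k)" using M(2) by (intro mult_right_mono) auto
    then show ?thesis using b[of j k] by simp
  qed
  have inner: "\<bar>\<Sum>k<N. fejer N k * b j k\<bar> \<le> \<bar>C\<bar> * suminf M * M j" for j N
  proof -
    have "\<bar>\<Sum>k<N. fejer N k * b j k\<bar> \<le> (\<Sum>k<N. \<bar>fejer N k * b j k\<bar>)" by (rule sum_abs)
    also have "\<dots> \<le> (\<Sum>k<N. 1 * (\<bar>C\<bar> * M j * M k))"
      unfolding abs_mult
      by (intro sum_mono mult_mono b') (auto simp: fejer_bounds)
    also have "\<dots> = \<bar>C\<bar> * M j * (\<Sum>k<N. M k)" by (simp add: sum_distrib_left)
    also have "\<dots> \<le> \<bar>C\<bar> * M j * suminf M" using sM M(2) by (intro mult_left_mono) auto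
    finally show ?thesis by (simp add: mult_ac)
  qed
  have eq: "(\<Sum>j<N. \<Sum>k<N. fejer N j * fejer N k * b j k) = (\<Sum>j<N. fejer N j * (\<Sum>k<N. fejer N k * b j k))" for N
    by (simp add: sum_distrib_left mult.assoc)
  have "(\<lambda>N. \<Sum>j<N. fejer N j * (\<Sum>k<N. fejer N k * b j k)) \<longlonglongrightarrow> (\<Sum>j. suminf (b j))"
  proof (rule fejer_tannery)
    show "summable (\<lambda>j. \<bar>C\<bar> * suminf M * M j)" using M(1) by (rule summable_mult)
    show "\<bar>\<Sum>k<N. fejer N k * b j k\<bar> \<le> \<bar>C\<bar> * suminf M * M j" for j N by (rule inner)
    show "(\<lambda>N. \<Sum>k<N. fejer N k * b j k) \<longlonglongrightarrow> suminf (b j)" for j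
      by (rule fejer_tannery[where M = "\<lambda>k. \<bar>C\<bar> * M j * M k"]) (auto intro: summable_mult M(1) b')
  qed
  then show "convergent (\<lambda>N. \<Sum>j<N. \<Sum>k<N. fejer N j * fejer N k * b j k)"
    unfolding eq by (rule convergentI)
  have "\<bar>\<Sum>j<N. fejer N j * (\<Sum>k<N. fejer N k * b j k)\<bar>
      \<le> (\<Sum>j<N. \<bar>fejer N j * (\<Sum>k<N. fejer N k * b j k)\<bar>)" by (rule sum_abs)
  also have "\<dots> \<le> (\<Sum>j<N. 1 * (\<bar>C\<bar> * suminf M * M j))"
    unfolding abs_mult by (intro sum_mono mult_mono inner[unfolded abs_mult]) (auto simp: fejer_bounds)
  also have "\<dots> = \<bar>C\<bar> * suminf M * (\<Sum>j<N. M j)" by (simp add: sum_distrib_left)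
  also have "\<dots> \<le> \<bar>C\<bar> * suminf M * suminf M" using sM S0 by (intro mult_left_mono) auto
  finally show "\<bar>\<Sum>j<N. \<Sum>k<N. fejer N j * fejer N k * b j k\<bar> \<le> \<bar>C\<bar> * (suminf M)\<^sup>2"
    unfolding eq by (simp add: power2_eq_square mult.assoc)
qed

text \<open>m^(-3/2) for m = 2k + 1. A coefficient with one derivative is homogeneous of degree -3
  in the two frequencies; splitting this evenly gives each index an exponent that is still
  summable.\<close>

definition odd_weight :: "nat \<Rightarrow> real" where
  "odd_weight k = 1 / sqrt (real (2 * k + 1)) ^ 3"

lemma odd_weight_summable: "summable odd_weight"
proof (rule summable_comparison_test)
  show "\<exists>N. \<forall>n\<ge>N. norm (odd_weight n) \<le> real (Suc n) powr (-3/2)"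
  proof (intro exI allI impI)
    fix n :: nat
    have "real (Suc n) powr (-3/2) = 1 / sqrt (real (Suc n)) ^ 3"
    proof -
      have "sqrt (real (Suc n)) ^ 3 = (real (Suc n) powr (1/2)) ^ 3"
        by (simp add: powr_half_sqrt del: of_nat_Suc)
      also have "\<dots> = real (Suc n) powr (3/2)" by (simp add: powr_power del: of_nat_Suc)
      finally show ?thesis by (simp add: powr_minus_divide)
    qed
    moreover have "sqrt (real (Suc n)) ^ 3 \<le> sqrt (real (2 * n + 1)) ^ 3"
      by (intro power_mono) auto
    ultimately show "norm (odd_weight n) \<le> real (Suc n) powr (-3/2)"
      by (simp add: odd_weight_def frac_le del: of_nat_Suc of_nat_add of_nat_mult)
  qed
  show "summable (\<lambda>n. real (Suc n) powr (-3/2))"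
    using summable_real_powr_iff[of "-3/2"] by (subst summable_Suc_iff) simp
qed

lemma odd_weight_nonneg: "odd_weight k \<ge> 0" by (simp add: odd_weight_def)

text \<open>The fourth power of the larger number alone is enough.\<close>

lemma mult_cube_le: "x > 0 \<Longrightarrow> y > 0 \<Longrightarrow> x ^ 3 * y \<le> x ^ 4 + (y::real) ^ 4"
proof -
  assume x: "x > 0" and y: "y > 0"
  show ?thesis
  proof (cases "x \<le> y")
    case True
    then have "x ^ 3 * y \<le> y ^ 3 * y" using x y by (intro mult_right_mono power_mono) auto
    also have "\<dots> = y ^ 4" by (simp add: power3_eq_cube power4_eq_xxxx)
    finally show ?thesis using zero_le_power[of x 4] x by linarith
  next
    case False
    then have "x ^ 3 * y \<le> x ^ 3 * x" using x by (intro mult_left_mono) auto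
    also have "\<dots> = x ^ 4" by (simp add: power3_eq_cube power4_eq_xxxx)
    finally show ?thesis using zero_le_power[of y 4] y by linarith
  qed
qed

lemma coef_swap: "coef \<alpha> \<beta> j k = coef \<beta> \<alpha> k j"
  by (simp add: coef_def algebra_simps)

text \<open>The factor 2j + 1 is the price of one derivative in the first variable. With m = x^2 and
  n = y^2, the core is x^3 y <= x^4 + y^4, multiplied by y^2.\<close>

lemma coef_bound1:
  assumes "\<alpha> > 0" "\<beta> > 0"
  shows "real (2 * j + 1) * coef \<alpha> \<beta> j k \<le> 1 / min \<alpha> \<beta> * (odd_weight j * odd_weight k)"
proof -
  define m n where "m = real (2 * j + 1)" and "n = real (2 * k + 1)"
  define x y where "x = sqrt m" and "y = sqrt n"
  have mn: "m > 0" "n > 0" by (auto simp: m_def n_def)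
  then have xy: "x > 0" "y > 0" "m = x\<^sup>2" "n = y\<^sup>2" by (auto simp: x_def y_def)
  have "min \<alpha> \<beta> * (x ^ 3 * y ^ 3) \<le> min \<alpha> \<beta> * (y\<^sup>2 * (x ^ 4 + y ^ 4))"
  proof (intro mult_left_mono)
    have "y\<^sup>2 * (x ^ 3 * y) \<le> y\<^sup>2 * (x ^ 4 + y ^ 4)"
      using xy by (intro mult_left_mono mult_cube_le) auto
    then show "x ^ 3 * y ^ 3 \<le> y\<^sup>2 * (x ^ 4 + y ^ 4)"
      by (simp add: power2_eq_square power3_eq_cube mult_ac)
  qed (use assms in auto)
  also have "\<dots> = n * (m\<^sup>2 * min \<alpha> \<beta> + n\<^sup>2 * min \<alpha> \<beta>)"
    unfolding xy(3,4) by (simp add: power2_eq_square power4_eq_xxxx algebra_simps)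
  also have "\<dots> \<le> n * (m\<^sup>2 * \<alpha> + n\<^sup>2 * \<beta>)"
    using mn by (intro mult_left_mono add_mono) auto
  finally have le: "min \<alpha> \<beta> * (x ^ 3 * y ^ 3) \<le> n * (m\<^sup>2 * \<alpha> + n\<^sup>2 * \<beta>)" .
  have "m * coef \<alpha> \<beta> j k = 1 / (n * (m\<^sup>2 * \<alpha> + n\<^sup>2 * \<beta>))"
    unfolding coef_def m_def[symmetric] n_def[symmetric] using mn by simp
  also have "\<dots> \<le> 1 / (min \<alpha> \<beta> * (x ^ 3 * y ^ 3))"
    using le xy(1,2) assms by (intro frac_le) auto
  also have "\<dots> = 1 / min \<alpha> \<beta> * (odd_weight j * odd_weight k)"
    by (simp add: odd_weight_def x_def y_def m_def n_def)
  finally show ?thesis by (simp add: m_def)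
qed

lemma coef_nonneg: "\<alpha> > 0 \<Longrightarrow> \<beta> > 0 \<Longrightarrow> coef \<alpha> \<beta> j k \<ge> 0"
  by (simp add: coef_def)

text \<open>One derivative in total is the limit for absolute summability: for
  \<open>i = l = 1\<close> the bound would be 1/(m^2 alpha + n^2 beta), whose double sum
  diverges.\<close>

lemma coef_sinN_bound:
  assumes "\<alpha> > 0" "\<beta> > 0" "i + l \<le> 1"
  shows "\<bar>coef \<alpha> \<beta> j k * (sinN i j s * sinN l k t)\<bar> \<le> 1 / min \<alpha> \<beta> * (odd_weight j * odd_weight k)"
proof -
  let ?m = "real (2 * j + 1)" and ?n = "real (2 * k + 1)"
  have c0: "coef \<alpha> \<beta> j k \<ge> 0" by (rule coef_nonneg[OF assms(1,2)])
  have "\<bar>coef \<alpha> \<beta> j k * (sinN i j s * sinN l k t)\<bar> \<le> coef \<alpha> \<beta> j k * (?m ^ i * ?n ^ l)"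
    unfolding abs_mult using c0 by (intro mult_mono sinN_bound) auto
  also have "\<dots> \<le> 1 / min \<alpha> \<beta> * (odd_weight j * odd_weight k)"
  proof -
    have b1: "?m * coef \<alpha> \<beta> j k \<le> 1 / min \<alpha> \<beta> * (odd_weight j * odd_weight k)"
      by (rule coef_bound1[OF assms(1,2)])
    have b2: "?n * coef \<alpha> \<beta> j k \<le> 1 / min \<alpha> \<beta> * (odd_weight j * odd_weight k)"
      using coef_bound1[OF assms(2,1), of k j] by (simp add: coef_swap[of \<alpha> \<beta>] min.commute mult_ac)
    consider "i = 0" "l = 0" | "i = 1" "l = 0" | "i = 0" "l = 1" using assms(3) by linarith
    then show ?thesis
    proof cases
      case 1
      have "1 * coef \<alpha> \<beta> j k \<le> ?m * coef \<alpha> \<beta> j k" using c0 by (intro mult_right_mono) auto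
      then show ?thesis using 1 b1 by simp
    qed (use b1 b2 in \<open>simp_all add: mult.commute\<close>)
  qed
  finally show ?thesis .
qed

lemma double_sum_convergent:
  assumes "\<alpha> > 0" "\<beta> > 0" "i + l \<le> 1"
  shows "convergent (\<lambda>N. double_sum \<alpha> \<beta> N (sinN i) (sinN l) s t)"
    and "\<bar>double_sum \<alpha> \<beta> N (sinN i) (sinN l) s t\<bar> \<le> \<bar>1 / min \<alpha> \<beta>\<bar> * (suminf odd_weight)\<^sup>2"
proof -
  have *: "double_sum \<alpha> \<beta> N (sinN i) (sinN l) s t
     = (\<Sum>j<N. \<Sum>k<N. fejer N j * fejer N k * (coef \<alpha> \<beta> j k * (sinN i j s * sinN l k t)))" for N
    by (simp only: double_sum_def mult.assoc)
  note b = fejer_double_convergent[OF odd_weight_summable odd_weight_nonneg coef_sinN_bound[OF assms]]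
  show "convergent (\<lambda>N. double_sum \<alpha> \<beta> N (sinN i) (sinN l) s t)"
    and "\<bar>double_sum \<alpha> \<beta> N (sinN i) (sinN l) s t\<bar> \<le> \<bar>1 / min \<alpha> \<beta>\<bar> * (suminf odd_weight)\<^sup>2"
    unfolding * by (rule b(1), rule b(2))
qed

section \<open>The torsion function of a rectangle\<close>

text \<open>Green's formula, coordinate by coordinate; the compact support of \<open>\<psi>\<close>
  removes the boundary term.\<close>

lemma integral_grad_inner_grad:
  fixes f :: "'a::euclidean_space \<Rightarrow> real"
  assumes "open \<Omega>" "bounded \<Omega>" "smooth f" "test_function \<Omega> \<psi>"
  shows "(LINT x|lebesgue_on \<Omega>. grad f x \<bullet> grad \<psi> x)
    = - (LINT x|lebesgue_on \<Omega>. (\<Sum>b\<in>Basis. frechet_derivative (\<lambda>y. frechet_derivative f (at y) b) (at x) b) * \<psi> x)"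
proof -
  let ?M = "lebesgue_on \<Omega>"
  have s\<psi>: "smooth \<psi>" using assms(4) by (rule test_functionD)
  note sd = smooth_frechet_derivative
  have int: "integrable ?M (\<lambda>x. g x * h x)" if "smooth g" "smooth h" for g h :: "'a \<Rightarrow> real"
    using integrable_inner_L2[OF smooth_L2(1)[OF assms(1,2) that(1)] smooth_L2(1)[OF assms(1,2) that(2)]]
    by simp
  have "(LINT x|?M. grad f x \<bullet> grad \<psi> x)
      = (LINT x|?M. (\<Sum>b\<in>Basis. frechet_derivative f (at x) b * frechet_derivative \<psi> (at x) b))"
    unfolding grad_inner_grad by (intro Bochner_Integration.integral_cong sum.cong) (auto simp: inner_grad)
  also have "\<dots> = (\<Sum>b\<in>Basis. LINT x|?M. frechet_derivative f (at x) b * frechet_derivative \<psi> (at x) b)"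
    by (intro Bochner_Integration.integral_sum int sd assms(3) s\<psi>)
  also have "\<dots> = (\<Sum>b\<in>Basis. - (LINT x|?M. frechet_derivative (\<lambda>y. frechet_derivative f (at y) b) (at x) b * \<psi> x))"
    by (intro sum.cong refl integration_by_parts_test_function assms sd)
  also have "\<dots> = - (LINT x|?M. (\<Sum>b\<in>Basis. frechet_derivative (\<lambda>y. frechet_derivative f (at y) b) (at x) b * \<psi> x))"
    unfolding sum_negf
    by (subst Bochner_Integration.integral_sum) (auto intro!: int sd assms(3) s\<psi>)
  finally show ?thesis by (simp only: sum_distrib_right)
qed

lemma grad_plane:
  "grad f z = (frechet_derivative f (at z) (1, 0), frechet_derivative f (at (z :: real \<times> real)) (0, 1))"
  by (auto simp: grad_def Basis_prod_def sum.union_disjoint image_iff sum.reindex inj_on_def)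

lemma sum_Basis_plane: "(\<Sum>b\<in>(Basis :: (real \<times> real) set). h b) = h (1, 0) + h (0, 1)"
  by (auto simp: Basis_prod_def sum.union_disjoint image_iff sum.reindex inj_on_def add.commute)

lemma frechet_derivative_cmult:
  "smooth f \<Longrightarrow> frechet_derivative (\<lambda>z. c * f z) (at z) v = c * frechet_derivative f (at z) v"
  by (intro frechet_derivative_eqI has_derivative_mult_right frechet_derivative_worksI smooth_differentiable)

locale rectangle_torsion =
  fixes a :: real
  assumes a: "a > 0"
begin

definition angle1 :: "real \<times> real \<Rightarrow> real" where
  "angle1 z = pi / a * fst z + pi / 2"

definition angle2 :: "real \<times> real \<Rightarrow> real" where
  "angle2 z = pi * a * snd z + pi / 2"

text \<open>\<open>i\<close> and \<open>l\<close> count derivatives in the two angles. The weights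
  are the squared slopes of the angles without the common factor pi^2; their product is 1, as the
  estimate at the centre requires.\<close>

abbreviation D :: "nat \<Rightarrow> nat \<Rightarrow> nat \<Rightarrow> real \<Rightarrow> real \<Rightarrow> real" where
  "D N i l \<equiv> double_sum (1 / a\<^sup>2) (a\<^sup>2) N (sinN i) (sinN l)"

text \<open>16/pi^4 is (4/pi)^2/pi^2: a factor 4/pi normalises each odd sine series to the constant
  1, and 1/pi^2 undoes the common factor in the slopes of the angles.\<close>

definition approx :: "nat \<Rightarrow> real \<times> real \<Rightarrow> real" where
  "approx N z = 16 / pi ^ 4 * D N 0 0 (angle1 z) (angle2 z)"

lemma pos: "1 / a\<^sup>2 > 0" "a\<^sup>2 > 0" using a by auto

lemma smooth_angle: "smooth angle1" "smooth angle2"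
  unfolding angle1_def[abs_def] angle2_def[abs_def]
  by (intro smooth_add smooth_mult smooth_const smooth_fst smooth_snd)+

lemma smooth_D: "smooth (\<lambda>z. D N i l (angle1 z) (angle2 z))"
proof -
  have "smooth (\<lambda>z. sinN i j (angle1 z))" "smooth (\<lambda>z. sinN i j (angle2 z))" for i j
    by (rule smooth_compose[where D = "\<lambda>i. sinN i j", OF sinN_deriv smooth_angle(1)])
      (rule smooth_compose[where D = "\<lambda>i. sinN i j", OF sinN_deriv smooth_angle(2)])
  then show ?thesis
    unfolding double_sum_def by (intro smooth_sum smooth_mult smooth_const)
qed

lemma smooth_approx: "smooth (approx N)"
  unfolding approx_def[abs_def] by (intro smooth_mult smooth_const smooth_D)

lemma D_has_derivative:
  "((\<lambda>z. D N i l (angle1 z) (angle2 z)) has_derivative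
     (\<lambda>h. D N (Suc i) l (angle1 z) (angle2 z) * (pi / a * fst h)
        + D N i (Suc l) (angle1 z) (angle2 z) * (pi * a * snd h))) (at z)"
proof -
  have d1: "(angle1 has_derivative (\<lambda>h. pi / a * fst h)) (at z)"
    unfolding angle1_def[abs_def] using a by (auto intro!: derivative_eq_intros)
  have d2: "(angle2 has_derivative (\<lambda>h. pi * a * snd h)) (at z)"
    unfolding angle2_def[abs_def] by (auto intro!: derivative_eq_intros)
  have s1: "((\<lambda>z. sinN i j (angle1 z)) has_derivative (\<lambda>h. sinN (Suc i) j (angle1 z) * (pi / a * fst h))) (at z)" for j
    using has_derivative_compose[OF d1 sinN_deriv[unfolded has_field_derivative_def]] .
  have s2: "((\<lambda>z. sinN l j (angle2 z)) has_derivative (\<lambda>h. sinN (Suc l) j (angle2 z) * (pi * a * snd h))) (at z)" for j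
    using has_derivative_compose[OF d2 sinN_deriv[unfolded has_field_derivative_def]] .
  let ?c = "\<lambda>j k. fejer N j * fejer N k * coef (1 / a\<^sup>2) (a\<^sup>2) j k"
  have "((\<lambda>z. \<Sum>j<N. \<Sum>k<N. ?c j k * (sinN i j (angle1 z) * sinN l k (angle2 z))) has_derivative
     (\<lambda>h. \<Sum>j<N. \<Sum>k<N. ?c j k * (sinN i j (angle1 z) * (sinN (Suc l) k (angle2 z) * (pi * a * snd h))
        + sinN (Suc i) j (angle1 z) * (pi / a * fst h) * sinN l k (angle2 z)))) (at z)"
    by (intro has_derivative_sum has_derivative_mult_right has_derivative_mult s1 s2)
  moreover have "(\<Sum>j<N. \<Sum>k<N. ?c j k * (sinN i j (angle1 z) * (sinN (Suc l) k (angle2 z) * (pi * a * snd h))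
        + sinN (Suc i) j (angle1 z) * (pi / a * fst h) * sinN l k (angle2 z)))
     = D N (Suc i) l (angle1 z) (angle2 z) * (pi / a * fst h)
        + D N i (Suc l) (angle1 z) (angle2 z) * (pi * a * snd h)" for h
    unfolding double_sum_def sum_distrib_right sum.distrib[symmetric]
    by (intro sum.cong refl) (simp only: distrib_left mult_ac add.commute)
  ultimately show ?thesis unfolding double_sum_def by simp
qed

lemma D_partial:
  "frechet_derivative (\<lambda>z. D N i l (angle1 z) (angle2 z)) (at z) (1, 0) = pi / a * D N (Suc i) l (angle1 z) (angle2 z)"
  "frechet_derivative (\<lambda>z. D N i l (angle1 z) (angle2 z)) (at z) (0, 1) = pi * a * D N i (Suc l) (angle1 z) (angle2 z)"
  by (subst frechet_derivative_eqI[OF D_has_derivative], simp)+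

lemma approx_partial:
  "frechet_derivative (approx N) (at z) (1, 0) = 16 / pi ^ 4 * (pi / a) * D N 1 0 (angle1 z) (angle2 z)"
  "frechet_derivative (approx N) (at z) (0, 1) = 16 / pi ^ 4 * (pi * a) * D N 0 1 (angle1 z) (angle2 z)"
  unfolding approx_def[abs_def] frechet_derivative_cmult[OF smooth_D] D_partial by simp_all

lemma grad_approx:
  "grad (approx N) z = (16 / pi ^ 4 * (pi / a) * D N 1 0 (angle1 z) (angle2 z),
     16 / pi ^ 4 * (pi * a) * D N 0 1 (angle1 z) (angle2 z))"
  by (simp only: grad_plane approx_partial)

lemma laplacian_approx:
  "(\<Sum>b\<in>Basis. frechet_derivative (\<lambda>y. frechet_derivative (approx N) (at y) b) (at z) b)
    = - (16 / pi\<^sup>2 * (fejer_sin N (angle1 z) * fejer_sin N (angle2 z)))"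
proof -
  have "(\<Sum>b\<in>Basis. frechet_derivative (\<lambda>y. frechet_derivative (approx N) (at y) b) (at z) b)
    = 16 / pi ^ 4 * (pi / a) * (pi / a * D N (Suc 1) 0 (angle1 z) (angle2 z))
      + 16 / pi ^ 4 * (pi * a) * (pi * a * D N 0 (Suc 1) (angle1 z) (angle2 z))"
    unfolding sum_Basis_plane approx_partial frechet_derivative_cmult[OF smooth_D] D_partial ..
  also have "\<dots> = 16 / pi\<^sup>2 * (1 / a\<^sup>2 * D N (Suc (Suc 0)) 0 (angle1 z) (angle2 z)
      + a\<^sup>2 * D N 0 (Suc (Suc 0)) (angle1 z) (angle2 z))"
    using a by (simp add: field_simps power2_eq_square power4_eq_xxxx)
  also have "\<dots> = - (16 / pi\<^sup>2 * (fejer_sin N (angle1 z) * fejer_sin N (angle2 z)))"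
    unfolding torsion_sum_laplacian[OF pos] fejer_sin_eq by simp
  finally show ?thesis .
qed

lemma Rect_eq: "Rect a = {- (a / 2)<..<a / 2} \<times> {- (1 / (2 * a))<..<1 / (2 * a)}"
  by (simp add: Rect_def)

lemma open_Rect: "open (Rect a)" and bounded_Rect: "bounded (Rect a)"
  unfolding Rect_def by (auto intro: open_Times bounded_Times)

lemma angle_bounds:
  assumes "z \<in> Rect a"
  shows "0 < angle1 z" "angle1 z < pi" "0 < angle2 z" "angle2 z < pi"
proof -
  have x: "- (a / 2) < fst z" "fst z < a / 2" and y: "- (1 / (2 * a)) < snd z" "snd z < 1 / (2 * a)"
    using assms by (auto simp: Rect_def)
  have e: "angle1 z = pi * (fst z / a) + pi / 2" "angle2 z = pi * (a * snd z) + pi / 2"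
    by (simp_all add: angle1_def angle2_def)
  have x': "- (1 / 2) < fst z / a" "fst z / a < 1 / 2" using x a by (auto simp: field_simps)
  show "0 < angle1 z" "angle1 z < pi"
    unfolding e using x'[THEN mult_strict_left_mono, OF pi_gt_zero] by linarith+
  have "a * (- (1 / (2 * a))) < a * snd z" "a * snd z < a * (1 / (2 * a))"
    using y[THEN mult_strict_left_mono, OF a] .
  then have y': "- (1 / 2) < a * snd z" "a * snd z < 1 / 2" using a by auto
  show "0 < angle2 z" "angle2 z < pi"
    unfolding e using y'[THEN mult_strict_left_mono, OF pi_gt_zero] by linarith+
qed

lemma approx_boundary:
  assumes "\<bar>fst z\<bar> = a / 2 \<or> \<bar>snd z\<bar> = 1 / (2 * a)"
  shows "approx N z = 0"
proof -
  consider "fst z = a / 2" | "fst z = - (a / 2)" | "snd z = 1 / (2 * a)" | "snd z = - (1 / (2 * a))"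
    using assms by linarith
  then have "(angle1 z = 0 \<or> angle1 z = pi) \<or> (angle2 z = 0 \<or> angle2 z = pi)"
  proof cases
    case 1
    have "pi / a * (a / 2) + pi / 2 = pi" using a by simp
    then show ?thesis unfolding angle1_def 1 by simp
  next
    case 2
    have "pi / a * (- (a / 2)) + pi / 2 = 0" using a by simp
    then show ?thesis unfolding angle1_def 2 by simp
  next
    case 3
    have "pi * a * (1 / (2 * a)) + pi / 2 = pi" using a by simp
    then show ?thesis unfolding angle2_def 3 by simp
  next
    case 4
    have "pi * a * (- (1 / (2 * a))) + pi / 2 = 0" using a by simp
    then show ?thesis unfolding angle2_def 4 by simp
  qed
  then have "D N 0 0 (angle1 z) (angle2 z) = 0"
    by (auto simp: double_sum_zero1 double_sum_zero2 sinN_0_at_0 sinN_0_at_pi)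
  then show ?thesis by (simp add: approx_def)
qed

section \<open>Passage to the limit\<close>

definition limit_fun :: "real \<times> real \<Rightarrow> real" where
  "limit_fun z = lim (\<lambda>N. approx N z)"

lemma approx_tendsto: "(\<lambda>N. approx N z) \<longlonglongrightarrow> limit_fun z"
proof -
  have "convergent (\<lambda>N. approx N z)"
    unfolding approx_def by (intro convergent_mult convergent_const double_sum_convergent pos) simp
  then show ?thesis by (simp add: convergent_LIMSEQ_iff limit_fun_def)
qed

lemma grad_approx_tendsto: "\<exists>g. \<forall>z. (\<lambda>N. grad (approx N) z) \<longlonglongrightarrow> g z"
proof -
  have "\<exists>g. (\<lambda>N. grad (approx N) z) \<longlonglongrightarrow> g" for z
  proof -
    have "convergent (\<lambda>N. 16 / pi ^ 4 * (pi / a) * D N 1 0 (angle1 z) (angle2 z))"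
      "convergent (\<lambda>N. 16 / pi ^ 4 * (pi * a) * D N 0 1 (angle1 z) (angle2 z))"
      by (intro convergent_mult convergent_const double_sum_convergent pos; simp)+
    then obtain p q where "(\<lambda>N. 16 / pi ^ 4 * (pi / a) * D N 1 0 (angle1 z) (angle2 z)) \<longlonglongrightarrow> p"
      "(\<lambda>N. 16 / pi ^ 4 * (pi * a) * D N 0 1 (angle1 z) (angle2 z)) \<longlonglongrightarrow> q"
      unfolding convergent_def by blast
    from tendsto_Pair[OF this] show ?thesis unfolding grad_approx by blast
  qed
  then show ?thesis by metis
qed

lemma grad_approx_bounded: "\<exists>K. \<forall>N z. norm (grad (approx N) z) \<le> K"
proof -
  define B where "B = \<bar>1 / min (1 / a\<^sup>2) (a\<^sup>2)\<bar> * (suminf odd_weight)\<^sup>2"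
  have B: "\<bar>D N 1 0 s t\<bar> \<le> B" "\<bar>D N 0 1 s t\<bar> \<le> B" for N s t
    unfolding B_def by (intro double_sum_convergent(2) pos; simp)+
  have "norm (grad (approx N) z) \<le> 16 / pi ^ 4 * (pi / a) * B + 16 / pi ^ 4 * (pi * a) * B" for N z
  proof -
    have "norm (grad (approx N) z) \<le> \<bar>16 / pi ^ 4 * (pi / a) * D N 1 0 (angle1 z) (angle2 z)\<bar>
        + \<bar>16 / pi ^ 4 * (pi * a) * D N 0 1 (angle1 z) (angle2 z)\<bar>"
      unfolding grad_approx using norm_Pair_le by (metis real_norm_def)
    also have "\<dots> \<le> 16 / pi ^ 4 * (pi / a) * B + 16 / pi ^ 4 * (pi * a) * B"
      unfolding abs_mult using a B by (intro add_mono mult_mono) auto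
    finally show ?thesis .
  qed
  then show ?thesis by blast
qed

text \<open>The Laplacian of \<open>approx N\<close> vanishes on the sides, so its convergence to -1
  inside is not uniform; the uniform bound on \<open>fejer_sin\<close> makes dominated convergence
  available.\<close>

lemma approx_equation:
  assumes t: "test_function (Rect a) \<psi>"
  shows "(\<lambda>N. LINT x|lebesgue_on (Rect a). grad (approx N) x \<bullet> grad \<psi> x)
    \<longlonglongrightarrow> (LINT x|lebesgue_on (Rect a). \<psi> x)"
proof -
  let ?M = "lebesgue_on (Rect a)"
  obtain C where C: "C > 0" "\<And>N t. 0 \<le> t \<Longrightarrow> t \<le> pi \<Longrightarrow> \<bar>fejer_sin N t\<bar> \<le> C"
    using fejer_sin_bounded by blast
  have L: "\<psi> \<in> L2 (Rect a)" by (rule test_function_L2[OF open_Rect bounded_Rect t])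
  have one: "(\<lambda>_. 1::real) \<in> L2 (Rect a)"
    by (intro L2_bounded_continuous[OF open_Rect bounded_Rect, of _ 1]) auto
  have i: "integrable ?M (\<lambda>x. 16 / pi\<^sup>2 * (C * C) * norm (\<psi> x))"
    using integrable_norm_mult_L2[OF one L] by simp
  have lap: "(\<lambda>z. 16 / pi\<^sup>2 * (fejer_sin N (angle1 z) * fejer_sin N (angle2 z))) \<in> L2 (Rect a)" for N
  proof -
    have "continuous_on UNIV (fejer_sin N)"
      by (intro continuous_at_imp_continuous_on ballI DERIV_isCont[OF fejer_sin_has_derivative])
    then have "continuous_on UNIV (\<lambda>z. 16 / pi\<^sup>2 * (fejer_sin N (angle1 z) * fejer_sin N (angle2 z)))"
      by (intro continuous_on_mult continuous_on_const
          continuous_on_compose2[OF _ smooth_continuous_on[OF smooth_angle(1)]]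
          continuous_on_compose2[OF _ smooth_continuous_on[OF smooth_angle(2)]]) auto
    then show ?thesis by (rule continuous_L2[OF open_Rect bounded_Rect])
  qed
  have [measurable]: "\<psi> \<in> borel_measurable ?M"
    "(\<lambda>z. 16 / pi\<^sup>2 * (fejer_sin N (angle1 z) * fejer_sin N (angle2 z))) \<in> borel_measurable ?M" for N
    using L lap L2_measurable by blast+
  have "(\<lambda>N. LINT x|?M. 16 / pi\<^sup>2 * (fejer_sin N (angle1 x) * fejer_sin N (angle2 x)) * \<psi> x)
    \<longlonglongrightarrow> (LINT x|?M. \<psi> x)"
  proof (rule integral_dominated_convergence[OF _ _ i])
    show "AE x in ?M. (\<lambda>N. 16 / pi\<^sup>2 * (fejer_sin N (angle1 x) * fejer_sin N (angle2 x)) * \<psi> x) \<longlonglongrightarrow> \<psi> x"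
    proof (intro AE_I2)
      fix x assume "x \<in> space ?M"
      then have "x \<in> Rect a" by simp
      note b = angle_bounds[OF this]
      have "(\<lambda>N. 16 / pi\<^sup>2 * (fejer_sin N (angle1 x) * fejer_sin N (angle2 x)) * \<psi> x)
          \<longlonglongrightarrow> 16 / pi\<^sup>2 * (pi / 4 * (pi / 4)) * \<psi> x"
        by (intro tendsto_intros fejer_sin_tendsto b)
      then show "(\<lambda>N. 16 / pi\<^sup>2 * (fejer_sin N (angle1 x) * fejer_sin N (angle2 x)) * \<psi> x) \<longlonglongrightarrow> \<psi> x"
        by (simp add: power2_eq_square)
    qed
    show "AE x in ?M. norm (16 / pi\<^sup>2 * (fejer_sin N (angle1 x) * fejer_sin N (angle2 x)) * \<psi> x)
        \<le> 16 / pi\<^sup>2 * (C * C) * norm (\<psi> x)" for N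
    proof (intro AE_I2)
      fix x assume "x \<in> space ?M"
      then have "x \<in> Rect a" by simp
      note b = angle_bounds[OF this]
      have "\<bar>fejer_sin N (angle1 x)\<bar> * \<bar>fejer_sin N (angle2 x)\<bar> \<le> C * C"
        using b C(1) by (intro mult_mono C(2)) auto
      then have "16 / pi\<^sup>2 * (\<bar>fejer_sin N (angle1 x)\<bar> * \<bar>fejer_sin N (angle2 x)\<bar>) * \<bar>\<psi> x\<bar>
          \<le> 16 / pi\<^sup>2 * (C * C) * \<bar>\<psi> x\<bar>"
        by (intro mult_right_mono mult_left_mono) auto
      then show "norm (16 / pi\<^sup>2 * (fejer_sin N (angle1 x) * fejer_sin N (angle2 x)) * \<psi> x)
        \<le> 16 / pi\<^sup>2 * (C * C) * norm (\<psi> x)" by (simp add: abs_mult)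
    qed
  qed measurable
  moreover have "(LINT x|?M. grad (approx N) x \<bullet> grad \<psi> x)
      = (LINT x|?M. 16 / pi\<^sup>2 * (fejer_sin N (angle1 x) * fejer_sin N (angle2 x)) * \<psi> x)" for N
    unfolding integral_grad_inner_grad[OF open_Rect bounded_Rect smooth_approx t] laplacian_approx
    by simp
  ultimately show ?thesis by simp
qed

lemma torsion_function_Rect: "torsion_function (Rect a) = (\<lambda>z. if z \<in> Rect a then limit_fun z else 0)"
proof -
  obtain K where K: "\<And>N z. norm (grad (approx N) z) \<le> K" using grad_approx_bounded by blast
  obtain g where g: "\<And>z. (\<lambda>N. grad (approx N) z) \<longlonglongrightarrow> g z" using grad_approx_tendsto by blast
  have "is_torsion_function (Rect a) (\<lambda>z. if z \<in> Rect a then limit_fun z else 0)"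
    unfolding Rect_eq
  proof (rule is_torsion_function_rectangleI[OF _ _ smooth_approx K approx_boundary approx_tendsto g])
    show "a / 2 > 0" "1 / (2 * a) > 0" using a by auto
  qed (use approx_equation[unfolded Rect_eq] in auto)
  then show ?thesis
    unfolding torsion_function_def
    using torsion_function_unique[OF open_Rect bounded_Rect] by blast
qed

text \<open>The centre dominates every other point at each finite stage, and weak inequalities
  survive the limit.\<close>

lemma torsion_max_Rect: "torsion_max (Rect a) = limit_fun (0, 0)"
proof -
  have z0: "(0, 0) \<in> Rect a" using a by (simp add: Rect_def)
  have le: "limit_fun z \<le> limit_fun (0, 0)" if z: "z \<in> Rect a" for z
  proof (rule LIMSEQ_le[OF approx_tendsto approx_tendsto])
    have "approx N z \<le> approx N (0, 0)" for N
    proof -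
      have "D N 0 0 (angle1 z) (angle2 z) \<le> D N 0 0 (pi / 2) (pi / 2)"
        using angle_bounds[OF z] by (intro torsion_sum_le_center pos) auto
      then show ?thesis unfolding approx_def by (intro mult_left_mono) (auto simp: angle1_def angle2_def)
    qed
    then show "\<exists>M. \<forall>N\<ge>M. approx N z \<le> approx N (0, 0)" by blast
  qed
  have "(SUP x\<in>Rect a. if x \<in> Rect a then limit_fun x else 0) = limit_fun (0, 0)"
  proof (rule cSup_eq_maximum)
    show "limit_fun (0, 0) \<in> (\<lambda>x. if x \<in> Rect a then limit_fun x else 0) ` Rect a"
      using z0 by force
  qed (use le in auto)
  then show ?thesis by (simp add: torsion_max_def torsion_function_Rect)
qed

lemma center_tendsto:
  "(\<lambda>N. 16 / pi ^ 4 * torsion_sum (1 / a\<^sup>2) (a\<^sup>2) N (pi / 2) (pi / 2)) \<longlonglongrightarrow> torsion_max (Rect a)"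
  using approx_tendsto[of "(0, 0)"] by (simp add: torsion_max_Rect approx_def angle1_def angle2_def)

end

theorem theorem5:
  fixes a :: real
  assumes "a > 0"
  shows "torsion_max (Rect 1) - torsion_max (Rect a) \<ge> (a\<^sup>2 - 1)\<^sup>2 / (24 * (1 + a ^ 4))"
proof -
  interpret one: rectangle_torsion 1 by unfold_locales simp
  interpret ra: rectangle_torsion a by unfold_locales (rule assms)
  obtain L where L: "L \<longlonglongrightarrow> pi ^ 4 / 192"
    "\<And>N. N > 0 \<Longrightarrow> L N \<le> 2 * (\<Sum>k<N. (fejer N k)\<^sup>2 / real (2 * k + 1) ^ 4)
        - (\<Sum>k<N. fejer N k / (real (2 * k + 1))\<^sup>2)\<^sup>2"
    using fejer_diagonal_lower_bound by blast
  let ?\<alpha> = "1 / a\<^sup>2" and ?\<beta> = "a\<^sup>2"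
  let ?T = "\<lambda>N. torsion_sum 1 1 N (pi / 2) (pi / 2)" and ?Ta = "\<lambda>N. torsion_sum ?\<alpha> ?\<beta> N (pi / 2) (pi / 2)"
  define c where "c = 1 - 2 / (?\<alpha> + ?\<beta>)"
  have c: "c = (a\<^sup>2 - 1)\<^sup>2 / (1 + a ^ 4)"
  proof -
    have "?\<alpha> + ?\<beta> = (1 + a ^ 4) / a\<^sup>2" using assms by (simp add: field_simps power2_eq_square power4_eq_xxxx)
    moreover have "1 + a ^ 4 > 0" using assms by (simp add: add_pos_pos)
    ultimately have "c = (1 + a ^ 4 - 2 * a\<^sup>2) / (1 + a ^ 4)" by (simp add: c_def diff_divide_distrib)
    then show ?thesis by (simp add: power2_diff flip: power_mult)
  qed
  have c0: "c \<ge> 0" using assms by (simp add: c add_pos_pos)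
  \<comment> \<open>8/pi^4 is half of 16/pi^4, because \<open>torsion_sum_center_diff\<close> bounds
    twice the difference; 8/192 = 1/24.\<close>
  have "c / 24 = 8 / pi ^ 4 * (c * (pi ^ 4 / 192))" by simp
  also have "\<dots> \<le> torsion_max (Rect 1) - torsion_max (Rect a)"
  proof (rule LIMSEQ_le)
    show "(\<lambda>N. 8 / pi ^ 4 * (c * L N)) \<longlonglongrightarrow> 8 / pi ^ 4 * (c * (pi ^ 4 / 192))"
      by (intro tendsto_intros L)
    show "(\<lambda>N. 16 / pi ^ 4 * ?T N - 16 / pi ^ 4 * ?Ta N) \<longlonglongrightarrow> torsion_max (Rect 1) - torsion_max (Rect a)"
      using tendsto_diff[OF one.center_tendsto ra.center_tendsto] by simp
    have "8 / pi ^ 4 * (c * L N) \<le> 16 / pi ^ 4 * ?T N - 16 / pi ^ 4 * ?Ta N" if N: "N > 0" for N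
    proof -
      have "c * L N \<le> 2 * (?T N - ?Ta N)"
        using mult_left_mono[OF L(2)[OF N] c0] torsion_sum_center_diff[of ?\<alpha> ?\<beta> N] assms
        unfolding c_def by simp
      then have "8 / pi ^ 4 * (c * L N) \<le> 8 / pi ^ 4 * (2 * (?T N - ?Ta N))"
        by (intro mult_left_mono) auto
      then show ?thesis by (simp add: diff_divide_distrib)
    qed
    then show "\<exists>M. \<forall>N\<ge>M. 8 / pi ^ 4 * (c * L N) \<le> 16 / pi ^ 4 * ?T N - 16 / pi ^ 4 * ?Ta N"
      by (intro exI[of _ 1]) auto
  qed
  finally show ?thesis by (simp add: c mult.commute)
qed

end
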